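(* Let $1\le m'\le m\le r$ be integers, let $n=mr$, $k=m'r$, let $u=(s_1s_2\cdots s_r)^{m}$ and let $\mathbf i=(1,\dots,r,\,1,\dots,r,\,\dots,\,1,\dots,r)$ ($m$ cycles) be its reduced word, so that $i_k=i_n=r$. Let $\mathbf Y=(Y_{1,1},\dots,Y_{1,r},\dots,Y_{m,1},\dots,Y_{m,r})\in(\mathbb C^\times)^n$. Then $$\Delta^L(k;\mathbf i)(\mathbf Y)=\sum_{p\in X^r(m,m')}Q(p),$$ where $X^r(m,m')$ is the set of paths and $Q(p)$ the label of a path as defined in the context.
   Context: Let $G$ be the simply connected simple algebraic group over $\mathbb C$ of type $\mathrm B_r$, $B,B_-$ opposite Borel subgroups, $N\subset B$, $N_-\subset B_-$ their unipotent radicals, $H=B\cap B_-$, $W=\mathrm{Norm}_G(H)/H$ the Weyl group with simple reflections $s_1,\dots,s_r$. Chevalley generators $e_i,f_i$ and simple coroots $h_i$ of $\mathrm{Lie}(G)$ are taken for the Cartan matrix $a_{ij}=\alpha_j(h_i)$ with $a_{ii}=2$, $a_{ij}=-1$ if $|i-j|=1$ and $(i,j)\ne(r,r-1)$, $a_{r,r-1}=-2$, and $a_{ij}=0$ otherwise. $\Lambda_i$ is the $i$-th fundamental weight. Put $x_i(t)=\exp(te_i)$, $y_i(t)=\exp(tf_i)$, $\alpha_i^\vee(t)=t^{h_i}$, $x_{-i}(t)=y_i(t)\alpha_i^\vee(t^{-1})$, $\overline{s_i}=x_i(-1)y_i(1)x_i(-1)$; for a reduced expression $w=s_{j_1}\cdots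 s_{j_p}$ put $\overline w=\overline{s_{j_1}}\cdots\overline{s_{j_p}}$. For $x\in G_0=N_-HN$ write $x=[x]_-[x]_0[x]_+$ accordingly; $\Delta_{w\Lambda_i,\Lambda_i}$ is the regular function on $G$ whose restriction to $\overline wG_0$ is $x\mapsto([\overline w^{-1}x]_0)^{\Lambda_i}$. For a reduced word $\mathbf i=(i_1,\dots,i_n)$ put $u_{\le k}=s_{i_1}\cdots s_{i_k}$, $\Delta(k;\mathbf i)=\Delta_{u_{\le k}\Lambda_{i_k},\Lambda_{i_k}}$, $x^L_{\mathbf i}(t_1,\dots,t_n)=x_{-i_1}(t_1)\cdots x_{-i_n}(t_n)$, and $\Delta^L(k;\mathbf i)(\mathbf Y)=\Delta(k;\mathbf i)(x^L_{\mathbf i}(\mathbf Y))$ (entries of $\mathbf Y$ inserted in the listed order). Paths. Vertices are the symbols $\mathrm{vt}(s;k_1,\dots,k_t)$ with $0\le s\le m$, $0\le t\le m-s$, $k_i\in\{1,\dots,r\}$, $k_1<k_2<\cdots<k_t$; directed edges go from vertices with first entry $s$ to vertices with first entry $s-1$. $X^r(m,m')$ is the set of directed paths $p$ from $\mathrm{vt}(m;\ )$ (with $t=0$) to $\mathrm{vt}(0;1,2,\dots,m')$ such that for each edge $\mathrm{vt}(s;k^{(s)}_1,\dots,k^{(s)}_t)\to\mathrm{vt}(s-1;k^{(s-1)}_1,\dots,k^{(s-1)}_{t'})$ of $p$ ($1\le s\le m$): (i) $t'=t$ or $t'=t+1$, and if $k^{(s)}_t=r$ then $t'=t$; (ii)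 $k^{(s-1)}_i\le k^{(s)}_i<k^{(s-1)}_{i+1}$ for $1\le i\le t$ (the second inequality when $i+1\le t'$); (iii) $k^{(0)}_i=i$ for $1\le i\le m'$. Labels. With the convention $Y_{s,0}=1$, the label of an edge $\mathrm{vt}(s;i_1,\dots,i_t)\to\mathrm{vt}(s-1;j_1,\dots,j_{t'})$ is $$\begin{cases}\dfrac{Y_{s,i_1}}{Y_{s,j_1-1}}\dfrac{Y_{s,i_2}}{Y_{s,j_2-1}}\cdots\dfrac{Y_{s,i_t}}{Y_{s,j_t-1}}\cdot\dfrac1{Y_{s,r}}&\text{if }t'=t,\\[2mm]\dfrac{Y_{s,i_1}}{Y_{s,j_1-1}}\dfrac{Y_{s,i_2}}{Y_{s,j_2-1}}\cdots\dfrac{Y_{s,i_t}}{Y_{s,j_t-1}}\cdot\dfrac1{Y_{s,j_{t+1}-1}}&\text{if }t'=t+1,\end{cases}$$ and $Q(p)$ is the product of the labels of all $m$ edges of $p$.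
   Formalization: In the label of an edge with t'=t, the factor 1/Y_{s,r} is omitted when i_t=r (t≥1); with it the formula fails, e.g. for r=m=2, m'=1, where the minor is Y_{1,1}/Y_{1,2}+Y_{1,2}/Y_{2,1}+1/Y_{2,2} but the labels would give 1/Y_{2,1} as middle term. *)

theory Defs
  imports "Jordan_Normal_Form.Matrix" "HOL-Algebra.Group_Action" "HOL-Algebra.Generated_Groups"
    "HOL-Library.FuncSet" Complex_Main
begin

section \<open>The group of type B and its spin representation\<close>

text \<open>
  The simply connected group of type \<open>B\<^sub>r\<close> is the group \<open>Spin\<close> of rank \<open>r\<close>, realised as the
  Chevalley group of the spin representation. The weights of that representation
  generate the whole weight lattice, so the Chevalley group is the simply connected one.

  The basis vectors of the \<open>2^r\<close>-dimensional spin representation are indexed by \<open>a < 2^r\<close>; the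
  vector number \<open>a\<close> has weight \<open>1/2 \<Sum>\<^sub>j \<plusminus>\<epsilon>\<^sub>j\<close>, with the minus sign at \<open>j\<close> iff bit \<open>j - 1\<close> of
  \<open>a\<close> is set. Thus \<open>a = 0\<close> is the highest weight \<open>\<Lambda>\<^sub>r\<close>.
\<close>

definition spin_sign :: "nat \<Rightarrow> nat \<Rightarrow> int" where
  "spin_sign a j = (if bit a (j - 1) then - 1 else 1)"

text \<open>Coordinates of \<open>\<alpha>\<^sub>i\<close> and \<open>h\<^sub>i\<close> in the basis \<open>\<epsilon>\<^sub>j\<close> and in its dual basis:
  \<open>\<alpha>\<^sub>i = \<epsilon>\<^sub>i - \<epsilon>\<^sub>i\<^sub>+\<^sub>1\<close> for \<open>i < r\<close> and \<open>\<alpha>\<^sub>r = \<epsilon>\<^sub>r\<close>.\<close>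

definition simple_root :: "nat \<Rightarrow> nat \<Rightarrow> nat \<Rightarrow> int" where
  "simple_root r i j =
     (if j = i then 1 else if i < r \<and> j = i + 1 then - 1 else 0)"

definition simple_coroot :: "nat \<Rightarrow> nat \<Rightarrow> nat \<Rightarrow> int" where
  "simple_coroot r i j = (if i = r then 2 else 1) * simple_root r i j"

definition cartan :: "nat \<Rightarrow> nat \<Rightarrow> nat \<Rightarrow> int" where
  "cartan r i j =
     (if i = j then 2
      else if i = r \<and> j + 1 = r then - 2
      else if i = j + 1 \<or> j = i + 1 then - 1
      else 0)"

lemma cartan_eq_pairing:
  assumes "i \<in> {1..r}" "j \<in> {1..r}"
  shows "(\<Sum>k = 1..r. simple_root r j k * simple_coroot r i k) = cartan r i j"
proof -
  let ?c = "if i = r then 2 else 1 :: int"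
  have *: "simple_root r j k =
      (if k = j then 1 else 0) - (if k = j + 1 then (if j < r then 1 else 0) else 0)" for k
    by (simp add: simple_root_def)
  have "(\<Sum>k = 1..r. simple_root r j k * simple_coroot r i k)
      = (\<Sum>k = 1..r. (if k = j then simple_coroot r i k else 0)
          - (if k = j + 1 then (if j < r then simple_coroot r i k else 0) else 0))"
    by (intro sum.cong refl) (auto simp: *)
  also have "\<dots> = simple_coroot r i j - (if j < r then simple_coroot r i (j + 1) else 0)"
    using assms by (auto simp: sum_subtractf)
  also have "\<dots> = cartan r i j"
    using assms by (auto simp: simple_coroot_def simple_root_def cartan_def)
  finally show ?thesis .
qed

text \<open>The value of \<open>h\<^sub>i\<close> on the weight of the vector number \<open>a\<close>. The division is exact.\<close>

definition spin_pairing :: "nat \<Rightarrow> nat \<Rightarrow> nat \<Rightarrow> int" where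
  "spin_pairing r i a = (\<Sum>j = 1..r. simple_coroot r i j * spin_sign a j) div 2"

text \<open>The spin representation is minuscule: \<open>e\<^sub>i\<close> (\<open>f\<^sub>i\<close>) maps the basis vector of weight \<open>\<mu>\<close> to
  the one of weight \<open>\<mu> + \<alpha>\<^sub>i\<close> (\<open>\<mu> - \<alpha>\<^sub>i\<close>) if that is a weight, and to \<open>0\<close> otherwise. Since
  \<open>spin_sign\<close> lists twice the coordinates of the weight, roots occur with a factor 2.\<close>

definition gen_e :: "nat \<Rightarrow> nat \<Rightarrow> complex mat" where
  "gen_e r i = mat (2 ^ r) (2 ^ r) (\<lambda>(b, a).
     if \<forall>j\<in>{1..r}. spin_sign b j = spin_sign a j + 2 * simple_root r i j then 1 else 0)"

definition gen_f :: "nat \<Rightarrow> nat \<Rightarrow> complex mat" where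
  "gen_f r i = mat (2 ^ r) (2 ^ r) (\<lambda>(b, a).
     if \<forall>j\<in>{1..r}. spin_sign b j = spin_sign a j - 2 * simple_root r i j then 1 else 0)"

definition mat_exp :: "complex mat \<Rightarrow> complex mat" where
  "mat_exp A = mat (dim_row A) (dim_row A) (\<lambda>(b, a). \<Sum>k. (A ^\<^sub>m k) $$ (b, a) / fact k)"

definition gen_x :: "nat \<Rightarrow> nat \<Rightarrow> complex \<Rightarrow> complex mat" where
  "gen_x r i t = mat_exp (t \<cdot>\<^sub>m gen_e r i)"

definition gen_y :: "nat \<Rightarrow> nat \<Rightarrow> complex \<Rightarrow> complex mat" where
  "gen_y r i t = mat_exp (t \<cdot>\<^sub>m gen_f r i)"

definition coroot_elt :: "nat \<Rightarrow> nat \<Rightarrow> complex \<Rightarrow> complex mat" where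
  "coroot_elt r i t =
     mat (2 ^ r) (2 ^ r) (\<lambda>(b, a). if b = a then t powi spin_pairing r i a else 0)"

definition GL :: "nat \<Rightarrow> complex mat monoid" where
  "GL r = units_of (ring_mat TYPE(complex) (2 ^ r) ())"

definition Spin :: "nat \<Rightarrow> complex mat monoid" where
  "Spin r = GL r \<lparr> carrier := generate (GL r)
     ((\<Union>i\<in>{1..r}. range (gen_x r i)) \<union> (\<Union>i\<in>{1..r}. range (gen_y r i))) \<rparr>"

text \<open>\<open>N\<close>, \<open>N\<^sub>-\<close> are the unipotent radicals of the opposite Borel subgroups \<open>B = HN\<close>,
  \<open>B\<^sub>- = N\<^sub>-H\<close>, and \<open>H = B \<inter> B\<^sub>-\<close>.\<close>

definition unip_plus :: "nat \<Rightarrow> complex mat set" where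
  "unip_plus r = generate (Spin r) (\<Union>i\<in>{1..r}. range (gen_x r i))"

definition unip_minus :: "nat \<Rightarrow> complex mat set" where
  "unip_minus r = generate (Spin r) (\<Union>i\<in>{1..r}. range (gen_y r i))"

definition torus :: "nat \<Rightarrow> complex mat set" where
  "torus r = generate (Spin r) (\<Union>i\<in>{1..r}. coroot_elt r i ` (- {0}))"

text \<open>Left-to-right product of a list in a monoid.\<close>

definition list_mult :: "('a, 'b) monoid_scheme \<Rightarrow> 'a list \<Rightarrow> 'a" where
  "list_mult G xs = foldr (mult G) xs (one G)"

section \<open>The Weyl group\<close>

definition weyl_group :: "nat \<Rightarrow> complex mat set monoid" where
  "weyl_group r = (Spin r \<lparr> carrier := normalizer (Spin r) (torus r) \<rparr>) Mod torus r"

definition simple_lift :: "nat \<Rightarrow> nat \<Rightarrow> complex mat" where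
  "simple_lift r i = list_mult (Spin r) [gen_x r i (- 1), gen_y r i 1, gen_x r i (- 1)]"

definition simple_refl :: "nat \<Rightarrow> nat \<Rightarrow> complex mat set" where
  "simple_refl r i = torus r #>\<^bsub>Spin r\<^esub> simple_lift r i"

definition weyl_word :: "nat \<Rightarrow> nat list \<Rightarrow> complex mat set" where
  "weyl_word r js = list_mult (weyl_group r) (map (simple_refl r) js)"

definition reduced_word :: "nat \<Rightarrow> complex mat set \<Rightarrow> nat list \<Rightarrow> bool" where
  "reduced_word r w js \<longleftrightarrow> set js \<subseteq> {1..r} \<and> weyl_word r js = w \<and>
     (\<forall>ks. set ks \<subseteq> {1..r} \<and> weyl_word r ks = w \<longrightarrow> length js \<le> length ks)"

text \<open>The choice is immaterial: by Tits, the lift is the same for all reduced words of \<open>w\<close>.\<close>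

definition weyl_lift :: "nat \<Rightarrow> complex mat set \<Rightarrow> complex mat" where
  "weyl_lift r w = list_mult (Spin r) (map (simple_lift r) (SOME js. reduced_word r w js))"

section \<open>Generalized minors\<close>

definition big_cell :: "nat \<Rightarrow> complex mat set" where
  "big_cell r = unip_minus r <#>\<^bsub>Spin r\<^esub> torus r <#>\<^bsub>Spin r\<^esub> unip_plus r"

definition torus_part :: "nat \<Rightarrow> complex mat \<Rightarrow> complex mat" where
  "torus_part r x = (THE h. h \<in> torus r \<and>
     (\<exists>n'\<in>unip_minus r. \<exists>n\<in>unip_plus r. x = n' \<otimes>\<^bsub>Spin r\<^esub> h \<otimes>\<^bsub>Spin r\<^esub> n))"

text \<open>A weight \<open>\<lambda>\<close> is given by its values \<open>\<lambda>(h\<^sub>j)\<close>, i.e. by its coordinates in the basis of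
  fundamental weights; the character takes \<open>\<Prod>\<^sub>j t\<^sub>j^h\<^sub>j\<close> to \<open>\<Prod>\<^sub>j t\<^sub>j^(\<lambda>(h\<^sub>j))\<close>. As the group is
  simply connected, the \<open>t\<^sub>j\<close> are uniquely determined.\<close>

definition torus_char :: "nat \<Rightarrow> (nat \<Rightarrow> int) \<Rightarrow> complex mat \<Rightarrow> complex" where
  "torus_char r lam h = (THE c. \<exists>t. (\<forall>j\<in>{1..r}. t j \<noteq> 0) \<and>
     h = list_mult (Spin r) (map (\<lambda>j. coroot_elt r j (t j)) [1..<r + 1]) \<and>
     c = (\<Prod>j = 1..r. t j powi lam j))"

definition fund_weight :: "nat \<Rightarrow> nat \<Rightarrow> int" where
  "fund_weight i j = (if j = i then 1 else 0)"

inductive_set poly_fun :: "nat \<Rightarrow> (complex mat \<Rightarrow> complex) set" for r where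
  const: "(\<lambda>x. c) \<in> poly_fun r"
| entry: "i < 2 ^ r \<Longrightarrow> j < 2 ^ r \<Longrightarrow> (\<lambda>x. x $$ (i, j)) \<in> poly_fun r"
| add: "p \<in> poly_fun r \<Longrightarrow> q \<in> poly_fun r \<Longrightarrow> (\<lambda>x. p x + q x) \<in> poly_fun r"
| mult: "p \<in> poly_fun r \<Longrightarrow> q \<in> poly_fun r \<Longrightarrow> (\<lambda>x. p x * q x) \<in> poly_fun r"

text \<open>The group is a Zariski closed subgroup of \<open>SL\<close>, hence its regular functions are the
  restrictions of polynomials in the matrix entries.\<close>

definition regular_fun :: "nat \<Rightarrow> (complex mat \<Rightarrow> complex) set" where
  "regular_fun r = (\<lambda>p. restrict p (carrier (Spin r))) ` poly_fun r"

text \<open>\<open>gen_minor r w i\<close> is \<open>\<Delta>\<close> with indices \<open>w\<Lambda>\<^sub>i\<close>, \<open>\<Lambda>\<^sub>i\<close>.\<close>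

definition gen_minor :: "nat \<Rightarrow> complex mat set \<Rightarrow> nat \<Rightarrow> complex mat \<Rightarrow> complex" where
  "gen_minor r w i = (THE D. D \<in> regular_fun r \<and>
     (\<forall>x \<in> weyl_lift r w <#\<^bsub>Spin r\<^esub> big_cell r.
        D x = torus_char r (fund_weight i)
                (torus_part r (inv\<^bsub>Spin r\<^esub> (weyl_lift r w) \<otimes>\<^bsub>Spin r\<^esub> x))))"

text \<open>Words are 0-indexed lists, so the letter \<open>i\<^sub>k\<close> is \<open>is ! (k - 1)\<close>.\<close>

definition minor_at :: "nat \<Rightarrow> nat \<Rightarrow> nat list \<Rightarrow> complex mat \<Rightarrow> complex" where
  "minor_at r k is = gen_minor r (weyl_word r (take k is)) (is ! (k - 1))"

definition x_minus :: "nat \<Rightarrow> nat \<Rightarrow> complex \<Rightarrow> complex mat" where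
  "x_minus r i t = gen_y r i t \<otimes>\<^bsub>Spin r\<^esub> coroot_elt r i (inverse t)"

definition x_L :: "nat \<Rightarrow> nat list \<Rightarrow> complex list \<Rightarrow> complex mat" where
  "x_L r is ts = list_mult (Spin r) (map2 (x_minus r) is ts)"

definition minor_L :: "nat \<Rightarrow> nat \<Rightarrow> nat list \<Rightarrow> complex list \<Rightarrow> complex" where
  "minor_L r k is ts = minor_at r k is (x_L r is ts)"

definition cyclic_word :: "nat \<Rightarrow> nat \<Rightarrow> nat list" where
  "cyclic_word r m = concat (replicate m [1..<r + 1])"

definition list_coords :: "nat \<Rightarrow> nat \<Rightarrow> (nat \<Rightarrow> nat \<Rightarrow> complex) \<Rightarrow> complex list" where
  "list_coords r m Y = concat (map (\<lambda>s. map (Y s) [1..<r + 1]) [1..<m + 1])"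

section \<open>Paths\<close>

text \<open>The vertex \<open>vt(s; k\<^sub>1, \<dots>, k\<^sub>t)\<close> is the pair \<open>(s, [k\<^sub>1, \<dots>, k\<^sub>t])\<close>; a path is its list of
  vertices.\<close>

type_synonym vertex = "nat \<times> nat list"

definition vertices :: "nat \<Rightarrow> nat \<Rightarrow> vertex set" where
  "vertices r m = {(s, ks). s \<le> m \<and> length ks \<le> m - s \<and> set ks \<subseteq> {1..r} \<and> sorted_wrt (<) ks}"

fun is_edge :: "nat \<Rightarrow> vertex \<Rightarrow> vertex \<Rightarrow> bool" where
  "is_edge r (s, ks) (s', js) \<longleftrightarrow> s = s' + 1 \<and>
     (length js = length ks \<or> length js = length ks + 1) \<and>
     (ks \<noteq> [] \<and> last ks = r \<longrightarrow> length js = length ks) \<and>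
     (\<forall>i < length ks. js ! i \<le> ks ! i \<and> (i + 1 < length js \<longrightarrow> ks ! i < js ! (i + 1)))"

definition paths :: "nat \<Rightarrow> nat \<Rightarrow> nat \<Rightarrow> vertex list set" where
  "paths r m m' = {p. p \<noteq> [] \<and> set p \<subseteq> vertices r m \<and>
     hd p = (m, []) \<and> last p = (0, [1..<m' + 1]) \<and>
     (\<forall>l. Suc l < length p \<longrightarrow> is_edge r (p ! l) (p ! Suc l))}"

definition Y_ext :: "(nat \<Rightarrow> nat \<Rightarrow> complex) \<Rightarrow> nat \<Rightarrow> nat \<Rightarrow> complex" where
  "Y_ext Y s i = (if i = 0 then 1 else Y s i)"

text \<open>
  For \<open>t' = t\<close> the factor \<open>1/Y\<^sub>s\<^sub>,\<^sub>r\<close> is the eigenvalue of \<open>\<alpha>\<^sub>r\<^sup>\<or>(Y\<^sub>s\<^sub>,\<^sub>r\<^sup>-\<^sup>1)\<close> on a basis vector with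
  \<open>+\<epsilon>\<^sub>r/2\<close> in its weight. It is present only if \<open>r\<close> is not among the \<open>k\<^sub>i\<close>: if \<open>k\<^sub>t = r\<close>, the
  sign is \<open>-\<close>, the eigenvalue is \<open>Y\<^sub>s\<^sub>,\<^sub>r\<close>, and this is already the numerator of the last
  fraction. Keeping \<open>1/Y\<^sub>s\<^sub>,\<^sub>r\<close> also for \<open>k\<^sub>t = r\<close> makes the path formula false: for \<open>r = m = 2\<close>,
  \<open>m' = 1\<close> the minor is \<open>1/Y\<^sub>2\<^sub>,\<^sub>2 + Y\<^sub>1\<^sub>,\<^sub>2/Y\<^sub>2\<^sub>,\<^sub>1 + Y\<^sub>1\<^sub>,\<^sub>1/Y\<^sub>1\<^sub>,\<^sub>2\<close>, while the middle term would
  become \<open>1/Y\<^sub>2\<^sub>,\<^sub>1\<close>.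
\<close>

fun edge_label :: "nat \<Rightarrow> (nat \<Rightarrow> nat \<Rightarrow> complex) \<Rightarrow> vertex \<Rightarrow> vertex \<Rightarrow> complex" where
  "edge_label r Y (s, ks) (s', js) =
     (\<Prod>i < length ks. Y_ext Y s (ks ! i) / Y_ext Y s (js ! i - 1)) *
     (if length js = length ks
      then (if ks \<noteq> [] \<and> last ks = r then 1 else 1 / Y_ext Y s r)
      else 1 / Y_ext Y s (js ! length ks - 1))"

definition path_label :: "nat \<Rightarrow> (nat \<Rightarrow> nat \<Rightarrow> complex) \<Rightarrow> vertex list \<Rightarrow> complex" where
  "path_label r Y p = (\<Prod>l < length p - 1. edge_label r Y (p ! l) (p ! Suc l))"

end

theory Submission
  imports Defs "HOL-Combinatorics.Transposition" "HOL-Library.Nat_Bijection"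
begin

text \<open>
The fundamental weight \<open>\<Lambda>\<^sub>r\<close> is the highest weight of the spin representation itself, so the minor
can be read off a single matrix. On the torus the character \<open>\<Lambda>\<^sub>r\<close> is the entry at \<open>(0, 0)\<close>, and on the
big cell \<open>N\<^sub>- H N\<close> this entry only sees the torus part, because \<open>N\<^sub>-\<close> and \<open>N\<close> are unitriangular for the
height of the weights. Hence the minor of \<open>x\<close> with indices \<open>w\<Lambda>\<^sub>r\<close>, \<open>\<Lambda>\<^sub>r\<close> is the entry at \<open>(0, 0)\<close> of
\<open>w\<inverse>x\<close>, with \<open>w\<close> lifted to the group, provided that a regular function is determined by its values on
a translate of the big cell (\<open>gen_minor_eq\<close>).

The density of the big cell (\<open>Spin_subset_closure\<close>) comes from rank one. Its Zariski closure is stable under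
right multiplication by \<open>N\<close> and \<open>H\<close>. To multiply by \<open>y\<^sub>i(t)\<close>, move this factor to the left through a product
of elements \<open>x\<^sub>j(a)\<close>: it commutes with them for \<open>j \<noteq> i\<close>, and for \<open>j = i\<close> the identity
\<open>x\<^sub>i(a) y\<^sub>i(t) = y\<^sub>i(t/d) d\<^sup>h x\<^sub>i(a/d)\<close> with \<open>d = 1 + at\<close> applies. The one value of \<open>t\<close> with \<open>d = 0\<close> is
reached by continuity.

The lift of a Weyl group element maps the highest weight vector to plus or minus a basis vector, and the sign
must be shown to be plus for whichever reduced word is chosen to define the lift. Lengths decide this. The
words act on a regular dominant weight \<open>\<lambda>\<close>, and every letter changes the number of positive roots that are
negative on the image of \<open>\<lambda>\<close> by at most one. For the \<open>m\<close>-th power of the Coxeter word this number is \<open>m r\<close>,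
the number of letters; so the word is reduced, and along any other reduced word of the same element the number
grows at every letter. A letter at which it grows does not raise the weight in the orbit of \<open>\<Lambda>\<^sub>r\<close> that it meets,
and raising this weight is the only way a minus sign could enter (\<open>word_lift_highest_vector\<close>). Since the power \<open>m'\<close> of the Coxeter element makes
exactly the first \<open>m'\<close> coordinates of \<open>\<Lambda>\<^sub>r\<close> negative, the minor is a matrix entry of the product of the
\<open>x\<^sub>-\<^sub>i(Y)\<close>, in the row of that weight and the column of \<open>\<Lambda>\<^sub>r\<close>.

It remains to expand this entry. A factor \<open>x\<^sub>-\<^sub>i\<close> maps a basis vector to a multiple of itself, plus at most one other
basis vector. For \<open>i < r\<close> that one arises by moving a minus sign from position \<open>i + 1\<close> to position \<open>i\<close>; for
\<open>i = r\<close> a minus sign enters at \<open>r\<close>. As minus signs are conserved for \<open>i < r\<close>, the intermediate vectors in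
\<open>x\<^sub>-\<^sub>1 \<cdots> x\<^sub>-\<^sub>r\<close> are determined by the two ends, so every entry of one cycle is a single monomial or
\<open>0\<close> (\<open>partial_cycle_entry\<close>). The positions of the minus signs at the two ends must interlace, which is the
edge relation, and the monomial is the edge label. Multiplying the \<open>m\<close> cycles sums over all paths.
\<close>

section \<open>Reflections on the weights of the spin representation\<close>

text \<open>The action of \<open>s\<^sub>i\<close> on the indices of the weight vectors; bit \<open>j - 1\<close> of an index holds the sign at \<open>j\<close>.\<close>

definition reflect :: "nat \<Rightarrow> nat \<Rightarrow> nat \<Rightarrow> nat" where
  "reflect r i a =
     (if i = r then flip_bit (i - 1) a
      else if bit a (i - 1) = bit a i then a
      else flip_bit (i - 1) (flip_bit i a))"

lemma bit_less_exp: "bit a n \<Longrightarrow> a < 2 ^ r \<Longrightarrow> n < r" for a :: nat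
  by (metis bit_take_bit_iff take_bit_nat_eq_self_iff)

lemma less_exp_if_bits: "(\<And>n. bit a n \<Longrightarrow> n < r) \<Longrightarrow> a < 2 ^ r" for a :: nat
  by (metis bit_eqI bit_take_bit_iff take_bit_nat_eq_self_iff)

lemma spin_sign_cases: "spin_sign a j = 1 \<or> spin_sign a j = -1"
  by (simp add: spin_sign_def)

lemma eq_if_spin_signs_eq:
  assumes "a < 2 ^ r" "b < 2 ^ r" "\<And>j. j \<in> {1..r} \<Longrightarrow> spin_sign a j = spin_sign b j"
  shows "a = b"
proof (rule bit_eqI)
  fix n
  show "bit a n = bit b n"
  proof (cases "n < r")
    case True
    then show ?thesis using assms(3)[of "Suc n"] by (auto simp: spin_sign_def split: if_splits)
  next
    case False
    then show ?thesis using assms(1,2) bit_less_exp by blast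
  qed
qed

lemma reflect_less:
  assumes "i \<in> {1..r}" "a < 2 ^ r"
  shows "reflect r i a < 2 ^ r"
proof (rule less_exp_if_bits)
  fix n assume "bit (reflect r i a) n"
  then show "n < r" using assms bit_less_exp[of a n r]
    by (auto simp: reflect_def bit_flip_bit_iff split: if_splits)
qed

lemma spin_sign_reflect:
  assumes "i \<in> {1..r}" "k \<in> {1..r}"
  shows "spin_sign (reflect r i a) k =
    (if i = r then (if k = r then - spin_sign a r else spin_sign a k)
     else spin_sign a (transpose i (i + 1) k))"
proof -
  obtain i' k' where [simp]: "i = Suc i'" "k = Suc k'"
    using assms by (metis atLeastAtMost_iff not0_implies_Suc not_one_le_zero)
  show ?thesis
  proof (cases "i = r")
    case True
    then have "r = Suc i'" by simp
    then show ?thesis by (simp add: spin_sign_def reflect_def bit_flip_bit_iff)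
  next
    case False
    consider "k' = i'" | "k' = Suc i'" | "k' \<noteq> i'" "k' \<noteq> Suc i'" by blast
    then show ?thesis
      using False by cases (simp_all add: spin_sign_def reflect_def bit_flip_bit_iff transpose_def)
  qed
qed

lemma reflect_reflect:
  assumes "i \<in> {1..r}" "a < 2 ^ r"
  shows "reflect r i (reflect r i a) = a"
proof (rule eq_if_spin_signs_eq[of _ r])
  fix k assume "k \<in> {1..r}"
  then show "spin_sign (reflect r i (reflect r i a)) k = spin_sign a k"
    using assms by (auto simp: spin_sign_reflect transpose_def)
qed (use assms reflect_less in auto)

lemma spin_pairing_eq:
  assumes "i \<in> {1..r}"
  shows "spin_pairing r i a =
    (if i = r then spin_sign a r else (spin_sign a i - spin_sign a (i + 1)) div 2)"
proof -
  have "(\<Sum>j = 1..r. simple_coroot r i j * spin_sign a j) =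
      (\<Sum>j = 1..r. (if j = i then (if i = r then 2 else 1) * spin_sign a i else 0) -
         (if j = i + 1 then (if i < r then spin_sign a (i + 1) else 0) else 0))"
    by (intro sum.cong refl) (auto simp: simple_coroot_def simple_root_def)
  also have "\<dots> = (if i = r then 2 else 1) * spin_sign a i - (if i < r then spin_sign a (i + 1) else 0)"
    using assms by (auto simp: sum_subtractf)
  finally show ?thesis using assms by (auto simp: spin_pairing_def)
qed

lemma spin_pairing_cases:
  assumes "i \<in> {1..r}"
  shows "spin_pairing r i a = 1 \<or> spin_pairing r i a = 0 \<or> spin_pairing r i a = -1"
  using spin_sign_cases[of a r] spin_sign_cases[of a i] spin_sign_cases[of a "i + 1"]
  by (auto simp: spin_pairing_eq[OF assms])

text \<open>This is \<open>\<langle>s\<^sub>i\<mu>, h\<^sub>j\<rangle> = \<langle>\<mu>, h\<^sub>j\<rangle> - \<langle>\<mu>, h\<^sub>i\<rangle> \<langle>\<alpha>\<^sub>i, h\<^sub>j\<rangle>\<close>. Together with the bound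
  \<open>\<bar>\<langle>\<mu>, h\<^sub>j\<rangle>\<bar> \<le> 1\<close> it carries all later computations with the generators.\<close>

lemma spin_pairing_reflect:
  assumes i: "i \<in> {1..r}" and j: "j \<in> {1..r}"
  shows "spin_pairing r j (reflect r i a) = spin_pairing r j a - cartan r j i * spin_pairing r i a"
proof -
  define s where "s = spin_sign a"
  have s: "s k = 1 \<or> s k = -1" for k by (simp add: s_def spin_sign_cases)
  have P: "spin_pairing r l a = (if l = r then s r else (s l - s (l + 1)) div 2)" if "l \<in> {1..r}" for l
    using that by (simp add: spin_pairing_eq s_def)
  have Q: "spin_pairing r j (reflect r i a) =
     (if j = r then (if i = r then - s r else s (transpose i (i + 1) r))
      else if i = r then (s j - (if j + 1 = r then - s r else s (j + 1))) div 2
      else (s (transpose i (i + 1) j) - s (transpose i (i + 1) (j + 1))) div 2)"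
    using i j by (auto simp: spin_pairing_eq spin_sign_reflect s_def)
  consider "j = i" | "j = i + 1" | "i = j + 1" | "j \<noteq> i" "j \<noteq> i + 1" "i \<noteq> j + 1" by blast
  then show ?thesis
  proof cases
    case 1
    then show ?thesis unfolding Q P[OF i] P[OF j] using s[of i] s[of "i+1"] by (auto simp: cartan_def)
  next
    case 2
    then show ?thesis unfolding Q P[OF i] P[OF j] using i j s[of i] s[of "i+1"] s[of "i+2"] by (auto simp: cartan_def)
  next
    case 3
    then show ?thesis unfolding Q P[OF i] P[OF j] using i j s[of j] s[of "j+1"] s[of "j+2"] by (auto simp: cartan_def)
  next
    case 4
    then show ?thesis unfolding Q P[OF i] P[OF j] using i j by (auto simp: cartan_def transpose_def)
  qed
qed

lemma reflect_eq_self: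
  assumes "i \<in> {1..r}" "a < 2 ^ r" "spin_pairing r i a = 0"
  shows "reflect r i a = a"
  using assms spin_sign_cases[of a r] spin_sign_cases[of a i] spin_sign_cases[of a "i + 1"]
  by (auto simp: spin_pairing_eq reflect_def spin_sign_def split: if_splits)

lemma spin_pairing_reflect_self:
  "i \<in> {1..r} \<Longrightarrow> spin_pairing r i (reflect r i a) = - spin_pairing r i a"
  by (simp add: spin_pairing_reflect cartan_def)

lemma reflect_commute:
  assumes i: "i \<in> {1..r}" and j: "j \<in> {1..r}" and ij: "i \<noteq> j" "cartan r i j = 0" and a: "a < 2 ^ r"
  shows "reflect r i (reflect r j a) = reflect r j (reflect r i a)"
proof (rule eq_if_spin_signs_eq[of _ r])
  fix k assume k: "k \<in> {1..r}"
  have apart: "i + 1 < j \<or> j + 1 < i"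
    using i j ij by (auto simp: cartan_def split: if_splits)
  have tr: "transpose i (i + 1) (transpose j (j + 1) k) = transpose j (j + 1) (transpose i (i + 1) k)"
    using apart by (auto simp: transpose_def)
  have range: "transpose l (l + 1) k \<in> {1..r}" if "l \<in> {1..r}" "l \<noteq> r" for l
    using that k by (auto simp: transpose_def)
  consider "i = r" "j \<noteq> r" | "j = r" "i \<noteq> r" | "i \<noteq> r" "j \<noteq> r" using ij by blast
  then show "spin_sign (reflect r i (reflect r j a)) k = spin_sign (reflect r j (reflect r i a)) k"
  proof cases
    case 1
    then have "transpose j (j + 1) r = r" "transpose j (j + 1) k = r \<longleftrightarrow> k = r"
      using apart j by (auto simp: transpose_def)
    then show ?thesis using 1 i j k range[of j] by (simp add: spin_sign_reflect)
  next
    case 2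
    then have "transpose i (i + 1) r = r" "transpose i (i + 1) k = r \<longleftrightarrow> k = r"
      using apart i by (auto simp: transpose_def)
    then show ?thesis using 2 i j k range[of i] by (simp add: spin_sign_reflect)
  next
    case 3
    then show ?thesis using i j k range[of i] range[of j] tr by (simp add: spin_sign_reflect)
  qed
qed (use assms reflect_less in auto)

text \<open>In a minuscule representation \<open>\<mu> - \<alpha>\<^sub>i\<close> is a weight only if \<open>\<langle>\<mu>, h\<^sub>i\<rangle> = 1\<close>, and then it equals
  \<open>s\<^sub>i\<mu>\<close>. So the one possible nonzero entry of row \<open>b\<close> stands in column \<open>s\<^sub>i b\<close>.\<close>

lemma gen_e_entry:
  assumes i: "i \<in> {1..r}" and ab: "a < 2 ^ r" "b < 2 ^ r"
  shows "gen_e r i $$ (b, a) = (if spin_pairing r i b = 1 \<and> a = reflect r i b then 1 else 0)"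
proof -
  have "(\<forall>j\<in>{1..r}. spin_sign b j = spin_sign a j + 2 * simple_root r i j) \<longleftrightarrow>
      spin_pairing r i b = 1 \<and> (\<forall>j\<in>{1..r}. spin_sign a j = spin_sign (reflect r i b) j)"
    (is "?L \<longleftrightarrow> ?R")
  proof
    assume L: ?L
    have "spin_sign b i = 1 \<and> spin_sign a i = -1"
      using bspec[OF L i] spin_sign_cases[of a i] spin_sign_cases[of b i] by (auto simp: simple_root_def)
    moreover have "spin_sign b (i + 1) = -1 \<and> spin_sign a (i + 1) = 1" if "i < r"
      using bspec[OF L, of "i + 1"] that spin_sign_cases[of a "i + 1"] spin_sign_cases[of b "i + 1"]
      by (auto simp: simple_root_def)
    ultimately have *: "spin_sign b i = 1 \<and> spin_sign a i = -1"
      "i < r \<Longrightarrow> spin_sign b (i + 1) = -1 \<and> spin_sign a (i + 1) = 1" by blast+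
    then show ?R using L i 
      by (auto simp: spin_pairing_eq spin_sign_reflect simple_root_def transpose_def)
  next
    assume R: ?R
    then have "spin_sign b i = 1" "i < r \<Longrightarrow> spin_sign b (i+1) = -1"
      using i spin_sign_cases[of b i] spin_sign_cases[of b "i+1"] by (auto simp: spin_pairing_eq split: if_splits)
    then show ?L using R i
      by (auto simp: spin_pairing_eq spin_sign_reflect simple_root_def transpose_def)
  qed
  moreover have "(\<forall>j\<in>{1..r}. spin_sign a j = spin_sign (reflect r i b) j) \<longleftrightarrow> a = reflect r i b"
    using eq_if_spin_signs_eq[OF ab(1) reflect_less[OF i ab(2)]] by auto
  ultimately show ?thesis using ab by (simp add: gen_e_def)
qed

lemma gen_f_transpose:
  assumes "a < 2 ^ r" "b < 2 ^ r"
  shows "gen_f r i $$ (b, a) = gen_e r i $$ (a, b)"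
proof -
  have "(\<forall>j\<in>{1..r}. spin_sign b j = spin_sign a j - 2 * simple_root r i j) \<longleftrightarrow>
     (\<forall>j\<in>{1..r}. spin_sign a j = spin_sign b j + 2 * simple_root r i j)"
    by (auto simp: algebra_simps)
  then show ?thesis using assms by (simp add: gen_f_def gen_e_def)
qed

lemma gen_f_entry:
  assumes i: "i \<in> {1..r}" and ab: "a < 2 ^ r" "b < 2 ^ r"
  shows "gen_f r i $$ (b, a) = (if spin_pairing r i b = -1 \<and> a = reflect r i b then 1 else 0)"
  using gen_e_entry[OF i ab(2,1)] gen_f_transpose[OF ab] reflect_reflect[OF i] spin_pairing_reflect_self[OF i] ab
  by auto

section \<open>The Chevalley generators as sparse matrices\<close>

abbreviation spin_mat :: "nat \<Rightarrow> complex mat set" where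
  "spin_mat r \<equiv> carrier_mat (2 ^ r) (2 ^ r)"

lemma gen_ef_carrier [simp]: "gen_e r i \<in> spin_mat r" "gen_f r i \<in> spin_mat r"
  by (simp_all add: gen_e_def gen_f_def)

lemma gen_ef_dim [simp]:
  "dim_row (gen_e r i) = 2 ^ r" "dim_col (gen_e r i) = 2 ^ r"
  "dim_row (gen_f r i) = 2 ^ r" "dim_col (gen_f r i) = 2 ^ r"
  by (simp_all add: gen_e_def gen_f_def)

lemma coroot_elt_carrier [simp]: "coroot_elt r i t \<in> spin_mat r"
  by (simp add: coroot_elt_def)

lemma mult_mat_entry:
  fixes A B :: "complex mat"
  assumes "A \<in> carrier_mat n n" "B \<in> carrier_mat n n" "b < n" "c < n"
  shows "(A * B) $$ (b, c) = (\<Sum>a<n. A $$ (b, a) * B $$ (a, c))"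
  using assms by (auto simp: scalar_prod_def atLeast0LessThan)

lemma sparse_mult_entry:
  fixes A B :: "complex mat"
  assumes "A \<in> carrier_mat n n" "B \<in> carrier_mat n n" "b < n" "c < n"
    and "a0 < n" "\<And>a. a < n \<Longrightarrow> a \<noteq> a0 \<Longrightarrow> A $$ (b, a) = 0"
  shows "(A * B) $$ (b, c) = A $$ (b, a0) * B $$ (a0, c)"
proof -
  have "(\<Sum>a<n. A $$ (b, a) * B $$ (a, c)) = (\<Sum>a<n. if a = a0 then A $$ (b, a0) * B $$ (a0, c) else 0)"
    by (rule sum.cong) (use assms in auto)
  then show ?thesis using assms by (simp add: mult_mat_entry del: index_mult_mat(1))
qed

lemma spin_mat_mult [simp]: "A \<in> spin_mat r \<Longrightarrow> B \<in> spin_mat r \<Longrightarrow> A * B \<in> spin_mat r"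
  by (rule mult_carrier_mat)

lemma spin_mat_assoc:
  "A \<in> spin_mat r \<Longrightarrow> B \<in> spin_mat r \<Longrightarrow> C \<in> spin_mat r \<Longrightarrow> (A * B) * C = A * (B * C)"
  by (rule assoc_mult_mat)

text \<open>The products below are computed by the effect of left multiplication on the rows of a matrix. The factor
  \<open>1\<close> makes these rules apply to the last factor of a product as well.\<close>

lemma spin_mat_eqI:
  assumes "A \<in> spin_mat r" "B \<in> spin_mat r"
    "\<And>b c. b < 2 ^ r \<Longrightarrow> c < 2 ^ r \<Longrightarrow> (A * 1\<^sub>m (2 ^ r)) $$ (b, c) = (B * 1\<^sub>m (2 ^ r)) $$ (b, c)"
  shows "A = B"
  using assms(3) by (intro eq_matI) (use assms(1,2) in auto)

lemma gen_e_mult: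
  assumes "i \<in> {1..r}" "A \<in> spin_mat r" "b < 2 ^ r" "c < 2 ^ r"
  shows "(gen_e r i * A) $$ (b, c) = (if spin_pairing r i b = 1 then A $$ (reflect r i b, c) else 0)"
  by (subst sparse_mult_entry[of _ _ _ _ _ "reflect r i b"])
    (use assms in \<open>auto simp: gen_e_entry reflect_less\<close>)

lemma gen_f_mult:
  assumes "i \<in> {1..r}" "A \<in> spin_mat r" "b < 2 ^ r" "c < 2 ^ r"
  shows "(gen_f r i * A) $$ (b, c) = (if spin_pairing r i b = -1 then A $$ (reflect r i b, c) else 0)"
  by (subst sparse_mult_entry[of _ _ _ _ _ "reflect r i b"])
    (use assms in \<open>auto simp: gen_f_entry reflect_less\<close>)

lemma coroot_elt_mult:
  assumes "A \<in> spin_mat r" "b < 2 ^ r" "c < 2 ^ r"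
  shows "(coroot_elt r i t * A) $$ (b, c) = t powi spin_pairing r i b * A $$ (b, c)"
  by (subst sparse_mult_entry[of _ _ _ _ _ b])
    (use assms in \<open>auto simp: coroot_elt_def\<close>)

lemma gen_e_square:
  assumes "i \<in> {1..r}"
  shows "gen_e r i * gen_e r i = 0\<^sub>m (2 ^ r) (2 ^ r)"
proof (rule spin_mat_eqI[of _ r])
  fix b c :: nat assume "b < 2 ^ r" "c < 2 ^ r"
  then show "(gen_e r i * gen_e r i * 1\<^sub>m (2 ^ r)) $$ (b, c) = (0\<^sub>m (2 ^ r) (2 ^ r) * 1\<^sub>m (2 ^ r)) $$ (b, c)"
    using assms by (simp add: spin_mat_assoc[of _ r] gen_e_mult gen_e_entry reflect_less spin_pairing_reflect_self del: index_mult_mat(1) right_mult_one_mat)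
qed auto

lemma gen_f_square:
  assumes "i \<in> {1..r}"
  shows "gen_f r i * gen_f r i = 0\<^sub>m (2 ^ r) (2 ^ r)"
proof (rule spin_mat_eqI[of _ r])
  fix b c :: nat assume "b < 2 ^ r" "c < 2 ^ r"
  then show "(gen_f r i * gen_f r i * 1\<^sub>m (2 ^ r)) $$ (b, c) = (0\<^sub>m (2 ^ r) (2 ^ r) * 1\<^sub>m (2 ^ r)) $$ (b, c)"
    using assms by (simp add: spin_mat_assoc[of _ r] gen_f_mult gen_f_entry reflect_less spin_pairing_reflect_self del: index_mult_mat(1) right_mult_one_mat)
qed auto

text \<open>The generators square to zero in a minuscule representation, so the exponential series stops after the
  linear term.\<close>

lemma mat_exp_square_zero:
  assumes E: "E \<in> carrier_mat n n" "E * E = 0\<^sub>m n n"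
  shows "mat_exp (t \<cdot>\<^sub>m E) = 1\<^sub>m n + t \<cdot>\<^sub>m E"
proof -
  define A where "A = t \<cdot>\<^sub>m E"
  have A: "A \<in> carrier_mat n n" using E by (simp add: A_def)
  have "A * A = t \<cdot>\<^sub>m (t \<cdot>\<^sub>m (E * E))"
    using E by (simp add: A_def mult_smult_assoc_mat[of _ n n _ n] mult_smult_distrib[of _ n n _ n])
  then have AA: "A * A = 0\<^sub>m n n" using E by simp
  have pow: "A ^\<^sub>m k = 0\<^sub>m n n" if "k \<ge> 2" for k
    using that
  proof (induction k rule: dec_induct)
    case base
    then show ?case using AA A by (simp add: numeral_2_eq_2)
  qed (use A in simp)
  have "mat_exp A $$ (b, a) = (1\<^sub>m n + A) $$ (b, a)" if "b < n" "a < n" for a b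
  proof -
    have "(\<Sum>k. (A ^\<^sub>m k) $$ (b, a) / fact k) = (\<Sum>k\<in>{0,1}. (A ^\<^sub>m k) $$ (b, a) / fact k)"
    proof (rule suminf_finite)
      fix k :: nat assume "k \<notin> {0, 1}"
      then have "k \<ge> 2" by auto
      then show "(A ^\<^sub>m k) $$ (b, a) / fact k = 0" using pow that by simp
    qed simp
    then show ?thesis using that A by (simp add: mat_exp_def)
  qed
  then show ?thesis unfolding A_def[symmetric]
    using A by (intro eq_matI) (auto simp: mat_exp_def)
qed

lemma gen_x_eq: "i \<in> {1..r} \<Longrightarrow> gen_x r i t = 1\<^sub>m (2 ^ r) + t \<cdot>\<^sub>m gen_e r i"
  and gen_y_eq: "i \<in> {1..r} \<Longrightarrow> gen_y r i t = 1\<^sub>m (2 ^ r) + t \<cdot>\<^sub>m gen_f r i"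
  by (simp_all add: gen_x_def gen_y_def mat_exp_square_zero gen_e_square gen_f_square)

lemma gen_xy_carrier [simp]: "gen_x r i t \<in> spin_mat r" "gen_y r i t \<in> spin_mat r"
  by (simp_all add: gen_x_def gen_y_def mat_exp_def gen_e_def gen_f_def)

lemma gen_x_mult:
  assumes "i \<in> {1..r}" "A \<in> spin_mat r" "b < 2 ^ r" "c < 2 ^ r"
  shows "(gen_x r i t * A) $$ (b, c) =
    A $$ (b, c) + (if spin_pairing r i b = 1 then t * A $$ (reflect r i b, c) else 0)"
proof -
  have "gen_x r i t * A = A + t \<cdot>\<^sub>m (gen_e r i * A)"
    using assms by (simp add: gen_x_eq add_mult_distrib_mat[of _ "2^r" "2^r"] mult_smult_assoc_mat[of _ "2^r" "2^r"])
  moreover have "dim_row A = 2 ^ r" "dim_col A = 2 ^ r" using assms by auto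
  ultimately show ?thesis using assms gen_e_mult[OF assms] by (simp del: index_mult_mat(1))
qed

lemma gen_y_mult:
  assumes "i \<in> {1..r}" "A \<in> spin_mat r" "b < 2 ^ r" "c < 2 ^ r"
  shows "(gen_y r i t * A) $$ (b, c) =
    A $$ (b, c) + (if spin_pairing r i b = -1 then t * A $$ (reflect r i b, c) else 0)"
proof -
  have "gen_y r i t * A = A + t \<cdot>\<^sub>m (gen_f r i * A)"
    using assms by (simp add: gen_y_eq add_mult_distrib_mat[of _ "2^r" "2^r"] mult_smult_assoc_mat[of _ "2^r" "2^r"])
  moreover have "dim_row A = 2 ^ r" "dim_col A = 2 ^ r" using assms by auto
  ultimately show ?thesis using assms gen_f_mult[OF assms] by (simp del: index_mult_mat(1))
qed

lemmas gen_mult = gen_x_mult gen_y_mult coroot_elt_mult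

lemma gen_x_add: "i \<in> {1..r} \<Longrightarrow> gen_x r i s * gen_x r i t = gen_x r i (s + t)"
  by (rule spin_mat_eqI[of _ r])
    (auto simp: gen_mult reflect_less spin_pairing_reflect_self algebra_simps simp add: spin_mat_assoc[of _ r] simp del: index_mult_mat(1) right_mult_one_mat)

lemma gen_y_add: "i \<in> {1..r} \<Longrightarrow> gen_y r i s * gen_y r i t = gen_y r i (s + t)"
  by (rule spin_mat_eqI[of _ r])
    (auto simp: gen_mult reflect_less spin_pairing_reflect_self algebra_simps simp add: spin_mat_assoc[of _ r] simp del: index_mult_mat(1) right_mult_one_mat)

lemma gen_x_zero: "i \<in> {1..r} \<Longrightarrow> gen_x r i 0 = 1\<^sub>m (2 ^ r)"
  and gen_y_zero: "i \<in> {1..r} \<Longrightarrow> gen_y r i 0 = 1\<^sub>m (2 ^ r)"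
  by (auto simp: gen_x_eq gen_y_eq intro!: eq_matI)

lemma simple_lift_eq: "simple_lift r i = gen_x r i (-1) * (gen_y r i 1 * gen_x r i (-1))"
  by (simp add: simple_lift_def list_mult_def Spin_def GL_def units_of_def ring_mat_simps
      right_mult_one_mat[OF gen_xy_carrier(1)])

lemma simple_lift_carrier [simp]: "simple_lift r i \<in> spin_mat r"
  by (simp add: simple_lift_eq)

text \<open>On the plane spanned by two vectors of weights \<open>\<mu>\<close> and \<open>s\<^sub>i\<mu>\<close> the lift is the rotation matrix
  of \<open>SL\<^sub>2\<close>; the minus sign belongs to the step that raises the weight.\<close>

lemma simple_lift_mult:
  assumes "i \<in> {1..r}" "A \<in> spin_mat r" "b < 2 ^ r" "c < 2 ^ r"
  shows "(simple_lift r i * A) $$ (b, c) =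
    (if spin_pairing r i b = 1 then -1 else 1) * A $$ (reflect r i b, c)"
  using assms spin_pairing_cases[OF assms(1), of b]
  by (auto simp: simple_lift_eq gen_mult reflect_less reflect_reflect reflect_eq_self spin_pairing_reflect_self
      simp add: spin_mat_assoc[of _ r] simp del: index_mult_mat(1))

text \<open>The decomposition \<open>N\<^sub>- H N\<close> of \<open>SL\<^sub>2\<close>, in which \<open>d\<close> is the upper left entry of
  \<open>x\<^sub>i(a) y\<^sub>i(t)\<close>.\<close>

lemma gen_x_mult_gen_y:
  assumes i: "i \<in> {1..r}" and d: "1 + a * t = d" "d \<noteq> 0"
  shows "gen_x r i a * gen_y r i t =
    gen_y r i (t / d) * (coroot_elt r i d * gen_x r i (a / d))"
proof (rule spin_mat_eqI[of _ r])
  fix b c :: nat assume bc: "b < 2 ^ r" "c < 2 ^ r"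
  have P: "spin_pairing r i (reflect r i b) = - spin_pairing r i b"
    using i by (rule spin_pairing_reflect_self)
  have "1 / d + t / d * a = 1" using d by (simp add: field_simps)
  then have E: "inverse d + t * a / d = 1" by (simp add: field_simps)
  have L: "(gen_x r i a * gen_y r i t * 1\<^sub>m (2 ^ r)) $$ (b, c) =
     1\<^sub>m (2 ^ r) $$ (b, c) + (if spin_pairing r i b = -1 then t * 1\<^sub>m (2 ^ r) $$ (reflect r i b, c) else 0)
      + (if spin_pairing r i b = 1 then a * 1\<^sub>m (2 ^ r) $$ (reflect r i b, c) + a * t * 1\<^sub>m (2 ^ r) $$ (b, c) else 0)"
    using i bc P by (simp add: spin_mat_assoc[of _ r] gen_mult reflect_less reflect_reflect algebra_simps
       del: index_mult_mat(1) right_mult_one_mat index_one_mat(1))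
  have R: "(gen_y r i (t / d) * (coroot_elt r i d * gen_x r i (a / d)) * 1\<^sub>m (2 ^ r)) $$ (b, c) =
     (if spin_pairing r i b = -1
      then (inverse d + t * a / d) * 1\<^sub>m (2 ^ r) $$ (b, c) + t * 1\<^sub>m (2 ^ r) $$ (reflect r i b, c)
      else if spin_pairing r i b = 1 then d * 1\<^sub>m (2 ^ r) $$ (b, c) + a * 1\<^sub>m (2 ^ r) $$ (reflect r i b, c)
      else 1\<^sub>m (2 ^ r) $$ (b, c))"
    using i bc P d(2) spin_pairing_cases[OF i, of b]
    by (auto simp: spin_mat_assoc[of _ r] gen_mult reflect_less reflect_reflect power_int_minus field_simps
       simp del: index_mult_mat(1) right_mult_one_mat index_one_mat(1))
  show "(gen_x r i a * gen_y r i t * 1\<^sub>m (2 ^ r)) $$ (b, c) =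
     (gen_y r i (t / d) * (coroot_elt r i d * gen_x r i (a / d)) * 1\<^sub>m (2 ^ r)) $$ (b, c)"
    unfolding L R E using d(1)[symmetric] spin_pairing_cases[OF i, of b] by (auto simp: algebra_simps)
qed auto

text \<open>In \<open>SL\<^sub>2\<close> the product \<open>x(t) y(-1/t) x(t)\<close> is a monomial matrix, and the lift of the reflection
  brings it back to the diagonal. This puts the torus into the group generated by root subgroups.\<close>

lemma coroot_elt_as_product:
  assumes "i \<in> {1..r}" "t \<noteq> 0"
  shows "coroot_elt r i t = gen_x r i t * (gen_y r i (- inverse t) * (gen_x r i t * simple_lift r i))"
proof (rule spin_mat_eqI[of _ r])
  fix b c :: nat assume "b < 2 ^ r" "c < 2 ^ r"
  then show "(coroot_elt r i t * 1\<^sub>m (2 ^ r)) $$ (b, c) =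
     (gen_x r i t * (gen_y r i (- inverse t) * (gen_x r i t * simple_lift r i)) * 1\<^sub>m (2 ^ r)) $$ (b, c)"
    using assms spin_pairing_cases[OF assms(1), of b]
    by (auto simp: gen_mult simple_lift_mult reflect_less reflect_reflect reflect_eq_self spin_pairing_reflect_self power_int_minus
      field_simps simp add: spin_mat_assoc[of _ r] simp del: index_mult_mat(1) right_mult_one_mat)
qed (auto intro!: mult_carrier_mat)

lemma cartan_zero_sym: "i \<in> {1..r} \<Longrightarrow> j \<in> {1..r} \<Longrightarrow> cartan r i j = 0 \<longleftrightarrow> cartan r j i = 0"
  by (auto simp: cartan_def)

lemma cartan_nonpos: "i \<noteq> j \<Longrightarrow> cartan r i j \<le> 0"
  by (auto simp: cartan_def)

text \<open>This is \<open>[e\<^sub>j, f\<^sub>i] = 0\<close>. If \<open>\<langle>\<alpha>\<^sub>i, h\<^sub>j\<rangle> < 0\<close>, both products of \<open>e\<^sub>j\<close> and \<open>f\<^sub>i\<close> vanish, because they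
  would lead through a weight with a pairing of absolute value at least 2; if it is \<open>0\<close>, the two reflections
  commute.\<close>

lemma gen_x_gen_y_commute:
  assumes i: "i \<in> {1..r}" and j: "j \<in> {1..r}" and ne: "i \<noteq> j"
  shows "gen_x r j a * gen_y r i t = gen_y r i t * gen_x r j a"
proof (rule spin_mat_eqI[of _ r])
  fix b c :: nat assume b: "b < 2 ^ r" and c: "c < 2 ^ r"
  let ?P = "spin_pairing r"
  have bounds: "?P i b' \<le> 1 \<and> ?P i b' \<ge> -1 \<and> ?P j b' \<le> 1 \<and> ?P j b' \<ge> -1" for b'
    using spin_pairing_cases[OF i, of b'] spin_pairing_cases[OF j, of b'] by auto
  have Pij: "?P j (reflect r i b) = ?P j b - cartan r j i * ?P i b"
    and Pji: "?P i (reflect r j b) = ?P i b - cartan r i j * ?P j b"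
    using i j by (simp_all add: spin_pairing_reflect)
  have 1: "cartan r i j = 0 \<and> ?P i b = -1" if "?P j b = 1" "?P i (reflect r j b) = -1"
    using Pji that bounds[of b] cartan_nonpos[OF ne, of r] by auto
  have 2: "cartan r j i = 0 \<and> ?P j b = 1" if "?P i b = -1" "?P j (reflect r i b) = 1"
    using Pij that bounds[of b] cartan_nonpos[of j i r] ne by auto
  show "(gen_x r j a * gen_y r i t * 1\<^sub>m (2 ^ r)) $$ (b, c) = (gen_y r i t * gen_x r j a * 1\<^sub>m (2 ^ r)) $$ (b, c)"
  proof (cases "cartan r i j = 0")
    case True
    then have "cartan r j i = 0" using cartan_zero_sym i j by blast
    then show ?thesis using Pij Pji True i j b c reflect_commute[OF i j ne True b]
      by (auto simp: gen_mult reflect_less algebra_simps simp add: spin_mat_assoc[of _ r] simp del: index_mult_mat(1) right_mult_one_mat)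
  next
    case False
    then have "cartan r j i \<noteq> 0" using cartan_zero_sym i j by blast
    then show ?thesis using 1 2 False i j b c
      by (auto simp: gen_mult reflect_less algebra_simps simp add: spin_mat_assoc[of _ r] simp del: index_mult_mat(1) right_mult_one_mat)
  qed
qed auto

section \<open>The torus and words in the Weyl group\<close>

lemma GL_simps [simp]: "mult (GL r) = (*)" "one (GL r) = 1\<^sub>m (2 ^ r)"
  by (simp_all add: GL_def units_of_def ring_mat_simps)

lemma Spin_simps [simp]: "mult (Spin r) = (*)" "one (Spin r) = 1\<^sub>m (2 ^ r)"
  by (simp_all add: Spin_def)

lemma group_GL: "group (GL r)"
  unfolding GL_def by (rule monoid.units_group, rule ring.is_monoid, rule ring_mat)

lemma GL_carrierI:
  assumes "A \<in> spin_mat r" "B \<in> spin_mat r" "A * B = 1\<^sub>m (2 ^ r)" "B * A = 1\<^sub>m (2 ^ r)"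
  shows "A \<in> carrier (GL r)"
  using assms by (auto simp: GL_def units_of_def Units_def ring_mat_simps)

lemma gen_x_inverse: "i \<in> {1..r} \<Longrightarrow> gen_x r i (- t) * gen_x r i t = 1\<^sub>m (2 ^ r)"
    "i \<in> {1..r} \<Longrightarrow> gen_x r i t * gen_x r i (- t) = 1\<^sub>m (2 ^ r)"
  and gen_y_inverse: "i \<in> {1..r} \<Longrightarrow> gen_y r i (- t) * gen_y r i t = 1\<^sub>m (2 ^ r)"
    "i \<in> {1..r} \<Longrightarrow> gen_y r i t * gen_y r i (- t) = 1\<^sub>m (2 ^ r)"
  by (simp_all add: gen_x_add gen_y_add gen_x_zero gen_y_zero)

lemma gen_xy_GL:
  assumes "i \<in> {1..r}"
  shows "gen_x r i t \<in> carrier (GL r)" "gen_y r i t \<in> carrier (GL r)"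
  by (rule GL_carrierI[OF gen_xy_carrier(1) gen_xy_carrier(1) gen_x_inverse(2,1)[OF assms]],
      rule GL_carrierI[OF gen_xy_carrier(2) gen_xy_carrier(2) gen_y_inverse(2,1)[OF assms]])

lemma gens_in_GL:
  "(\<Union>i\<in>{1..r}. range (gen_x r i)) \<union> (\<Union>i\<in>{1..r}. range (gen_y r i)) \<subseteq> carrier (GL r)"
  using gen_xy_GL by blast

lemma group_Spin: "group (Spin r)"
  unfolding Spin_def
  by (intro group.subgroup_imp_group group_GL group.generate_is_subgroup gens_in_GL)

lemma Spin_carrier: "x \<in> carrier (Spin r) \<Longrightarrow> x \<in> spin_mat r"
proof -
  assume "x \<in> carrier (Spin r)"
  then have "x \<in> carrier (GL r)"
    using group.generate_in_carrier[OF group_GL gens_in_GL] by (simp add: Spin_def)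
  then show ?thesis by (simp add: GL_def units_of_def Units_def ring_mat_simps)
qed

lemma gen_xy_Spin [simp]:
  assumes "i \<in> {1..r}"
  shows "gen_x r i t \<in> carrier (Spin r)" "gen_y r i t \<in> carrier (Spin r)"
  using assms by (auto simp: Spin_def intro!: generate.incl)

lemma Spin_mult_closed: "x \<in> carrier (Spin r) \<Longrightarrow> y \<in> carrier (Spin r) \<Longrightarrow> x * y \<in> carrier (Spin r)"
  using monoid.m_closed[OF group.is_monoid[OF group_Spin[of r]], of x y] by simp

lemma Spin_one_closed: "1\<^sub>m (2 ^ r) \<in> carrier (Spin r)"
  using monoid.one_closed[OF group.is_monoid[OF group_Spin[of r]]] by simp

lemma Spin_inv:
  assumes "x \<in> carrier (Spin r)"
  shows "inv\<^bsub>Spin r\<^esub> x \<in> carrier (Spin r)" "inv\<^bsub>Spin r\<^esub> x * x = 1\<^sub>m (2 ^ r)" "x * inv\<^bsub>Spin r\<^esub> x = 1\<^sub>m (2 ^ r)"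
  using group.inv_closed[OF group_Spin assms] group.l_inv[OF group_Spin assms] group.r_inv[OF group_Spin assms]
  by simp_all

lemma Spin_inv_unique:
  assumes "x \<in> carrier (Spin r)" "y \<in> carrier (Spin r)" "x * y = 1\<^sub>m (2 ^ r)"
  shows "inv\<^bsub>Spin r\<^esub> x = y"
proof -
  have "inv\<^bsub>Spin r\<^esub> y = x" using group.inv_equality[OF group_Spin[of r], of x y] assms by simp
  then show ?thesis using group.inv_inv[OF group_Spin assms(2)] by simp
qed

lemma Spin_inv_gen:
  assumes "i \<in> {1..r}"
  shows "inv\<^bsub>Spin r\<^esub> (gen_x r i t) = gen_x r i (- t)" "inv\<^bsub>Spin r\<^esub> (gen_y r i t) = gen_y r i (- t)"
  using assms gen_x_inverse gen_y_inverse by (auto intro!: Spin_inv_unique)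

lemma simple_lift_Spin: "i \<in> {1..r} \<Longrightarrow> simple_lift r i \<in> carrier (Spin r)"
  by (simp add: simple_lift_eq Spin_mult_closed)

lemma coroot_elt_Spin: "i \<in> {1..r} \<Longrightarrow> t \<noteq> 0 \<Longrightarrow> coroot_elt r i t \<in> carrier (Spin r)"
  by (simp add: coroot_elt_as_product Spin_mult_closed simple_lift_Spin)

lemma coroots_in_Spin: "(\<Union>i\<in>{1..r}. coroot_elt r i ` (- {0})) \<subseteq> carrier (Spin r)"
  using coroot_elt_Spin by (auto simp del: atLeastAtMost_iff)

lemma subgroup_torus: "subgroup (torus r) (Spin r)"
  unfolding torus_def by (intro group.generate_is_subgroup group_Spin coroots_in_Spin)

lemma subgroup_unip: "subgroup (unip_plus r) (Spin r)" "subgroup (unip_minus r) (Spin r)"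
  unfolding unip_plus_def unip_minus_def
  using gen_xy_Spin by (intro group.generate_is_subgroup group_Spin; blast)+

lemma subgroup_Spin_simps:
  assumes "subgroup H (Spin r)"
  shows "1\<^sub>m (2 ^ r) \<in> H" "x \<in> H \<Longrightarrow> y \<in> H \<Longrightarrow> x * y \<in> H" "x \<in> H \<Longrightarrow> inv\<^bsub>Spin r\<^esub> x \<in> H"
    "x \<in> H \<Longrightarrow> x \<in> carrier (Spin r)" "x \<in> H \<Longrightarrow> x \<in> spin_mat r"
  using subgroup.one_closed[OF assms] subgroup.m_closed[OF assms, of x y] subgroup.m_inv_closed[OF assms, of x]
    subgroup.mem_carrier[OF assms, of x] Spin_carrier by auto

text \<open>The product of the elements \<open>\<alpha>\<^sub>j\<^sup>\<or>(t\<^sub>j)\<close> over all \<open>j\<close>, in the form of its eigenvalues.\<close>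

definition torus_elt :: "nat \<Rightarrow> (nat \<Rightarrow> complex) \<Rightarrow> complex mat" where
  "torus_elt r t = mat (2 ^ r) (2 ^ r)
     (\<lambda>(b, a). if b = a then \<Prod>j = 1..r. t j powi spin_pairing r j a else 0)"

lemma torus_elt_carrier [simp]: "torus_elt r t \<in> spin_mat r"
  by (simp add: torus_elt_def)

lemma torus_elt_mult:
  assumes "A \<in> spin_mat r" "b < 2 ^ r" "c < 2 ^ r"
  shows "(torus_elt r t * A) $$ (b, c) = (\<Prod>j = 1..r. t j powi spin_pairing r j b) * A $$ (b, c)"
  by (subst sparse_mult_entry[of _ _ _ _ _ b]) (use assms in \<open>auto simp: torus_elt_def\<close>)

lemma torus_elt_mult_torus_elt:
  assumes "\<And>j. j \<in> {1..r} \<Longrightarrow> t j \<noteq> 0" "\<And>j. j \<in> {1..r} \<Longrightarrow> s j \<noteq> 0"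
  shows "torus_elt r t * torus_elt r s = torus_elt r (\<lambda>j. t j * s j)"
  by (rule spin_mat_eqI[of _ r])
    (auto simp: torus_elt_mult spin_mat_assoc[of _ r] power_int_mult_distrib prod.distrib
      simp del: index_mult_mat(1) right_mult_one_mat)

lemma torus_elt_one: "torus_elt r (\<lambda>j. 1) = 1\<^sub>m (2 ^ r)"
  by (rule eq_matI) (auto simp: torus_elt_def)

lemma coroot_elt_torus_elt:
  assumes "i \<in> {1..r}"
  shows "coroot_elt r i t = torus_elt r (\<lambda>j. if j = i then t else 1)"
proof -
  have "(\<Prod>j = 1..r. (if j = i then t else 1) powi spin_pairing r j a) = t powi spin_pairing r i a" for a
  proof -
    have "(\<Prod>j = 1..r. (if j = i then t else 1) powi spin_pairing r j a) =
       (\<Prod>j = 1..r. if j = i then t powi spin_pairing r i a else 1)"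
      by (rule prod.cong) auto
    then show ?thesis using assms by simp
  qed
  then show ?thesis by (simp add: coroot_elt_def torus_elt_def del: One_nat_def cong: if_cong)
qed

lemma list_mult_coroot_elts:
  assumes "set js \<subseteq> {1..r}" "distinct js" "\<And>j. j \<in> {1..r} \<Longrightarrow> t j \<noteq> 0"
  shows "list_mult (Spin r) (map (\<lambda>j. coroot_elt r j (t j)) js) =
    torus_elt r (\<lambda>j. if j \<in> set js then t j else 1)"
  using assms(1,2)
proof (induction js)
  case Nil
  then show ?case by (simp add: list_mult_def torus_elt_one)
next
  case (Cons i js)
  then have "coroot_elt r i (t i) * torus_elt r (\<lambda>j. if j \<in> set js then t j else 1) =
     torus_elt r (\<lambda>j. (if j = i then t i else 1) * (if j \<in> set js then t j else 1))"
    using assms(3) by (simp add: coroot_elt_torus_elt del: atLeastAtMost_iff One_nat_def)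
      (rule torus_elt_mult_torus_elt, auto)
  also have "(\<lambda>j. (if j = i then t i else 1) * (if j \<in> set js then t j else 1)) =
     (\<lambda>j. if j \<in> set (i # js) then t j else 1)"
    using Cons.prems by auto
  finally show ?case using Cons by (simp add: list_mult_def)
qed

lemma torus_elt_cong: "(\<And>j. j \<in> {1..r} \<Longrightarrow> t j = s j) \<Longrightarrow> torus_elt r t = torus_elt r s"
  unfolding torus_elt_def by (intro cong_mat) (auto intro!: prod.cong)

lemma torus_elt_as_list_mult:
  assumes "\<And>j. j \<in> {1..r} \<Longrightarrow> t j \<noteq> 0"
  shows "list_mult (Spin r) (map (\<lambda>j. coroot_elt r j (t j)) [1..<r + 1]) = torus_elt r t"
  using assms by (subst list_mult_coroot_elts) (auto intro!: torus_elt_cong)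

lemma torus_eq: "torus r = {torus_elt r t | t. \<forall>j\<in>{1..r}. t j \<noteq> 0}"
proof (rule Set.set_eqI, rule iffI)
  fix h assume "h \<in> torus r"
  then show "h \<in> {torus_elt r t | t. \<forall>j\<in>{1..r}. t j \<noteq> 0}"
    unfolding torus_def
  proof (induction rule: generate.induct)
    case one
    then show ?case using torus_elt_one by (intro CollectI exI[of _ "\<lambda>_. 1"]) auto
  next
    case (incl h)
    then obtain i t where "i \<in> {1..r}" "t \<in> - {0}" "h = coroot_elt r i t" by blast
    then show ?case
      by (intro CollectI exI[of _ "\<lambda>j. if j = i then t else 1"]) (auto simp: coroot_elt_torus_elt)
  next
    case (inv h)
    then obtain i t where "i \<in> {1..r}" "t \<in> - {0}" "h = coroot_elt r i t" by blast
    then have it: "i \<in> {1..r}" "t \<noteq> 0" "h = coroot_elt r i t" by simp_all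
    have "coroot_elt r i t * coroot_elt r i (inverse t) =
      torus_elt r (\<lambda>j. (if j = i then t else 1) * (if j = i then inverse t else 1))"
      using it by (simp add: coroot_elt_torus_elt torus_elt_mult_torus_elt)
    also have "(\<lambda>j. (if j = i then t else 1) * (if j = i then inverse t else 1)) = (\<lambda>j. 1)"
      using it by auto
    finally have "inv\<^bsub>Spin r\<^esub> h = coroot_elt r i (inverse t)"
      using it by (auto intro!: Spin_inv_unique coroot_elt_Spin simp: torus_elt_one)
    then show ?case using it
      by (intro CollectI exI[of _ "\<lambda>j. if j = i then inverse t else 1"]) (simp add: coroot_elt_torus_elt)
  next
    case (eng h1 h2)
    then obtain t s where ts: "\<forall>j\<in>{1..r}. t j \<noteq> 0" "\<forall>j\<in>{1..r}. s j \<noteq> 0"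
      "h1 = torus_elt r t" "h2 = torus_elt r s"
      by auto
    then have "torus_elt r t * torus_elt r s = torus_elt r (\<lambda>j. t j * s j)"
      by (intro torus_elt_mult_torus_elt) blast+
    then show ?case using ts by (intro CollectI exI[of _ "\<lambda>j. t j * s j"]) simp
  qed
next
  fix h assume "h \<in> {torus_elt r t | t. \<forall>j\<in>{1..r}. t j \<noteq> 0}"
  then obtain t where t: "\<forall>j\<in>{1..r}. t j \<noteq> 0" "h = torus_elt r t" by auto
  have "list_mult (Spin r) (map (\<lambda>j. coroot_elt r j (t j)) js) \<in> torus r" if "set js \<subseteq> {1..r}" for js
    using that
  proof (induction js)
    case Nil
    then show ?case using subgroup_Spin_simps(1)[OF subgroup_torus] by (simp add: list_mult_def)
  next
    case (Cons i js)
    then have "coroot_elt r i (t i) \<in> torus r" using t unfolding torus_def by (intro generate.incl UN_I[of i] imageI) auto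
    then show ?case using subgroup_Spin_simps(2)[OF subgroup_torus] Cons by (simp add: list_mult_def)
  qed
  note * = this
  have "set [1..<r + 1] \<subseteq> {1..r}" by auto
  from *[OF this] show "h \<in> torus r"
    using t torus_elt_as_list_mult[of r t] by (simp del: upt.simps One_nat_def)
qed

text \<open>Of all \<open>h\<^sub>j\<close> only \<open>h\<^sub>r\<close> pairs nontrivially with the highest weight \<open>\<Lambda>\<^sub>r\<close> of the spin
  representation, so the eigenvalue on the vector number \<open>0\<close> is \<open>t\<^sub>r\<close>.\<close>

lemma torus_char_fund_weight:
  assumes "1 \<le> r" "h \<in> torus r"
  shows "torus_char r (fund_weight r) h = h $$ (0, 0)"
proof -
  have P0: "spin_pairing r j 0 = (if j = r then 1 else 0)" if "j \<in> {1..r}" for j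
    using that by (simp add: spin_pairing_eq spin_sign_def)
  have char: "(\<Prod>j = 1..r. t j powi fund_weight r j) = torus_elt r t $$ (0, 0)" for t
    by (auto simp: torus_elt_def P0 fund_weight_def intro!: prod.cong)
  obtain t where t: "\<forall>j\<in>{1..r}. t j \<noteq> 0" "h = torus_elt r t" using assms(2) torus_eq by auto
  show ?thesis unfolding torus_char_def
  proof (rule the_equality)
    show "\<exists>t. (\<forall>j\<in>{1..r}. t j \<noteq> 0) \<and> h = list_mult (Spin r) (map (\<lambda>j. coroot_elt r j (t j)) [1..<r + 1]) \<and>
      h $$ (0, 0) = (\<Prod>j = 1..r. t j powi fund_weight r j)"
      using t char torus_elt_as_list_mult[of r t] by (intro exI[of _ t]) auto
  next
    fix c assume "\<exists>t. (\<forall>j\<in>{1..r}. t j \<noteq> 0) \<and> h = list_mult (Spin r) (map (\<lambda>j. coroot_elt r j (t j)) [1..<r + 1]) \<and>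
      c = (\<Prod>j = 1..r. t j powi fund_weight r j)"
    then show "c = h $$ (0, 0)" using char torus_elt_as_list_mult by auto
  qed
qed

lemma prod_powi: "(\<Prod>x\<in>A. f x powi n) = (\<Prod>x\<in>A. f x) powi n" for f :: "'b \<Rightarrow> complex"
  by (induction A rule: infinite_finite_induct) (auto simp: power_int_mult_distrib)

text \<open>The constant \<open>c\<close> is the value of \<open>-\<alpha>\<^sub>i\<close> at the torus element, since \<open>s\<^sub>i\<mu> = \<mu> - \<langle>\<mu>, h\<^sub>i\<rangle> \<alpha>\<^sub>i\<close>.\<close>

lemma torus_eigenvalue_reflect:
  fixes t :: "nat \<Rightarrow> complex"
  assumes i: "i \<in> {1..r}" and t: "\<forall>j\<in>{1..r}. t j \<noteq> 0"
  obtains c where "c \<noteq> 0"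
    "\<And>b. (\<Prod>j = 1..r. t j powi spin_pairing r j (reflect r i b)) =
      (\<Prod>j = 1..r. t j powi spin_pairing r j b) * c powi spin_pairing r i b"
proof
  let ?c = "\<Prod>j = 1..r. t j powi - cartan r j i"
  have "t j powi - cartan r j i \<noteq> 0" if "j \<in> {1..r}" for j
    using t that by (metis power_int_eq_0_iff)
  then show "?c \<noteq> 0" unfolding prod_zero_iff[OF finite_atLeastAtMost] by blast
  fix b
  have "(\<Prod>j = 1..r. t j powi spin_pairing r j (reflect r i b)) =
    (\<Prod>j = 1..r. t j powi spin_pairing r j b * (t j powi - cartan r j i) powi spin_pairing r i b)"
    using t i by (intro prod.cong)
      (auto simp: spin_pairing_reflect power_int_add[symmetric] power_int_mult[symmetric])
  then show "(\<Prod>j = 1..r. t j powi spin_pairing r j (reflect r i b)) =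
    (\<Prod>j = 1..r. t j powi spin_pairing r j b) * ?c powi spin_pairing r i b"
    by (simp add: prod.distrib prod_powi)
qed

text \<open>Conjugation by the lift permutes the eigenvalues of a torus element by \<open>s\<^sub>i\<close>. The permuted
  eigenvalues come from the torus element whose parameter number \<open>i\<close> has been multiplied by \<open>c\<close>.\<close>

lemma simple_lift_torus:
  assumes i: "i \<in> {1..r}" and h: "h \<in> torus r"
  obtains h' where "h' \<in> torus r" "simple_lift r i * h = h' * simple_lift r i"
proof -
  obtain t where t: "\<forall>j\<in>{1..r}. t j \<noteq> 0" "h = torus_elt r t" using h torus_eq by auto
  obtain c where c: "c \<noteq> 0"
    "\<And>b. (\<Prod>j = 1..r. t j powi spin_pairing r j (reflect r i b)) =
      (\<Prod>j = 1..r. t j powi spin_pairing r j b) * c powi spin_pairing r i b"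
    using torus_eigenvalue_reflect[OF i t(1)] by metis
  define t' where "t' j = t j * (if j = i then c else 1)" for j
  have t'1: "\<forall>j\<in>{1..r}. t' j \<noteq> 0" using t(1) c(1) by (simp add: t'_def)
  have t'2: "(\<Prod>j = 1..r. t j powi spin_pairing r j (reflect r i b)) = (\<Prod>j = 1..r. t' j powi spin_pairing r j b)" for b
  proof -
    have "(\<Prod>j = 1..r. (if j = i then c else 1) powi spin_pairing r j b) =
        (\<Prod>j = 1..r. if j = i then c powi spin_pairing r i b else 1)"
      by (intro prod.cong) auto
    also have "\<dots> = c powi spin_pairing r i b" using i by simp
    finally show ?thesis by (simp add: c(2) t'_def power_int_mult_distrib prod.distrib del: One_nat_def)
  qed
  have "simple_lift r i * h = torus_elt r t' * simple_lift r i"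
    unfolding t(2)
    by (rule spin_mat_eqI[of _ r])
     (use i t'2 in \<open>auto simp: torus_elt_mult simple_lift_mult spin_mat_assoc[of _ r] reflect_less
      simp del: index_mult_mat(1) right_mult_one_mat\<close>)
  then show ?thesis using that t'1 torus_eq by blast
qed

definition word_lift :: "nat \<Rightarrow> nat list \<Rightarrow> complex mat" where
  "word_lift r js = list_mult (Spin r) (map (simple_lift r) js)"

lemma word_lift_simps [simp]:
  "word_lift r [] = 1\<^sub>m (2 ^ r)" "word_lift r (j # js) = simple_lift r j * word_lift r js"
  by (simp_all add: word_lift_def list_mult_def)

lemma word_lift_Spin: "set js \<subseteq> {1..r} \<Longrightarrow> word_lift r js \<in> carrier (Spin r)"
  by (induction js) (auto intro!: Spin_mult_closed Spin_one_closed simple_lift_Spin)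

lemma word_lift_carrier [simp]: "word_lift r js \<in> spin_mat r"
  by (induction js) auto

lemma word_lift_append: "word_lift r (js @ ks) = word_lift r js * word_lift r ks"
  by (induction js) (auto simp: left_mult_one_mat[OF word_lift_carrier] spin_mat_assoc[of _ r])

lemma word_lift_torus:
  assumes "set js \<subseteq> {1..r}" "h \<in> torus r"
  shows "\<exists>h'\<in>torus r. word_lift r js * h = h' * word_lift r js"
  using assms
proof (induction js)
  case Nil
  then show ?case using subgroup_Spin_simps(5)[OF subgroup_torus, of h r] by (intro bexI[of _ h]) auto
next
  case (Cons j js)
  then obtain h1 where h1: "h1 \<in> torus r" "word_lift r js * h = h1 * word_lift r js" by auto
  obtain h2 where h2: "h2 \<in> torus r" "simple_lift r j * h1 = h2 * simple_lift r j"
    using simple_lift_torus[of j r h1] h1 Cons.prems by auto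
  have c: "h \<in> spin_mat r" "h1 \<in> spin_mat r" "h2 \<in> spin_mat r"
    using Cons.prems h1 h2 subgroup_Spin_simps(5)[OF subgroup_torus] by auto
  have "word_lift r (j # js) * h = simple_lift r j * (h1 * word_lift r js)"
    using c h1 by (simp add: spin_mat_assoc[of _ r])
  also have "\<dots> = h2 * word_lift r (j # js)"
    using c h2 by (simp add: spin_mat_assoc[of _ r, symmetric])
  finally show ?case using h2 by auto
qed

text \<open>Products in the quotient group are products of sets of matrices, and it suffices that the left
  representative can be moved past the torus.\<close>

lemma coset_mult:
  assumes "A \<in> spin_mat r" "B \<in> spin_mat r" "\<And>h. h \<in> torus r \<Longrightarrow> \<exists>h'\<in>torus r. A * h = h' * A"
  shows "(torus r #>\<^bsub>Spin r\<^esub> A) <#>\<^bsub>Spin r\<^esub> (torus r #>\<^bsub>Spin r\<^esub> B) = torus r #>\<^bsub>Spin r\<^esub> (A * B)"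
proof (intro Set.set_eqI iffI)
  note T = subgroup_Spin_simps[OF subgroup_torus]
  fix x
  {
    assume "x \<in> (torus r #>\<^bsub>Spin r\<^esub> A) <#>\<^bsub>Spin r\<^esub> (torus r #>\<^bsub>Spin r\<^esub> B)"
    then obtain h k where hk: "h \<in> torus r" "k \<in> torus r" "x = h * A * (k * B)"
      by (auto simp: r_coset_def set_mult_def)
    obtain k' where k': "k' \<in> torus r" "A * k = k' * A" using assms(3)[OF hk(2)] by auto
    have "x = h * ((A * k) * B)" using hk T(5) assms by (simp add: spin_mat_assoc[of _ r])
    also have "\<dots> = h * k' * (A * B)" using k' hk T(5) assms by (simp add: spin_mat_assoc[of _ r])
    finally show "x \<in> torus r #>\<^bsub>Spin r\<^esub> (A * B)" using hk k' T(2) by (auto simp: r_coset_def)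
  next
    assume "x \<in> torus r #>\<^bsub>Spin r\<^esub> (A * B)"
    then obtain h where h: "h \<in> torus r" "x = h * (A * B)" by (auto simp: r_coset_def)
    then have "x = h * A * (1\<^sub>m (2 ^ r) * B)" using T(5) assms by (simp add: spin_mat_assoc[of _ r])
    then show "x \<in> (torus r #>\<^bsub>Spin r\<^esub> A) <#>\<^bsub>Spin r\<^esub> (torus r #>\<^bsub>Spin r\<^esub> B)"
      using h T(1) by (auto simp: r_coset_def set_mult_def)
  }
qed

lemma weyl_group_simps: "mult (weyl_group r) = set_mult (Spin r)" "one (weyl_group r) = torus r"
  by (simp_all add: weyl_group_def FactGroup_def set_mult_def fun_eq_iff)

lemma torus_coset_one: "torus r #>\<^bsub>Spin r\<^esub> 1\<^sub>m (2 ^ r) = torus r"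
  using right_mult_one_mat[OF subgroup_Spin_simps(5)[OF subgroup_torus]] by (auto simp: r_coset_def)

lemma weyl_word_eq:
  "set js \<subseteq> {1..r} \<Longrightarrow> weyl_word r js = torus r #>\<^bsub>Spin r\<^esub> word_lift r js"
proof (induction js)
  case Nil
  then show ?case by (simp add: weyl_word_def list_mult_def weyl_group_simps torus_coset_one)
next
  case (Cons j js)
  then have "weyl_word r (j # js) = (torus r #>\<^bsub>Spin r\<^esub> simple_lift r j) <#>\<^bsub>Spin r\<^esub> (torus r #>\<^bsub>Spin r\<^esub> word_lift r js)"
    by (simp add: weyl_word_def list_mult_def weyl_group_simps simple_refl_def)
  also have "\<dots> = torus r #>\<^bsub>Spin r\<^esub> (simple_lift r j * word_lift r js)"
    using Cons.prems simple_lift_torus[of j r] by (intro coset_mult) (auto, metis)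
  finally show ?case by simp
qed

lemma weyl_word_concat:
  assumes "\<And>js. js \<in> set jss \<Longrightarrow> set js \<subseteq> {1..r}"
  shows "list_mult (weyl_group r) (map (weyl_word r) jss) = weyl_word r (concat jss)"
  using assms
proof (induction jss)
  case Nil
  then show ?case by (simp add: weyl_word_def list_mult_def)
next
  case (Cons js jss)
  have js: "set js \<subseteq> {1..r}" "set (concat jss) \<subseteq> {1..r}" using Cons.prems by auto
  have "list_mult (weyl_group r) (map (weyl_word r) (js # jss)) =
      (torus r #>\<^bsub>Spin r\<^esub> word_lift r js) <#>\<^bsub>Spin r\<^esub> (torus r #>\<^bsub>Spin r\<^esub> word_lift r (concat jss))"
    using Cons.IH Cons.prems js by (simp add: weyl_word_eq list_mult_def weyl_group_simps)
  also have "\<dots> = torus r #>\<^bsub>Spin r\<^esub> (word_lift r js * word_lift r (concat jss))"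
    using word_lift_torus[OF js(1)] by (intro coset_mult) auto
  finally show ?case using js by (simp add: weyl_word_eq word_lift_append)
qed

section \<open>Lengths and signs of lifts\<close>

definition word_act :: "nat \<Rightarrow> nat list \<Rightarrow> nat \<Rightarrow> nat" where
  "word_act r js a = foldr (reflect r) js a"

lemma word_act_simps [simp]:
  "word_act r [] a = a" "word_act r (j # js) a = reflect r j (word_act r js a)"
  by (simp_all add: word_act_def)

lemma word_act_less: "set js \<subseteq> {1..r} \<Longrightarrow> a < 2 ^ r \<Longrightarrow> word_act r js a < 2 ^ r"
  by (induction js) (auto simp: reflect_less)

text \<open>The lift of a word is a monomial matrix, so its coset modulo the torus remembers the permutation of the
  weights. This makes combinatorial invariants of words well defined on the Weyl group.\<close>

lemma word_lift_nonzero_iff: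
  assumes "set js \<subseteq> {1..r}" "a < 2 ^ r" "b < 2 ^ r"
  shows "word_lift r js $$ (b, a) \<noteq> 0 \<longleftrightarrow> b = word_act r js a"
  using assms
proof (induction js arbitrary: b)
  case (Cons j js)
  then have j: "j \<in> {1..r}" by simp
  have "word_lift r (j # js) $$ (b, a) \<noteq> 0 \<longleftrightarrow> word_lift r js $$ (reflect r j b, a) \<noteq> 0"
    using Cons.prems j by (simp add: simple_lift_mult del: index_mult_mat(1))
  also have "\<dots> \<longleftrightarrow> reflect r j b = word_act r js a"
    using Cons j by (intro Cons.IH) (auto simp: reflect_less)
  also have "\<dots> \<longleftrightarrow> b = reflect r j (word_act r js a)"
    using Cons.prems reflect_reflect[OF j, of b] reflect_reflect[OF j, of "word_act r js a"]
      word_act_less[of js r a] by auto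
  finally show ?case by simp
qed simp

lemma word_act_eq_if_weyl_word_eq:
  assumes js: "set js \<subseteq> {1..r}" and ks: "set ks \<subseteq> {1..r}"
    and eq: "weyl_word r js = weyl_word r ks" and a: "a < 2 ^ r"
  shows "word_act r js a = word_act r ks a"
proof -
  note T = subgroup_Spin_simps[OF subgroup_torus]
  have "word_lift r js \<in> torus r #>\<^bsub>Spin r\<^esub> word_lift r ks"
    unfolding weyl_word_eq[OF ks, symmetric] eq[symmetric] weyl_word_eq[OF js]
    using T(1)[of r] by (auto simp: r_coset_def left_mult_one_mat[OF word_lift_carrier] intro!: bexI[of _ "1\<^sub>m (2 ^ r)"])
  then obtain h where h: "h \<in> torus r" "word_lift r js = h * word_lift r ks" by (auto simp: r_coset_def)
  obtain t where t: "h = torus_elt r t" using h torus_eq by auto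
  define b where "b = word_act r js a"
  have b: "b < 2 ^ r" using word_act_less[OF js a] by (simp add: b_def)
  have "word_lift r js $$ (b, a) \<noteq> 0" using word_lift_nonzero_iff[OF js a b] by (simp add: b_def)
  then have "word_lift r ks $$ (b, a) \<noteq> 0"
    unfolding h(2) t torus_elt_mult[OF word_lift_carrier b a] by simp
  then show ?thesis using word_lift_nonzero_iff[OF ks a b] by (simp add: b_def)
qed

definition reflect_vec :: "nat \<Rightarrow> nat \<Rightarrow> (nat \<Rightarrow> int) \<Rightarrow> nat \<Rightarrow> int" where
  "reflect_vec r i v = (if i = r then v(r := - v r) else v \<circ> transpose i (i + 1))"

lemma reflect_vec_cong:
  assumes "\<And>k. k \<in> {1..r} \<Longrightarrow> v k = w k" "i \<in> {1..r}" "k \<in> {1..r}"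
  shows "reflect_vec r i v k = reflect_vec r i w k"
  using assms by (auto simp: reflect_vec_def transpose_def)

text \<open>The simple root \<open>\<alpha>\<^sub>i\<close> as a linear form in the coordinates.\<close>

definition root_value :: "nat \<Rightarrow> nat \<Rightarrow> (nat \<Rightarrow> int) \<Rightarrow> int" where
  "root_value r i v = (if i = r then v r else v i - v (i + 1))"

text \<open>Counts the positive roots \<open>\<epsilon>\<^sub>i\<close>, \<open>\<epsilon>\<^sub>p - \<epsilon>\<^sub>q\<close>, \<open>\<epsilon>\<^sub>p + \<epsilon>\<^sub>q\<close> (\<open>p < q\<close>) that are negative at \<open>v\<close>.\<close>

definition neg_roots :: "nat \<Rightarrow> (nat \<Rightarrow> int) \<Rightarrow> nat" where
  "neg_roots r v = (\<Sum>i = 1..r. of_bool (v i < 0)) +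
     (\<Sum>(p, q) \<in> Sigma {1..r} (\<lambda>p. {p<..r}). of_bool (v p < v q) + of_bool (v p + v q < 0))"

lemma neg_roots_cong:
  assumes "\<And>k. k \<in> {1..r} \<Longrightarrow> v k = w k"
  shows "neg_roots r v = neg_roots r w"
  unfolding neg_roots_def using assms by (intro arg_cong2[of _ _ _ _ "(+)"] sum.cong) auto

text \<open>A simple reflection permutes the positive roots other than its own root, which changes sign.\<close>

lemma neg_roots_reflect:
  assumes i: "i \<in> {1..r}"
  shows "neg_roots r (reflect_vec r i v) + of_bool (root_value r i v < 0) =
    neg_roots r v + of_bool (root_value r i v > 0)"
proof (cases "i = r")
  case True
  have "(\<Sum>k = 1..r. of_bool ((v(r := - v r)) k < 0)) = of_bool (v r > 0) + (\<Sum>k\<in>{1..r} - {r}. of_bool (v k < 0) :: nat)"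
    using i True by (subst sum.remove[of _ r]) auto
  moreover have "(\<Sum>k = 1..r. of_bool (v k < 0)) = of_bool (v r < 0) + (\<Sum>k\<in>{1..r} - {r}. of_bool (v k < 0) :: nat)"
    using i True by (subst sum.remove[of _ r]) auto
  moreover have "(\<Sum>(p, q) \<in> Sigma {1..r} (\<lambda>p. {p<..r}). of_bool ((v(r := - v r)) p < (v(r := - v r)) q) +
        of_bool ((v(r := - v r)) p + (v(r := - v r)) q < 0)) =
      (\<Sum>(p, q) \<in> Sigma {1..r} (\<lambda>p. {p<..r}). of_bool (v p < v q) + of_bool (v p + v q < 0) :: nat)"
    by (rule sum.cong) (auto split: if_splits)
  ultimately show ?thesis using True
    by (simp add: neg_roots_def reflect_vec_def root_value_def del: fun_upd_apply)
next
  case False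
  let ?t = "transpose i (i + 1)"
  define S where "S = Sigma {1..r} (\<lambda>p. {p<..r}) - {(i, i + 1)}"
  have S: "Sigma {1..r} (\<lambda>p. {p<..r}) = insert (i, i + 1) S" "(i, i + 1) \<notin> S" "finite S"
    using i False by (auto simp: S_def)
  define g :: "int \<Rightarrow> int \<Rightarrow> nat" where "g a b = of_bool (a < b) + of_bool (a + b < 0)" for a b
  have singles: "(\<Sum>k = 1..r. of_bool ((v \<circ> ?t) k < 0)) = (\<Sum>k = 1..r. of_bool (v k < 0) :: nat)"
    by (rule sum.reindex_bij_witness[of _ ?t ?t]) (use i False in \<open>auto simp: transpose_def\<close>)
  have pairs: "(\<Sum>(p, q) \<in> S. g ((v \<circ> ?t) p) ((v \<circ> ?t) q)) = (\<Sum>(p, q) \<in> S. g (v p) (v q))"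
    by (rule sum.reindex_bij_witness[of _ "\<lambda>(p, q). (?t p, ?t q)" "\<lambda>(p, q). (?t p, ?t q)"])
      (use i False in \<open>auto simp: S_def transpose_def split: if_splits\<close>)
  have *: "neg_roots r w = (\<Sum>k = 1..r. of_bool (w k < 0)) + g (w i) (w (i + 1)) + (\<Sum>(p, q) \<in> S. g (w p) (w q))" for w
    unfolding neg_roots_def S(1) using S(2,3) by (simp add: g_def)
  have "neg_roots r (v \<circ> ?t) = (\<Sum>k = 1..r. of_bool (v k < 0)) + g (v (i + 1)) (v i) + (\<Sum>(p, q) \<in> S. g (v p) (v q))"
    unfolding * singles pairs by simp
  then show ?thesis using False unfolding *[of v]
    by (auto simp: reflect_vec_def root_value_def g_def add.commute)
qed

text \<open>The vectors \<open>push_bit p (mask (r - p))\<close> have the signs \<open>+\<close> up to position \<open>p\<close> and \<open>-\<close> after it. The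
  sum of their weights and of \<open>r\<close> copies of the highest weight is a regular dominant weight
  (see \<open>orbit_vec_Nil\<close>). This function is twice the vector of coordinates of its image under the word. It is
  written as a sum over weight vectors so that it visibly depends only on the permutation of the weights.\<close>

definition orbit_vec :: "nat \<Rightarrow> nat list \<Rightarrow> nat \<Rightarrow> int" where
  "orbit_vec r js k = (\<Sum>p = 1..r. spin_sign (word_act r js (push_bit p (mask (r - p)))) k)
     + int r * spin_sign (word_act r js 0) k"

lemma push_bit_mask_less: "push_bit p (mask (r - p)) < (2::nat) ^ r"
  by (rule less_exp_if_bits) (auto simp: bit_push_bit_iff bit_mask_iff)

lemma orbit_vec_Cons:
  assumes "j \<in> {1..r}" "k \<in> {1..r}"
  shows "orbit_vec r (j # js) k = reflect_vec r j (orbit_vec r js) k"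
  using assms
  by (auto simp: orbit_vec_def reflect_vec_def spin_sign_reflect sum_negf)

lemma orbit_vec_eq_if_weyl_word_eq:
  assumes "set js \<subseteq> {1..r}" "set ks \<subseteq> {1..r}" "weyl_word r js = weyl_word r ks"
  shows "orbit_vec r js = orbit_vec r ks"
  using word_act_eq_if_weyl_word_eq[OF assms] push_bit_mask_less by (simp add: orbit_vec_def fun_eq_iff)

lemma orbit_vec_Nil:
  assumes "k \<in> {1..r}"
  shows "orbit_vec r [] k = 2 * (int r + 1 - int k)"
proof -
  have "(\<Sum>p = 1..r. spin_sign (push_bit p (mask (r - p))) k) = (\<Sum>p\<in>{1..<k} \<union> {k..r}. if p < k then - 1 else 1)"
    using assms by (intro sum.cong) (auto simp: spin_sign_def bit_push_bit_iff bit_mask_iff)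
  also have "\<dots> = (\<Sum>p\<in>{1..<k}. - 1) + (\<Sum>p\<in>{k..r}. 1 :: int)"
    by (subst sum.union_disjoint) auto
  also have "\<dots> = int r + 2 - 2 * int k" using assms by (simp add: of_nat_diff)
  finally show ?thesis using assms by (simp add: orbit_vec_def spin_sign_def)
qed

text \<open>The highest weight outweighs the other summands: it occurs \<open>r + 1\<close> times, against \<open>r - 1\<close> other signs.
  So the orbit of the regular weight also records the orbit of \<open>\<Lambda>\<^sub>r\<close>.\<close>

lemma orbit_vec_sign:
  assumes "1 \<le> r"
  shows "spin_sign (word_act r js 0) k * orbit_vec r js k > 0"
proof -
  define f where "f p = spin_sign (word_act r js (push_bit p (mask (r - p)))) k" for p
  have f: "f p \<le> 1 \<and> f p \<ge> -1" for p using spin_sign_cases[of "word_act r js (push_bit p (mask (r - p)))" k] by (auto simp: f_def)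
  have fr: "f r = spin_sign (word_act r js 0) k" by (simp add: f_def mask_0)
  have eq: "orbit_vec r js k = (\<Sum>p\<in>{1..<r}. f p) + (int r + 1) * f r"
  proof -
    have "{1..r} = insert r {1..<r}" using assms by auto
    then show ?thesis using fr by (simp add: orbit_vec_def f_def algebra_simps)
  qed
  have "(\<Sum>p\<in>{1..<r}. f p) \<le> (\<Sum>p\<in>{1..<r}. 1)" "(\<Sum>p\<in>{1..<r}. f p) \<ge> (\<Sum>p\<in>{1..<r}. - 1)"
    using f by (intro sum_mono; blast)+
  then have "(\<Sum>p\<in>{1..<r}. f p) < int r" "(\<Sum>p\<in>{1..<r}. f p) > - int r" using assms by (auto simp: of_nat_diff)
  then show ?thesis using spin_sign_cases[of "word_act r js 0" k] fr unfolding eq by (auto simp: fr)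
qed

lemma neg_roots_orbit_vec_Cons:
  assumes "j \<in> {1..r}"
  shows "neg_roots r (orbit_vec r (j # js)) + of_bool (root_value r j (orbit_vec r js) < 0) =
    neg_roots r (orbit_vec r js) + of_bool (root_value r j (orbit_vec r js) > 0)"
  using neg_roots_cong[of r "orbit_vec r (j # js)" "reflect_vec r j (orbit_vec r js)"]
    orbit_vec_Cons[OF assms] neg_roots_reflect[OF assms] by simp

lemma neg_roots_le_length:
  "set js \<subseteq> {1..r} \<Longrightarrow> neg_roots r (orbit_vec r js) \<le> length js"
proof (induction js)
  case Nil
  have "neg_roots r (orbit_vec r []) = neg_roots r (\<lambda>k. 2 * (int r + 1 - int k))"
    by (rule neg_roots_cong) (rule orbit_vec_Nil)
  also have "\<dots> = 0" by (auto simp: neg_roots_def)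
  finally show ?case by simp
next
  case (Cons j js)
  then show ?case using neg_roots_orbit_vec_Cons[of j r js] by (auto simp: of_bool_def simp del: One_nat_def split: if_splits)
qed

text \<open>If every letter increases the number of negative roots, then each letter \<open>j\<close> meets a weight vector in the
  orbit of the highest one on which \<open>h\<^sub>j\<close> is nonnegative, and the lift of \<open>j\<close> acts without a sign.\<close>

lemma word_lift_highest_vector:
  assumes "set js \<subseteq> {1..r}" "neg_roots r (orbit_vec r js) = length js"
  shows "word_lift r js $$ (word_act r js 0, 0) = 1"
  using assms
proof (induction js)
  case (Cons j js)
  then have j: "j \<in> {1..r}" and js: "set js \<subseteq> {1..r}" by auto
  define b where "b = word_act r js 0"
  have b: "b < 2 ^ r" using word_act_less[OF js] by (simp add: b_def)
  have le: "neg_roots r (orbit_vec r js) \<le> length js" using neg_roots_le_length[OF js] .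
  \<comment> \<open>The number of negative roots of the remaining word is at most its length, so the letter \<open>j\<close> must add one.\<close>
  then have root: "root_value r j (orbit_vec r js) > 0" and len: "neg_roots r (orbit_vec r js) = length js"
    using neg_roots_orbit_vec_Cons[OF j, of js] Cons.prems(2) by (auto simp: of_bool_def split: if_splits)
  have pos: "spin_sign b k * orbit_vec r js k > 0" for k
    using orbit_vec_sign[of r js k] j by (simp add: b_def)
  have "spin_pairing r j b \<noteq> -1"
    using root pos[of r] pos[of j] pos[of "j + 1"] spin_sign_cases[of b r] spin_sign_cases[of b j] spin_sign_cases[of b "j + 1"] j
    by (auto simp: spin_pairing_eq root_value_def split: if_splits)
  then have "word_lift r (j # js) $$ (reflect r j b, 0) = word_lift r js $$ (b, 0)"
    using j b by (simp add: simple_lift_mult reflect_less reflect_reflect spin_pairing_reflect_self del: index_mult_mat(1))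
  then show ?case using Cons.IH[OF js len] by (simp add: b_def)
qed simp

text \<open>The Coxeter word shifts the coordinates by one position and brings the last one, negated, to the front. The
  statement for the final segment \<open>i, \<dots>, r\<close> of the word is what the induction needs.\<close>

lemma foldr_reflect_vec_cycle:
  assumes "1 \<le> i" "i \<le> r" "k \<le> r"
  shows "foldr (reflect_vec r) [i..<r + 1] v k = (if k < i then v k else if k = i then - v r else v (k - 1))"
  using assms(2,1,3)
proof (induction i arbitrary: k rule: inc_induct)
  case base
  then show ?case by (simp add: reflect_vec_def)
next
  case (step n)
  have "foldr (reflect_vec r) [n..<r + 1] v = foldr (reflect_vec r) [Suc n..<r + 1] v \<circ> transpose n (n + 1)"
    using step.hyps by (simp add: upt_conv_Cons reflect_vec_def del: upt_Suc)
  then show ?case using step by (auto simp: transpose_def)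
qed

lemma orbit_vec_append:
  assumes "set js \<subseteq> {1..r}" "k \<in> {1..r}"
  shows "orbit_vec r (js @ ks) k = foldr (reflect_vec r) js (orbit_vec r ks) k"
  using assms
proof (induction js arbitrary: k)
  case (Cons j js)
  then have "orbit_vec r (j # js @ ks) k = reflect_vec r j (orbit_vec r (js @ ks)) k"
    by (intro orbit_vec_Cons) auto
  also have "\<dots> = reflect_vec r j (foldr (reflect_vec r) js (orbit_vec r ks)) k"
    using Cons by (intro reflect_vec_cong[of r]) auto
  finally show ?case by simp
qed simp

lemma set_cyclic_word: "set (cyclic_word r m) \<subseteq> {1..r}"
  by (auto simp: cyclic_word_def)

lemma length_cyclic_word: "length (cyclic_word r m) = m * r"
  by (induction m) (auto simp: cyclic_word_def)

lemma orbit_vec_cyclic_word: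
  assumes "m \<le> r" "k \<in> {1..r}"
  shows "orbit_vec r (cyclic_word r m) k =
    (if k \<le> m then - 2 * (int m + 1 - int k) else 2 * (int r + 1 + int m - int k))"
  using assms
proof (induction m arbitrary: k)
  case 0
  then show ?case using orbit_vec_Nil[of k r] by (simp add: cyclic_word_def)
next
  case (Suc m)
  have "orbit_vec r (cyclic_word r (Suc m)) k =
      foldr (reflect_vec r) [1..<r + 1] (orbit_vec r (cyclic_word r m)) k"
    unfolding cyclic_word_def replicate_Suc concat.simps
    by (rule orbit_vec_append) (use Suc.prems in auto)
  also have "\<dots> = (if k < 1 then orbit_vec r (cyclic_word r m) k
      else if k = 1 then - orbit_vec r (cyclic_word r m) r else orbit_vec r (cyclic_word r m) (k - 1))"
    by (rule foldr_reflect_vec_cycle) (use Suc.prems in auto)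
  also have "\<dots> = (if k \<le> Suc m then - 2 * (int (Suc m) + 1 - int k) else 2 * (int r + 1 + int (Suc m) - int k))"
  proof (cases "k = 1")
    case False
    then have "k - 1 \<in> {1..r}" "int (k - 1) = int k - 1" using Suc.prems by auto
    then show ?thesis using Suc.IH[of "k - 1"] Suc.prems False by (auto simp del: One_nat_def)
  qed (use Suc.IH[of r] Suc.prems in auto)
  finally show ?case .
qed

lemma neg_roots_cyclic_word:
  assumes "m \<le> r"
  shows "neg_roots r (orbit_vec r (cyclic_word r m)) = m * r"
proof -
  define v where "v k = (if k \<le> m then - 2 * (int m + 1 - int k) else 2 * (int r + 1 + int m - int k))" for k
  have "neg_roots r (orbit_vec r (cyclic_word r m)) = neg_roots r v"
    unfolding v_def by (rule neg_roots_cong) (rule orbit_vec_cyclic_word[OF assms])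
  also have "\<dots> = (\<Sum>p = 1..r. of_bool (p \<le> m) + (\<Sum>q\<in>{p<..r}. of_bool (p \<le> m) + of_bool (q \<le> m)))"
    unfolding neg_roots_def sum.Sigma[symmetric, OF finite_atLeastAtMost ballI[OF finite_greaterThanAtMost]]
    unfolding sum.distrib[symmetric]
    by (intro sum.cong refl arg_cong2[of _ _ _ _ "(+)"]) (auto simp: v_def split: if_splits)
  also have "\<dots> = (\<Sum>p = 1..r. of_bool (p \<le> m) * (1 + (r - p)) + (m - p))"
  proof (intro sum.cong refl)
    fix p
    have "{p<..r} \<inter> {q. q \<le> m} = {p<..m}" using assms by auto
    then show "of_bool (p \<le> m) + (\<Sum>q\<in>{p<..r}. of_bool (p \<le> m) + of_bool (q \<le> m)) = of_bool (p \<le> m) * (1 + (r - p)) + (m - p)"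
      by (simp add: sum.distrib sum_of_bool_eq)
  qed
  also have "\<dots> = (\<Sum>p = 1..m. 1 + (r - p) + (m - p))"
    using assms by (intro sum.mono_neutral_cong_right) auto
  also have "int \<dots> = (\<Sum>p = 1..m. 1 + int r + int m - 2 * int p)"
    unfolding of_nat_sum using assms by (intro sum.cong) (auto simp: of_nat_diff)
  also have "(\<Sum>p = 1..m. 1 + int r + int m - 2 * int p) = int m * int r"
  proof -
    have *: "(\<Sum>p = 1..n. c - 2 * int p) = int n * c - int n * (int n + 1)" for n c
      by (induction n) (auto simp: algebra_simps)
    show ?thesis by (subst *) (simp add: algebra_simps)
  qed
  finally show ?thesis by (metis of_nat_eq_iff of_nat_mult)
qed

text \<open>The number of negative roots is an invariant of the Weyl group element and bounds the length of every word for
  it from below; the cyclic word attains the bound as long as \<open>m \<le> r\<close>.\<close>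

lemma reduced_cyclic_word:
  assumes "m \<le> r"
  shows "reduced_word r (weyl_word r (cyclic_word r m)) (cyclic_word r m)"
  unfolding reduced_word_def
proof (intro conjI allI impI)
  fix ks assume ks: "set ks \<subseteq> {1..r} \<and> weyl_word r ks = weyl_word r (cyclic_word r m)"
  then have "m * r = neg_roots r (orbit_vec r ks)"
    using orbit_vec_eq_if_weyl_word_eq[of ks r "cyclic_word r m"] neg_roots_cyclic_word[OF assms] set_cyclic_word by simp
  also have "\<dots> \<le> length ks" using ks by (intro neg_roots_le_length) auto
  finally show "length (cyclic_word r m) \<le> length ks" by (simp add: length_cyclic_word)
qed (use set_cyclic_word in auto)

text \<open>The choice of a reduced word in the definition of the lift is harmless on the highest weight vector: every
  reduced word has \<open>m r\<close> letters and the same number of negative roots. The number \<open>mask m\<close> has its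
  \<open>m\<close> lowest bits set, that is, minus signs at \<open>1, \<dots>, m\<close>.\<close>

lemma weyl_lift_cyclic_word:
  assumes "m \<le> r" "1 \<le> r"
  obtains js where "set js \<subseteq> {1..r}" "weyl_lift r (weyl_word r (cyclic_word r m)) = word_lift r js"
    "word_act r js 0 = mask m" "word_lift r js $$ (mask m, 0) = 1"
proof -
  define w where "w = weyl_word r (cyclic_word r m)"
  define js where "js = (SOME js. reduced_word r w js)"
  have red: "reduced_word r w js" unfolding js_def w_def by (rule someI, rule reduced_cyclic_word[OF assms(1)])
  then have js: "set js \<subseteq> {1..r}" "weyl_word r js = w" and "length js \<le> length (cyclic_word r m)"
    using set_cyclic_word by (auto simp: reduced_word_def w_def)
  have ov: "orbit_vec r js = orbit_vec r (cyclic_word r m)"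
    using orbit_vec_eq_if_weyl_word_eq[OF js(1) set_cyclic_word] js by (simp add: w_def)
  have "neg_roots r (orbit_vec r js) = length js"
    using neg_roots_le_length[OF js(1)] \<open>length js \<le> length (cyclic_word r m)\<close>
    by (simp add: ov neg_roots_cyclic_word assms length_cyclic_word)
  then have one: "word_lift r js $$ (word_act r js 0, 0) = 1"
    using word_lift_highest_vector[OF js(1)] by blast
  have "word_act r js 0 = mask m"
  proof (rule eq_if_spin_signs_eq[of _ r])
    show "mask m < (2 :: nat) ^ r" using assms by (auto intro!: less_exp_if_bits simp: bit_mask_iff)
    fix k assume k: "k \<in> {1..r}"
    show "spin_sign (word_act r js 0) k = spin_sign (mask m) k"
      using orbit_vec_sign[OF assms(2), of js k] spin_sign_cases[of "word_act r js 0" k] k assms(1)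
      unfolding ov orbit_vec_cyclic_word[OF assms(1) k]
      by (auto simp: spin_sign_def bit_mask_iff split: if_splits)
  qed (use word_act_less[OF js(1)] in auto)
  then show ?thesis using that[of js] js one by (simp add: weyl_lift_def word_lift_def js_def w_def)
qed

section \<open>Density of the big cell and the minors of the last fundamental weight\<close>

text \<open>Twice the pairing of the weight with the sum of the fundamental coweights, which raising operators
  increase.\<close>

definition height :: "nat \<Rightarrow> nat \<Rightarrow> int" where
  "height r a = (\<Sum>k = 1..r. (int r + 1 - int k) * spin_sign a k)"

lemma height_reflect:
  assumes i: "i \<in> {1..r}"
  shows "height r (reflect r i a) = height r a - 2 * spin_pairing r i a"
proof (cases "i = r")
  case True
  have "height r (reflect r i a) - height r a =
      (\<Sum>k = 1..r. (int r + 1 - int k) * (spin_sign (reflect r i a) k - spin_sign a k))"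
    by (simp add: height_def sum_subtractf[symmetric] algebra_simps)
  also have "\<dots> = (\<Sum>k = 1..r. if k = r then - 2 * spin_sign a r else 0)"
    using i True by (intro sum.cong) (auto simp: spin_sign_reflect)
  finally show ?thesis using i True by (simp add: spin_pairing_eq)
next
  case False
  let ?t = "transpose i (i + 1)"
  have "height r (reflect r i a) = (\<Sum>k = 1..r. (int r + 1 - int k) * spin_sign a (?t k))"
    unfolding height_def using i False by (intro sum.cong) (auto simp: spin_sign_reflect)
  also have "\<dots> = (\<Sum>k = 1..r. (int r + 1 - int (?t k)) * spin_sign a k)"
    by (rule sum.reindex_bij_witness[of _ ?t ?t]) (use i False in \<open>auto simp: transpose_def\<close>)
  finally have "height r (reflect r i a) - height r a =
      (\<Sum>k = 1..r. (int k - int (?t k)) * spin_sign a k)"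
    by (simp add: height_def sum_subtractf[symmetric] algebra_simps)
  also have "\<dots> = (\<Sum>k = 1..r. (if k = i then - spin_sign a i else 0) + (if k = i + 1 then spin_sign a (i + 1) else 0))"
    by (intro sum.cong) (auto simp: transpose_def)
  also have "\<dots> = spin_sign a (i + 1) - spin_sign a i"
    using i False by (simp add: sum.distrib)
  finally show ?thesis using i False spin_sign_cases[of a i] spin_sign_cases[of a "i + 1"]
    by (auto simp: spin_pairing_eq)
qed

lemma height_le: "height r a \<le> height r 0"
  unfolding height_def by (rule sum_mono) (auto simp: spin_sign_def)

text \<open>Unitriangular with respect to the partial order that \<open>f\<close> induces on the indices; the order of the natural
  numbers is not compatible with the weights.\<close>

definition unitriangular :: "nat \<Rightarrow> (nat \<Rightarrow> int) \<Rightarrow> complex mat set" where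
  "unitriangular r f = {A \<in> spin_mat r. \<forall>a<2 ^ r. \<forall>b<2 ^ r.
     (a = b \<longrightarrow> A $$ (b, a) = 1) \<and> (a \<noteq> b \<longrightarrow> A $$ (b, a) \<noteq> 0 \<longrightarrow> f a < f b)}"

lemma unitriangularD:
  assumes "A \<in> unitriangular r f" "a < 2 ^ r" "b < 2 ^ r"
  shows "A $$ (a, a) = 1" "a \<noteq> b \<Longrightarrow> A $$ (b, a) \<noteq> 0 \<Longrightarrow> f a < f b" "A \<in> spin_mat r"
  using assms by (auto simp: unitriangular_def)

lemma unitriangular_mult:
  assumes A: "A \<in> unitriangular r f" and B: "B \<in> unitriangular r f"
  shows "A * B \<in> unitriangular r f"
proof -
  have c: "A \<in> spin_mat r" "B \<in> spin_mat r" using A B by (auto simp: unitriangular_def)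
  have diag: "(A * B) $$ (a, a) = 1" if a: "a < 2 ^ r" for a
  proof -
    have zero: "A $$ (a, c) * B $$ (c, a) = 0" if "c < 2 ^ r" "c \<noteq> a" for c
      using unitriangularD(2)[OF A that(1) a that(2)] unitriangularD(2)[OF B a that(1)] that(2) by force
    have "(A * B) $$ (a, a) = (\<Sum>c<2 ^ r. if c = a then 1 else 0)"
      unfolding mult_mat_entry[OF c a a]
      by (rule sum.cong) (use zero unitriangularD(1)[OF A a a] unitriangularD(1)[OF B a a] in auto)
    then show ?thesis using a by simp
  qed
  have off: "f a < f b" if ab: "a < 2 ^ r" "b < 2 ^ r" "a \<noteq> b" and nz: "(A * B) $$ (b, a) \<noteq> 0" for a b
  proof -
    obtain c where "c < 2 ^ r" "A $$ (b, c) * B $$ (c, a) \<noteq> 0"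
      using nz unfolding mult_mat_entry[OF c ab(2,1)] by (metis (mono_tags, lifting) lessThan_iff sum.neutral)
    then show ?thesis
      using unitriangularD(2)[OF A, of c b] unitriangularD(2)[OF B, of a c] ab by (cases "c = b"; cases "a = c"; force)
  qed
  show ?thesis using diag off c by (auto simp: unitriangular_def simp del: index_mult_mat(1))
qed

lemma unitriangular_one: "1\<^sub>m (2 ^ r) \<in> unitriangular r f"
  by (auto simp: unitriangular_def split: if_splits)

lemma unip_plus_unitriangular: "n \<in> unip_plus r \<Longrightarrow> n \<in> unitriangular r (height r)"
proof -
  have gen: "gen_x r i t \<in> unitriangular r (height r)" if "i \<in> {1..r}" for i t
    using that spin_pairing_reflect_self[OF that]
    by (auto simp: unitriangular_def gen_x_eq gen_e_entry height_reflect split: if_splits)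
       (metis neg_equal_zero zero_neq_one zero_neq_neg_one)
  show "n \<in> unip_plus r \<Longrightarrow> n \<in> unitriangular r (height r)"
    unfolding unip_plus_def
    by (induction rule: generate.induct)
      (auto simp: Spin_inv_gen gen unitriangular_mult unitriangular_one)
qed

lemma unip_minus_unitriangular: "n \<in> unip_minus r \<Longrightarrow> n \<in> unitriangular r (\<lambda>a. - height r a)"
proof -
  have gen: "gen_y r i t \<in> unitriangular r (\<lambda>a. - height r a)" if "i \<in> {1..r}" for i t
    using that spin_pairing_reflect_self[OF that]
    by (auto simp: unitriangular_def gen_y_eq gen_f_entry height_reflect split: if_splits)
       (metis neg_equal_zero zero_neq_one zero_neq_neg_one)
  show "n \<in> unip_minus r \<Longrightarrow> n \<in> unitriangular r (\<lambda>a. - height r a)"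
    unfolding unip_minus_def
    by (induction rule: generate.induct)
      (auto simp: Spin_inv_gen gen unitriangular_mult unitriangular_one)
qed

lemma big_cell_iff:
  "x \<in> big_cell r \<longleftrightarrow> (\<exists>n'\<in>unip_minus r. \<exists>h\<in>torus r. \<exists>n\<in>unip_plus r. x = n' * h * n)"
  by (auto simp: big_cell_def set_mult_def)

lemmas unip_simps = subgroup_Spin_simps[OF subgroup_unip(1)] subgroup_Spin_simps[OF subgroup_unip(2)]
lemmas torus_simps = subgroup_Spin_simps[OF subgroup_torus]

lemma mult_torus_elt:
  assumes "A \<in> spin_mat r" "b < 2 ^ r" "c < 2 ^ r"
  shows "(A * torus_elt r t) $$ (b, c) = A $$ (b, c) * torus_elt r t $$ (c, c)"
proof -
  have "(\<Sum>a<2 ^ r. A $$ (b, a) * torus_elt r t $$ (a, c)) = (\<Sum>a<2 ^ r. if a = c then A $$ (b, c) * torus_elt r t $$ (c, c) else 0)"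
    by (rule sum.cong) (use assms in \<open>auto simp: torus_elt_def\<close>)
  then show ?thesis using assms by (simp add: mult_mat_entry[OF _ torus_elt_carrier] del: index_mult_mat(1))
qed

text \<open>Comparing two decompositions gives an equation between a unitriangular matrix times \<open>h1\<close> and \<open>h2\<close> times a
  unitriangular matrix of the opposite kind; only the diagonals are compared.\<close>

lemma torus_part_unique:
  assumes n: "n1 \<in> unip_minus r" "n2 \<in> unip_minus r" "h1 \<in> torus r" "h2 \<in> torus r" "u1 \<in> unip_plus r" "u2 \<in> unip_plus r"
    and eq: "n1 * h1 * u1 = n2 * h2 * u2"
  shows "h1 = h2"
proof -
  define m where "m = inv\<^bsub>Spin r\<^esub> n2 * n1"
  define u where "u = u2 * inv\<^bsub>Spin r\<^esub> u1"
  have m: "m \<in> unip_minus r" and u: "u \<in> unip_plus r"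
    using n unip_simps by (auto simp: m_def u_def)
  have car: "n1 \<in> carrier (Spin r)" "n2 \<in> carrier (Spin r)" "u1 \<in> carrier (Spin r)" "u2 \<in> carrier (Spin r)"
    using n unip_simps by auto
  have mat: "n1 \<in> spin_mat r" "n2 \<in> spin_mat r" "u1 \<in> spin_mat r" "u2 \<in> spin_mat r" "h1 \<in> spin_mat r" "h2 \<in> spin_mat r"
     "inv\<^bsub>Spin r\<^esub> n2 \<in> spin_mat r" "inv\<^bsub>Spin r\<^esub> u1 \<in> spin_mat r"
    using n unip_simps torus_simps car Spin_inv Spin_carrier by auto
  have "m * h1 = inv\<^bsub>Spin r\<^esub> n2 * (n1 * h1 * u1) * inv\<^bsub>Spin r\<^esub> u1"
    using mat Spin_inv[OF car(3)] by (simp add: m_def spin_mat_assoc[of _ r])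
  also have "\<dots> = (inv\<^bsub>Spin r\<^esub> n2 * n2) * (h2 * u)"
    using mat by (simp add: eq u_def spin_mat_assoc[of _ r])
  also have "\<dots> = h2 * u" using mat Spin_inv[OF car(2)] by (simp add: u_def)
  finally have eq: "m * h1 = h2 * u" .
  obtain t1 t2 where t: "h1 = torus_elt r t1" "h2 = torus_elt r t2" using n torus_eq by auto
  have mu: "m \<in> spin_mat r" "u \<in> spin_mat r" using mat by (simp_all add: m_def u_def)
  have "torus_elt r t1 $$ (a, a) = torus_elt r t2 $$ (a, a)" if a: "a < 2 ^ r" for a
  proof -
    have "(m * h1) $$ (a, a) = torus_elt r t1 $$ (a, a)"
      unfolding t mult_torus_elt[OF mu(1) a a]
      using unitriangularD(1)[OF unip_minus_unitriangular[OF m] a a] by simp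
    moreover have "(h2 * u) $$ (a, a) = torus_elt r t2 $$ (a, a)"
      unfolding t torus_elt_mult[OF mu(2) a a]
      using unitriangularD(1)[OF unip_plus_unitriangular[OF u] a a] a by (simp add: torus_elt_def)
    ultimately show ?thesis using eq by simp
  qed
  then show ?thesis unfolding t by (intro eq_matI) (auto simp: torus_elt_def)
qed

text \<open>The highest weight vector is fixed by \<open>N\<close>, and the row of the highest weight in an element of \<open>N\<^sub>-\<close> is
  that of the identity.\<close>

lemma torus_char_torus_part:
  assumes r: "1 \<le> r" and x: "x \<in> big_cell r"
  shows "torus_char r (fund_weight r) (torus_part r x) = x $$ (0, 0)"
proof -
  obtain n' h n where d: "n' \<in> unip_minus r" "h \<in> torus r" "n \<in> unip_plus r" "x = n' * h * n"
    using x big_cell_iff by auto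
  have mat: "n' \<in> spin_mat r" "h \<in> spin_mat r" "n \<in> spin_mat r" using d unip_simps torus_simps by auto
  have "torus_part r x = h"
    unfolding torus_part_def
  proof (rule the_equality)
    show "h \<in> torus r \<and> (\<exists>n'\<in>unip_minus r. \<exists>n\<in>unip_plus r. x = n' \<otimes>\<^bsub>Spin r\<^esub> h \<otimes>\<^bsub>Spin r\<^esub> n)"
      using d by auto
    fix h2 assume "h2 \<in> torus r \<and> (\<exists>n'\<in>unip_minus r. \<exists>n\<in>unip_plus r. x = n' \<otimes>\<^bsub>Spin r\<^esub> h2 \<otimes>\<^bsub>Spin r\<^esub> n)"
    then obtain n2 u2 where "h2 \<in> torus r" "n2 \<in> unip_minus r" "u2 \<in> unip_plus r" "x = n2 * h2 * u2"
      by auto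
    then show "h2 = h" using torus_part_unique[of n2 r n' h2 h u2 n] d by simp
  qed
  moreover have "x $$ (0, 0) = n' $$ (0, 0) * (h * n) $$ (0, 0)"
    unfolding d(4) spin_mat_assoc[OF mat]
  proof (rule sparse_mult_entry[OF mat(1) spin_mat_mult[OF mat(2,3)]])
    fix a :: nat assume "a < 2 ^ r" "a \<noteq> 0"
    then show "n' $$ (0, a) = 0"
      using unitriangularD(2)[OF unip_minus_unitriangular[OF d(1)], of a 0] height_le[of r a] by force
  qed simp_all
  moreover have "n' $$ (0, 0) = 1" "n $$ (0, 0) = 1"
    using unitriangularD(1)[OF unip_minus_unitriangular[OF d(1)], of 0 0]
      unitriangularD(1)[OF unip_plus_unitriangular[OF d(3)], of 0 0] by simp_all
  moreover have "(h * n) $$ (0, 0) = h $$ (0, 0) * n $$ (0, 0)"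
  proof -
    obtain t where "h = torus_elt r t" using d torus_eq by auto
    then show ?thesis using torus_elt_mult[OF mat(3), of 0 0 t] by (simp add: torus_elt_def)
  qed
  ultimately show ?thesis using torus_char_fund_weight[OF r d(2)] by simp
qed

lemma poly_fun_sum: "(\<And>k. k \<in> A \<Longrightarrow> f k \<in> poly_fun r) \<Longrightarrow> (\<lambda>x. \<Sum>k\<in>A. f k x) \<in> poly_fun r"
  by (induction A rule: infinite_finite_induct) (auto intro: poly_fun.intros)

text \<open>Substitution of polynomial maps, stated on a set \<open>S\<close> because the entries of a matrix product are
  given by the usual sums only for matrices of the right dimensions.\<close>

lemma poly_fun_subst:
  assumes "p \<in> poly_fun r"
    and entries: "\<And>i j. i < 2 ^ r \<Longrightarrow> j < 2 ^ r \<Longrightarrow> \<exists>q\<in>poly_fun r. \<forall>x\<in>S. q x = f x $$ (i, j)"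
  shows "\<exists>q\<in>poly_fun r. \<forall>x\<in>S. q x = p (f x)"
  using assms(1)
proof induction
  case (const c)
  then show ?case by (intro bexI[of _ "\<lambda>_. c"]) (auto intro: poly_fun.const)
next
  case (entry i j)
  then show ?case by (rule entries)
next
  case (add p q)
  then obtain p' q' where "p' \<in> poly_fun r" "q' \<in> poly_fun r"
    "\<forall>x\<in>S. p' x = p (f x)" "\<forall>x\<in>S. q' x = q (f x)" by blast
  then show ?case by (intro bexI[of _ "\<lambda>x. p' x + q' x"]) (auto intro: poly_fun.add)
next
  case (mult p q)
  then obtain p' q' where "p' \<in> poly_fun r" "q' \<in> poly_fun r"
    "\<forall>x\<in>S. p' x = p (f x)" "\<forall>x\<in>S. q' x = q (f x)" by blast
  then show ?case by (intro bexI[of _ "\<lambda>x. p' x * q' x"]) (auto intro: poly_fun.mult)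
qed

lemma poly_fun_translate_right:
  assumes "p \<in> poly_fun r" "g \<in> spin_mat r"
  obtains q where "q \<in> poly_fun r" "\<And>x. x \<in> spin_mat r \<Longrightarrow> q x = p (x * g)"
proof -
  have "\<exists>q\<in>poly_fun r. \<forall>x\<in>spin_mat r. q x = (x * g) $$ (i, j)" if "i < 2 ^ r" "j < 2 ^ r" for i j
  proof (rule bexI)
    show "(\<lambda>x. \<Sum>k<2 ^ r. x $$ (i, k) * g $$ (k, j)) \<in> poly_fun r"
      by (intro poly_fun_sum poly_fun.mult poly_fun.entry poly_fun.const) (use that in auto)
  qed (use that assms(2) in \<open>auto simp: mult_mat_entry simp del: index_mult_mat(1)\<close>)
  from poly_fun_subst[OF assms(1) this] show ?thesis using that by blast
qed

lemma poly_fun_translate_left: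
  assumes "p \<in> poly_fun r" "g \<in> spin_mat r"
  obtains q where "q \<in> poly_fun r" "\<And>x. x \<in> spin_mat r \<Longrightarrow> q x = p (g * x)"
proof -
  have "\<exists>q\<in>poly_fun r. \<forall>x\<in>spin_mat r. q x = (g * x) $$ (i, j)" if "i < 2 ^ r" "j < 2 ^ r" for i j
  proof (rule bexI)
    show "(\<lambda>x. \<Sum>k<2 ^ r. g $$ (i, k) * x $$ (k, j)) \<in> poly_fun r"
      by (intro poly_fun_sum poly_fun.mult poly_fun.entry poly_fun.const) (use that in auto)
  qed (use that assms(2) in \<open>auto simp: mult_mat_entry simp del: index_mult_mat(1)\<close>)
  from poly_fun_subst[OF assms(1) this] show ?thesis using that by blast
qed

lemma poly_fun_isCont:
  assumes "p \<in> poly_fun r" "A \<in> spin_mat r" "B \<in> spin_mat r"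
  shows "isCont (\<lambda>t. p (A + t \<cdot>\<^sub>m B)) t0"
  using assms(1)
proof induction
  case (entry i j)
  then have "(\<lambda>t. (A + t \<cdot>\<^sub>m B) $$ (i, j)) = (\<lambda>t. A $$ (i, j) + t * B $$ (i, j))"
    using assms(2,3) by (auto simp: fun_eq_iff)
  then show ?case by simp
qed auto

lemma isCont_eq_0:
  fixes f :: "complex \<Rightarrow> complex"
  assumes "isCont f t0" "\<And>t. t \<noteq> t0 \<Longrightarrow> f t = 0"
  shows "f t0 = 0"
proof -
  have "(f \<longlongrightarrow> f t0) (at t0)" using assms(1) by (simp add: isCont_def)
  moreover have "(f \<longlongrightarrow> 0) (at t0)"
    by (rule tendsto_eventually) (auto simp: eventually_at_filter assms(2))
  ultimately show ?thesis by (rule tendsto_unique[OF at_neq_bot])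
qed

text \<open>The Zariski closure of the big cell among all matrices of the right size.\<close>

definition cell_closure :: "nat \<Rightarrow> complex mat set" where
  "cell_closure r = {x \<in> spin_mat r. \<forall>p\<in>poly_fun r. (\<forall>y\<in>big_cell r. p y = 0) \<longrightarrow> p x = 0}"

lemma big_cell_Spin: "x \<in> big_cell r \<Longrightarrow> x \<in> carrier (Spin r)"
  using unip_simps(4,9) torus_simps(4) by (auto simp: big_cell_iff intro!: Spin_mult_closed)

lemma big_cell_subset_closure: "big_cell r \<subseteq> cell_closure r"
  using big_cell_Spin Spin_carrier by (auto simp: cell_closure_def)

text \<open>Right translations are polynomial maps, so it is enough to look at the big cell itself.\<close>

lemma cell_closure_mult:
  assumes g: "g \<in> spin_mat r" and cell: "\<And>y. y \<in> big_cell r \<Longrightarrow> y * g \<in> cell_closure r" and x: "x \<in> cell_closure r"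
  shows "x * g \<in> cell_closure r"
  unfolding cell_closure_def
proof (intro CollectI conjI ballI impI)
  show "x * g \<in> spin_mat r" using g x by (simp add: cell_closure_def)
  fix p assume p: "p \<in> poly_fun r" and p0: "\<forall>y\<in>big_cell r. p y = 0"
  obtain q where q: "q \<in> poly_fun r" "\<And>x. x \<in> spin_mat r \<Longrightarrow> q x = p (x * g)"
    using poly_fun_translate_right[OF p g] by blast
  have "q y = 0" if "y \<in> big_cell r" for y
    using cell[OF that] q(2)[of y] p p0 Spin_carrier[OF big_cell_Spin[OF that]] by (simp add: cell_closure_def)
  then show "p (x * g) = 0" using x q by (auto simp: cell_closure_def)
qed

text \<open>The constant \<open>c\<close> is the value of \<open>-\<alpha>\<^sub>i\<close> at \<open>h\<close>.\<close>

lemma torus_conj: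
  assumes i: "i \<in> {1..r}" and h: "h \<in> torus r"
  obtains c where "\<And>t. gen_x r i t * h = h * gen_x r i (c * t)" "\<And>t. h * gen_y r i t = gen_y r i (c * t) * h"
proof -
  obtain s where s: "\<forall>j\<in>{1..r}. s j \<noteq> 0" "h = torus_elt r s" using h torus_eq by auto
  define D where "D b = (\<Prod>j = 1..r. s j powi spin_pairing r j b)" for b
  obtain c where c: "c \<noteq> 0" and D: "\<And>b. D (reflect r i b) = D b * c powi spin_pairing r i b"
    using torus_eigenvalue_reflect[OF i s(1)] unfolding D_def by metis
  have "gen_x r i t * h = h * gen_x r i (c * t)" for t
    unfolding s(2)
    by (rule spin_mat_eqI[of _ r])
     (use i c in \<open>auto simp: torus_elt_mult gen_x_mult spin_mat_assoc[of _ r] reflect_less D_def[symmetric] D algebra_simps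
      simp del: One_nat_def index_mult_mat(1) right_mult_one_mat\<close>)
  moreover have "h * gen_y r i t = gen_y r i (c * t) * h" for t
    unfolding s(2)
    by (rule spin_mat_eqI[of _ r])
     (use i c in \<open>auto simp: torus_elt_mult gen_y_mult spin_mat_assoc[of _ r] reflect_less D_def[symmetric] D algebra_simps
      power_int_minus simp del: One_nat_def index_mult_mat(1) right_mult_one_mat\<close>)
  ultimately show ?thesis using that by blast
qed

lemma unip_plus_torus:
  assumes "n \<in> unip_plus r" "h \<in> torus r"
  shows "\<exists>n'\<in>unip_plus r. n * h = h * n'"
  using assms(1) unfolding unip_plus_def
proof (induction rule: generate.induct)
  case one
  then show ?case using torus_simps(5)[OF assms(2)] by (intro bexI[of _ "1\<^sub>m (2 ^ r)"]) (auto intro: generate.one[of "Spin r", simplified])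
next
  case (incl x)
  then obtain i t where i: "i \<in> {1..r}" "x = gen_x r i t" by blast
  then show ?case using torus_conj[OF i(1) assms(2)] by (metis UN_I generate.incl rangeI)
next
  case (inv x)
  then obtain i t where i: "i \<in> {1..r}" "x = gen_x r i t" by blast
  then show ?case using torus_conj[OF i(1) assms(2)] Spin_inv_gen(1)[OF i(1)] by (metis UN_I generate.incl rangeI)
next
  case (eng x y)
  then obtain x' y' where xy: "x' \<in> unip_plus r" "y' \<in> unip_plus r" "x * h = h * x'" "y * h = h * y'"
    by (auto simp: unip_plus_def)
  have mat: "x \<in> spin_mat r" "y \<in> spin_mat r" "x' \<in> spin_mat r" "y' \<in> spin_mat r" "h \<in> spin_mat r"
    using eng.hyps xy unip_simps torus_simps assms(2) by (auto simp: unip_plus_def)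
  have "x * y * h = x * (h * y')" using mat xy by (simp add: spin_mat_assoc[of _ r])
  also have "\<dots> = (x * h) * y'" using mat by (simp add: spin_mat_assoc[of _ r])
  also have "\<dots> = h * (x' * y')" using mat xy by (simp add: spin_mat_assoc[of _ r])
  finally show ?case using unip_simps(2)[OF xy(1,2)] by (auto simp: unip_plus_def)
qed

lemma cell_closure_gen_x:
  assumes i: "i \<in> {1..r}" and x: "x \<in> cell_closure r"
  shows "x * gen_x r i t \<in> cell_closure r"
proof (rule cell_closure_mult[OF gen_xy_carrier(1) _ x])
  fix y assume "y \<in> big_cell r"
  then obtain n' h n where d: "n' \<in> unip_minus r" "h \<in> torus r" "n \<in> unip_plus r" "y = n' * h * n"
    using big_cell_iff by auto
  have "gen_x r i t \<in> unip_plus r" using i unfolding unip_plus_def by (intro generate.incl UN_I[of i]) auto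
  then have "n * gen_x r i t \<in> unip_plus r" using unip_simps(2) d by blast
  moreover have "y * gen_x r i t = n' * h * (n * gen_x r i t)"
    using d unip_simps(5,10) torus_simps(5) by (auto simp: spin_mat_assoc[of _ r])
  ultimately have "y * gen_x r i t \<in> big_cell r" using d big_cell_iff by blast
  then show "y * gen_x r i t \<in> cell_closure r" using big_cell_subset_closure by blast
qed

lemma cell_closure_torus:
  assumes g: "g \<in> torus r" and x: "x \<in> cell_closure r"
  shows "x * g \<in> cell_closure r"
proof (rule cell_closure_mult[OF torus_simps(5)[OF g] _ x])
  fix y assume "y \<in> big_cell r"
  then obtain n' h n where d: "n' \<in> unip_minus r" "h \<in> torus r" "n \<in> unip_plus r" "y = n' * h * n"
    using big_cell_iff by auto
  obtain n2 where n2: "n2 \<in> unip_plus r" "n * g = g * n2" using unip_plus_torus[OF d(3) g] by blast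
  have mat: "n' \<in> spin_mat r" "h \<in> spin_mat r" "n \<in> spin_mat r" "n2 \<in> spin_mat r" "g \<in> spin_mat r"
    using d n2 g unip_simps(5,10) torus_simps(5) by auto
  have "y * g = n' * (h * g) * n2"
    using mat d(4) n2(2) by (simp add: spin_mat_assoc[of _ r])
  then have "y * g \<in> big_cell r" using d n2 g torus_simps(2) big_cell_iff by blast
  then show "y * g \<in> cell_closure r" using big_cell_subset_closure by blast
qed

text \<open>Call a matrix good if all its right multiples by \<open>y\<^sub>i\<close> lie in the closure. Elements of \<open>N\<^sub>- H\<close> are good,
  as \<open>y\<^sub>i\<close> can be moved into \<open>N\<^sub>-\<close>, and goodness survives right multiplication by the generators of \<open>N\<close>.
  For \<open>x\<^sub>i\<close> this is the decomposition of \<open>x\<^sub>i(a) y\<^sub>i(t)\<close> in \<open>SL\<^sub>2\<close>.\<close>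

lemma cell_closure_gen_y:
  assumes i: "i \<in> {1..r}" and x: "x \<in> cell_closure r"
  shows "x * gen_y r i t \<in> cell_closure r"
proof (rule cell_closure_mult[OF gen_xy_carrier(2) _ x])
  define good where "good = {z \<in> spin_mat r. \<forall>t. z * gen_y r i t \<in> cell_closure r}"
  have step: "z * gen_x r j a \<in> good" if z: "z \<in> good" and j: "j \<in> {1..r}" for z j a
  proof -
    have zm: "z \<in> spin_mat r" and zy: "z * gen_y r i s \<in> cell_closure r" for s using z by (auto simp: good_def)
    have "z * gen_x r j a * gen_y r i s \<in> cell_closure r" for s
    proof (cases "j = i")
      case False
      have "z * gen_x r j a * gen_y r i s = z * gen_y r i s * gen_x r j a"
        using zm gen_x_gen_y_commute[OF i j] False by (simp add: spin_mat_assoc[of _ r])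
      then show ?thesis using cell_closure_gen_x[OF j zy] by simp
    next
      case True
      have generic: "z * gen_x r i a * gen_y r i s \<in> cell_closure r" if d: "1 + a * s \<noteq> 0" for s
      proof -
        have "coroot_elt r i (1 + a * s) \<in> torus r"
          unfolding torus_def using i d by (intro generate.incl UN_I[of i] imageI) auto
        from cell_closure_gen_x[OF i cell_closure_torus[OF this zy]]
        have "z * gen_y r i (s / (1 + a * s)) * coroot_elt r i (1 + a * s) * gen_x r i (a / (1 + a * s)) \<in> cell_closure r" .
        then show ?thesis using zm gen_x_mult_gen_y[OF i refl d] by (simp add: spin_mat_assoc[of _ r])
      qed
      show ?thesis
      proof (cases "1 + a * s = 0")
        case False
        then show ?thesis using generic True by simp
      next
        \<comment> \<open>The exceptional parameter is a limit of parameters for which the decomposition exists.\<close>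
        case exc: True
        show ?thesis unfolding cell_closure_def
        proof (intro CollectI conjI ballI impI)
          show "z * gen_x r j a * gen_y r i s \<in> spin_mat r" using zm by simp
          fix p assume p: "p \<in> poly_fun r" and p0: "\<forall>y\<in>big_cell r. p y = 0"
          define A where "A = z * gen_x r i a"
          have A: "A \<in> spin_mat r" using zm by (simp add: A_def)
          have lin: "A * gen_y r i s' = A + s' \<cdot>\<^sub>m (A * gen_f r i)" for s'
            using mult_add_distrib_mat[OF A one_carrier_mat smult_carrier_mat[OF gen_ef_carrier(2), of s' r i]]
              mult_smult_distrib[OF A gen_ef_carrier(2), of s' i] A i by (simp add: gen_y_eq)
          have "p (A + s' \<cdot>\<^sub>m (A * gen_f r i)) = 0" if "s' \<noteq> s" for s'
          proof -
            have "a \<noteq> 0" using exc by auto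
            then have "1 + a * s' \<noteq> 0" using exc that by (metis add_left_cancel mult_cancel_left)
            then show ?thesis using generic[of s'] p p0 by (simp add: cell_closure_def A_def[symmetric] lin)
          qed
          from isCont_eq_0[OF poly_fun_isCont[OF p A] this]
          show "p (z * gen_x r j a * gen_y r i s) = 0" using A lin True by (simp add: A_def)
        qed
      qed
    qed
    then show ?thesis using zm by (simp add: good_def)
  qed
  have N: "\<forall>z\<in>good. z * n \<in> good" if "n \<in> unip_plus r" for n
    using that unfolding unip_plus_def
  proof (induction rule: generate.induct)
    case (eng x y)
    then have "x \<in> spin_mat r" "y \<in> spin_mat r" using unip_simps(5) by (auto simp: unip_plus_def)
    then show ?case using eng by (auto simp: good_def spin_mat_assoc[of _ r, symmetric])
  qed (use step in \<open>auto simp: good_def Spin_inv_gen\<close>)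
  fix y assume "y \<in> big_cell r"
  then obtain n' h n where d: "n' \<in> unip_minus r" "h \<in> torus r" "n \<in> unip_plus r" "y = n' * h * n"
    using big_cell_iff by auto
  have mat: "n' \<in> spin_mat r" "h \<in> spin_mat r" using d unip_simps(5,10) torus_simps(5) by auto
  have "n' * h * gen_y r i s \<in> cell_closure r" for s
  proof -
    obtain c where c: "h * gen_y r i s = gen_y r i (c * s) * h" using torus_conj[OF i d(2)] by metis
    have y: "gen_y r i (c * s) \<in> unip_minus r" using i unfolding unip_minus_def by (intro generate.incl UN_I[of i]) auto
    have "n' * h * gen_y r i s = (n' * gen_y r i (c * s)) * h * 1\<^sub>m (2 ^ r)"
      using mat c by (simp add: spin_mat_assoc[of _ r])
    moreover have "n' * gen_y r i (c * s) \<in> unip_minus r" using d y unip_simps(7) by blast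
    ultimately have "n' * h * gen_y r i s \<in> big_cell r" using d(2) unip_simps(1) big_cell_iff by blast
    then show ?thesis using big_cell_subset_closure by blast
  qed
  then have "n' * h \<in> good" using mat by (simp add: good_def)
  then have "y \<in> good" using N[OF d(3)] d(4) by blast
  then show "y * gen_y r i t \<in> cell_closure r" by (simp add: good_def)
qed

lemma Spin_subset_closure: "carrier (Spin r) \<subseteq> cell_closure r"
proof
  fix g assume "g \<in> carrier (Spin r)"
  then have g: "g \<in> generate (GL r) ((\<Union>i\<in>{1..r}. range (gen_x r i)) \<union> (\<Union>i\<in>{1..r}. range (gen_y r i)))"
    by (simp add: Spin_def)
  have "g \<in> carrier (Spin r) \<and> (\<forall>x\<in>cell_closure r. x * g \<in> cell_closure r)"
    using g
  proof (induction rule: generate.induct)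
    case one
    then show ?case using Spin_one_closed by (auto simp: cell_closure_def)
  next
    case (incl h)
    then show ?case using cell_closure_gen_x cell_closure_gen_y by auto
  next
    case (inv h)
    have "inv\<^bsub>GL r\<^esub> (gen_x r i t) = gen_x r i (- t)" "inv\<^bsub>GL r\<^esub> (gen_y r i t) = gen_y r i (- t)" if "i \<in> {1..r}" for i t
      using that group.inv_equality[OF group_GL[of r], of "gen_x r i (- t)" "gen_x r i t"]
       group.inv_equality[OF group_GL[of r], of "gen_y r i (- t)" "gen_y r i t"] gen_xy_GL gen_x_inverse gen_y_inverse by auto
    then show ?case using inv cell_closure_gen_x cell_closure_gen_y by auto
  next
    case (eng h1 h2)
    have "x * (h1 * h2) = (x * h1) * h2" if "x \<in> cell_closure r" for x
      using that eng.IH Spin_carrier by (auto simp: cell_closure_def spin_mat_assoc[of _ r])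
    then show ?case using eng.IH Spin_mult_closed by auto
  qed
  moreover have "1\<^sub>m (2 ^ r) \<in> cell_closure r"
    using big_cell_subset_closure big_cell_iff[of "1\<^sub>m (2 ^ r)" r] unip_simps(1,6) torus_simps(1)
    by (metis left_mult_one_mat one_carrier_mat subsetD)
  ultimately have "1\<^sub>m (2 ^ r) * g \<in> cell_closure r" and "g \<in> spin_mat r" using Spin_carrier by auto
  then show "g \<in> cell_closure r" by simp
qed

text \<open>The right-hand side is linear in the entries of \<open>x\<close>, hence regular, and it has the prescribed values on the
  translated big cell. Any other such function agrees with it by density.\<close>

lemma gen_minor_eq:
  assumes r: "1 \<le> r" and L: "weyl_lift r w \<in> carrier (Spin r)" and x: "x \<in> carrier (Spin r)"
  shows "gen_minor r w r x = (inv\<^bsub>Spin r\<^esub> (weyl_lift r w) * x) $$ (0, 0)"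
proof -
  define L where "L = weyl_lift r w"
  define M where "M = inv\<^bsub>Spin r\<^esub> L"
  have L: "L \<in> carrier (Spin r)" and M: "M \<in> carrier (Spin r)" "M * L = 1\<^sub>m (2 ^ r)" "L * M = 1\<^sub>m (2 ^ r)"
    using L Spin_inv[of L r] by (simp_all add: L_def M_def)
  have mat: "L \<in> spin_mat r" "M \<in> spin_mat r" using L M Spin_carrier by auto
  have cancel: "M * (L * g) = g" "L * (M * g) = g" if "g \<in> spin_mat r" for g
    using that mat M spin_mat_assoc[of M r L g] spin_mat_assoc[of L r M g] by simp_all
  define p0 where "p0 x = (\<Sum>b<2 ^ r. M $$ (0, b) * x $$ (b, 0))" for x
  have p0: "p0 \<in> poly_fun r" unfolding p0_def[abs_def]
    by (intro poly_fun_sum poly_fun.mult poly_fun.entry poly_fun.const) auto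
  have p0_eq: "p0 g = (M * g) $$ (0, 0)" if "g \<in> spin_mat r" for g
    using mult_mat_entry[OF mat(2) that, of 0 0] by (simp add: p0_def)
  let ?val = "\<lambda>x. torus_char r (fund_weight r) (torus_part r (M * x))"
  have val: "?val (L * g) = g $$ (0, 0)" if "g \<in> big_cell r" for g
    using torus_char_torus_part[OF r that] cancel(1)[OF Spin_carrier[OF big_cell_Spin[OF that]]] by simp
  have "gen_minor r w r = restrict p0 (carrier (Spin r))"
    unfolding gen_minor_def L_def[symmetric] M_def[symmetric] Spin_simps
  proof (rule the_equality)
    show "restrict p0 (carrier (Spin r)) \<in> regular_fun r \<and>
      (\<forall>x\<in>L <#\<^bsub>Spin r\<^esub> big_cell r. restrict p0 (carrier (Spin r)) x = ?val x)"
    proof (intro conjI ballI)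
      show "restrict p0 (carrier (Spin r)) \<in> regular_fun r" using p0 by (auto simp: regular_fun_def)
      fix x assume "x \<in> L <#\<^bsub>Spin r\<^esub> big_cell r"
      then obtain g where g: "g \<in> big_cell r" "x = L * g" by (auto simp: l_coset_def)
      then show "restrict p0 (carrier (Spin r)) x = ?val x"
        using val[OF g(1)] big_cell_Spin[OF g(1)] Spin_carrier[OF big_cell_Spin[OF g(1)]] L mat
        by (simp add: p0_eq cancel Spin_mult_closed)
    qed
  next
    fix D assume D: "D \<in> regular_fun r \<and> (\<forall>x\<in>L <#\<^bsub>Spin r\<^esub> big_cell r. D x = ?val x)"
    then obtain p where p: "p \<in> poly_fun r" "D = restrict p (carrier (Spin r))" by (auto simp: regular_fun_def)
    have "(\<lambda>x. p x + (- 1) * p0 x) \<in> poly_fun r" using p(1) p0 by (intro poly_fun.intros)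
    from poly_fun_translate_left[OF this mat(1)]
    obtain q where q: "q \<in> poly_fun r" "\<And>x. x \<in> spin_mat r \<Longrightarrow> q x = p (L * x) + (- 1) * p0 (L * x)"
      by blast
    have "q g = 0" if g: "g \<in> big_cell r" for g
    proof -
      have gc: "g \<in> carrier (Spin r)" "g \<in> spin_mat r" using big_cell_Spin[OF g] Spin_carrier by auto
      have "L * g \<in> L <#\<^bsub>Spin r\<^esub> big_cell r" using g by (auto simp: l_coset_def)
      then have "D (L * g) = g $$ (0, 0)" using D val[OF g] by simp
      then have "p (L * g) = g $$ (0, 0)" using p(2) gc L by (simp add: Spin_mult_closed)
      then show ?thesis using q(2)[OF gc(2)] gc mat by (simp add: p0_eq cancel)
    qed
    then have q0: "q g = 0" if "g \<in> carrier (Spin r)" for g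
      using subsetD[OF Spin_subset_closure that] q(1) by (simp add: cell_closure_def)
    have "p g = p0 g" if g: "g \<in> carrier (Spin r)" for g
    proof -
      have "M * g \<in> carrier (Spin r)" using M g Spin_mult_closed by blast
      then show ?thesis using q0[of "M * g"] q(2)[of "M * g"] cancel(2)[OF Spin_carrier[OF g]] Spin_carrier by simp
    qed
    then show "D = restrict p0 (carrier (Spin r))" using p(2) by (auto simp: restrict_def fun_eq_iff)
  qed
  then show ?thesis using x p0_eq[OF Spin_carrier[OF x]] by (simp add: L_def M_def)
qed

lemma word_act_inj:
  assumes "set js \<subseteq> {1..r}" "a < 2 ^ r" "b < 2 ^ r" "word_act r js a = word_act r js b"
  shows "a = b"
  using assms
proof (induction js)
  case (Cons j js)
  then have j: "j \<in> {1..r}" and js: "set js \<subseteq> {1..r}"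
    and eq: "reflect r j (word_act r js a) = reflect r j (word_act r js b)" by simp_all
  have "word_act r js a = word_act r js b"
    using arg_cong[OF eq, of "reflect r j"]
    by (simp add: reflect_reflect[OF j] word_act_less[OF js] Cons.prems(2,3))
  then show ?case using Cons.IH[OF js Cons.prems(2,3)] by simp
qed simp

text \<open>In the row of \<open>mask m\<close> the lift has the single entry \<open>1\<close>, in column \<open>0\<close>. So this row of \<open>x\<close> equals row
  \<open>0\<close> of the inverse of the lift times \<open>x\<close>.\<close>

lemma gen_minor_cyclic_word:
  assumes "m \<le> r" "1 \<le> r" "x \<in> carrier (Spin r)"
  shows "gen_minor r (weyl_word r (cyclic_word r m)) r x = x $$ (mask m, 0)"
proof -
  define w where "w = weyl_word r (cyclic_word r m)"
  obtain js where js: "set js \<subseteq> {1..r}" "weyl_lift r w = word_lift r js" "word_act r js 0 = mask m"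
    "word_lift r js $$ (mask m, 0) = 1"
    using weyl_lift_cyclic_word[OF assms(1,2)] unfolding w_def by blast
  have m: "mask m < (2 :: nat) ^ r" using js(1,3) word_act_less[of js r 0] by simp
  define M where "M = inv\<^bsub>Spin r\<^esub> (word_lift r js)"
  have M: "M \<in> carrier (Spin r)" "word_lift r js * M = 1\<^sub>m (2 ^ r)"
    using Spin_inv[OF word_lift_Spin[OF js(1)]] by (simp_all add: M_def)
  have mat: "M \<in> spin_mat r" "x \<in> spin_mat r" using M assms(3) Spin_carrier by auto
  have "x = word_lift r js * (M * x)" using M mat spin_mat_assoc[of "word_lift r js" r M x] by simp
  then have "x $$ (mask m, 0) = (word_lift r js * (M * x)) $$ (mask m, 0)" by simp
  also have "\<dots> = word_lift r js $$ (mask m, 0) * (M * x) $$ (0, 0)"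
  proof (rule sparse_mult_entry)
    fix a :: nat assume a: "a < 2 ^ r" "a \<noteq> 0"
    then have "word_act r js a \<noteq> mask m" using word_act_inj[OF js(1) a(1), of 0] js(3) by auto
    then show "word_lift r js $$ (mask m, a) = 0" using word_lift_nonzero_iff[OF js(1) a(1) m] by auto
  qed (use mat m in auto)
  also have "\<dots> = gen_minor r w r x"
    using gen_minor_eq[OF assms(2) _ assms(3), of w] js word_lift_Spin[OF js(1)] by (simp add: M_def)
  finally show ?thesis by (simp add: w_def)
qed

section \<open>The matrix of one cycle\<close>

lemma x_minus_eq: "x_minus r i t = gen_y r i t * coroot_elt r i (inverse t)"
  by (simp add: x_minus_def)

lemma x_minus_carrier [simp]: "x_minus r i t \<in> spin_mat r"
  by (simp add: x_minus_eq)

lemma x_minus_Spin: "i \<in> {1..r} \<Longrightarrow> t \<noteq> 0 \<Longrightarrow> x_minus r i t \<in> carrier (Spin r)"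
  by (simp add: x_minus_eq Spin_mult_closed coroot_elt_Spin)

text \<open>On a pair of vectors with \<open>\<langle>\<mu>, h\<^sub>i\<rangle> = \<plusminus>1\<close> the element is the lower triangular matrix with diagonal entries
  \<open>1/t\<close> and \<open>t\<close> and with the entry \<open>1\<close> below the diagonal.\<close>

lemma x_minus_mult:
  assumes i: "i \<in> {1..r}" and t: "t \<noteq> 0" and A: "A \<in> spin_mat r" "b < 2 ^ r" "c < 2 ^ r"
  shows "(x_minus r i t * A) $$ (b, c) = inverse t powi spin_pairing r i b * A $$ (b, c) +
    (if spin_pairing r i b = -1 then A $$ (reflect r i b, c) else 0)"
  using assms spin_pairing_reflect_self[OF i, of b]
  by (auto simp: x_minus_eq spin_mat_assoc[of _ r] gen_y_mult coroot_elt_mult reflect_less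
    simp del: index_mult_mat(1))

text \<open>The part \<open>x\<^sub>-\<^sub>i(y\<^sub>i) \<cdots> x\<^sub>-\<^sub>r(y\<^sub>r)\<close> of a cycle. The factors are applied to a vector from the right, so the
  induction adds factors on the left and goes down in \<open>i\<close>.\<close>

definition partial_cycle :: "nat \<Rightarrow> (nat \<Rightarrow> complex) \<Rightarrow> nat \<Rightarrow> complex mat" where
  "partial_cycle r y i = list_mult (Spin r) (map (\<lambda>j. x_minus r j (y j)) [i..<r + 1])"

lemma partial_cycle_rec:
  "i \<le> r \<Longrightarrow> partial_cycle r y i = x_minus r i (y i) * partial_cycle r y (Suc i)"
  "r < i \<Longrightarrow> partial_cycle r y i = 1\<^sub>m (2 ^ r)"
  by (simp_all add: partial_cycle_def list_mult_def upt_conv_Cons del: upt_Suc)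

lemma partial_cycle_carrier [simp]: "partial_cycle r y i \<in> spin_mat r"
proof -
  have "list_mult (Spin r) (map (\<lambda>j. x_minus r j (y j)) js) \<in> spin_mat r" for js
    by (induction js) (simp_all add: list_mult_def)
  then show ?thesis by (simp add: partial_cycle_def)
qed

definition minus_count :: "nat \<Rightarrow> nat \<Rightarrow> nat" where
  "minus_count a l = (\<Sum>j<l. of_bool (bit a j))"

text \<open>By the first inequality minus signs move only to lower positions. After the factors \<open>l, \<dots>, r\<close> of a cycle
  have acted, \<open>minus_count b l - minus_count a (l - 1)\<close> minus signs stand at position \<open>l\<close>; by the second
  inequality there is at most one.\<close>

definition interlaced_at :: "nat \<Rightarrow> nat \<Rightarrow> nat \<Rightarrow> bool" where
  "interlaced_at a b l \<longleftrightarrow> minus_count a l \<le> minus_count b l \<and> minus_count b l \<le> minus_count a (l - 1) + 1"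

text \<open>When \<open>x\<^sub>-\<^sub>l\<close> acts for \<open>l < r\<close>, the sign at \<open>l\<close> is still that of \<open>a\<close>, and the sign that it leaves at
  \<open>l + 1\<close> is that of \<open>b\<close>. In all permitted cases its coefficient is \<open>y\<^sub>l\<close> to the power
  \<open>[minus at l in a] - [minus at l + 1 in b]\<close>; moving a minus sign gives exponent \<open>0\<close>. The last factor accounts
  for \<open>x\<^sub>-\<^sub>r\<close>, which has the coefficient \<open>1/y\<^sub>r\<close> on a plus sign that it leaves in place.\<close>

definition cycle_weight :: "nat \<Rightarrow> (nat \<Rightarrow> complex) \<Rightarrow> nat \<Rightarrow> nat \<Rightarrow> nat \<Rightarrow> complex" where
  "cycle_weight r y i a b =
     (\<Prod>l = i..r. if bit a (l - 1) then y l else 1) / (\<Prod>l = Suc i..r. if bit b (l - 1) then y (l - 1) else 1) *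
     (if minus_count b r = minus_count a r \<and> \<not> bit a (r - 1) then inverse (y r) else 1)"

lemma bit_reflect:
  assumes "i \<in> {1..r}" "i \<noteq> r"
  shows "bit (reflect r i b) n = bit b (transpose (i - 1) i n)"
  using assms by (cases i) (auto simp: reflect_def bit_flip_bit_iff transpose_def)

lemma minus_count_reflect:
  assumes "i \<in> {1..r}" "i \<noteq> r" "i < l"
  shows "minus_count (reflect r i b) l = minus_count b l"
  unfolding minus_count_def bit_reflect[OF assms(1,2)]
  by (rule sum.reindex_bij_witness[of _ "transpose (i - 1) i" "transpose (i - 1) i"])
    (use assms in \<open>auto simp: transpose_def\<close>)

lemma spin_pairing_bits:
  assumes "i \<in> {1..r}"
  shows "spin_pairing r i b = (if i = r then (if bit b (r - 1) then -1 else 1)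
    else of_bool (bit b i) - of_bool (bit b (i - 1)))"
  using assms by (auto simp: spin_pairing_eq spin_sign_def)

text \<open>The factors \<open>i, \<dots>, r\<close> leave the signs below \<open>i\<close> alone. By \<open>x_minus_mult\<close>, row \<open>b\<close> of the product with one
  more factor combines row \<open>b\<close> and, if a minus sign can have moved to \<open>i\<close>, the row with that sign moved back to
  \<open>i + 1\<close>. These two rows differ in the sign at \<open>i\<close>, so at most one of them contributes.\<close>

lemma partial_cycle_entry:
  assumes "1 \<le> i" "i \<le> r" and y: "\<And>j. j \<in> {1..r} \<Longrightarrow> y j \<noteq> 0" and ab: "a < 2 ^ r" "b < 2 ^ r"
  shows "partial_cycle r y i $$ (b, a) =
    (if (\<forall>j<i - 1. bit b j = bit a j) \<and> (\<forall>l\<in>{i..r}. interlaced_at a b l) then cycle_weight r y i a b else 0)"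
  using assms(2,1) ab(2)
proof (induction i arbitrary: b rule: inc_induct)
  case base
  then have r: "r \<in> {1..r}" by simp
  obtain q where q: "r = Suc q" using base by (cases r) auto
  have eq1: "b = a \<longleftrightarrow> (\<forall>j<q. bit b j = bit a j) \<and> bit b q = bit a q"
    using bit_less_exp[OF _ ab(1)] bit_less_exp[OF _ base(2)] q
    by (auto intro!: bit_eqI) (metis less_Suc_eq)+
  have "bit (reflect r r b) n = (if n = q then \<not> bit b n else bit b n)" for n
    by (auto simp: reflect_def q bit_flip_bit_iff)
  then have eq2: "reflect r r b = a \<longleftrightarrow> (\<forall>j<q. bit b j = bit a j) \<and> bit b q \<noteq> bit a q"
    using bit_less_exp[OF _ ab(1)] bit_less_exp[OF _ base(2)] q
    by (auto intro!: bit_eqI split: if_splits) (metis less_Suc_eq)+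
  have "partial_cycle r y r $$ (b, a) = (x_minus r r (y r) * 1\<^sub>m (2 ^ r)) $$ (b, a)"
    by (simp only: partial_cycle_rec le_refl lessI)
  also have "\<dots> = inverse (y r) powi spin_pairing r r b * of_bool (b = a) +
    (if spin_pairing r r b = -1 then of_bool (reflect r r b = a) else 0)"
    using r y[OF r] base(2) ab(1) by (simp add: x_minus_mult reflect_less del: index_mult_mat(1) right_mult_one_mat)
  finally have entry: "partial_cycle r y r $$ (b, a) = \<dots>" .
  show ?case
  proof (cases "\<forall>j<q. bit b j = bit a j")
    case True
    then have "minus_count b q = minus_count a q" by (simp add: minus_count_def)
    then show ?thesis using True y[OF r] unfolding entry eq1 eq2 spin_pairing_bits[OF r]
      by (auto simp: q interlaced_at_def cycle_weight_def minus_count_def power_int_minus)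
  next
    case False
    then show ?thesis unfolding entry eq1 eq2 by (auto simp: q)
  qed
next
  case (step i)
  then have i: "i \<in> {1..r}" and ir: "i \<noteq> r" by auto
  obtain q where q: "i = Suc q" using step by (cases i) auto
  define C where "C \<longleftrightarrow> (\<forall>l\<in>{Suc i..r}. interlaced_at a b l)"
  define E where "E \<longleftrightarrow> (\<forall>j<q. bit b j = bit a j)"
  define W where "W = cycle_weight r y (Suc i) a b"
  have ivl: "{i..r} = insert i {Suc i..r}" "{Suc i..r} = insert (Suc i) {Suc (Suc i)..r}"
    using step.hyps by auto
  have W: "cycle_weight r y i a b = (if bit a q then y i else 1) / (if bit b i then y i else 1) * W"
    unfolding W_def cycle_weight_def by (subst ivl(1), subst ivl(2)) (simp add: q)
  have IH1: "partial_cycle r y (Suc i) $$ (b, a) = (if E \<and> bit b q = bit a q \<and> C then W else 0)"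
    using step.IH[of b] step.prems by (auto simp: C_def E_def W_def q less_Suc_eq)
  have IH2: "partial_cycle r y (Suc i) $$ (reflect r i b, a) = (if E \<and> \<not> bit a q \<and> C then W else 0)"
    if bits: "bit b q" "\<not> bit b i"
  proof -
    have "interlaced_at a (reflect r i b) l = interlaced_at a b l" if "l \<in> {Suc i..r}" for l
      using that i ir by (simp add: interlaced_at_def minus_count_reflect)
    moreover have "cycle_weight r y (Suc i) a (reflect r i b) = W"
      using i ir step.hyps unfolding W_def cycle_weight_def
      by (auto simp: minus_count_reflect bit_reflect transpose_def intro!: prod.cong arg_cong2[of _ _ _ _ "(/)"])
    moreover have "bit (reflect r i b) j = bit b j" if "j < q" for j
      using that i ir by (simp add: bit_reflect transpose_def q)
    moreover have "\<not> bit (reflect r i b) q" using bits i ir by (simp add: bit_reflect q)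
    ultimately show ?thesis
      using step.IH[of "reflect r i b"] step.prems reflect_less[OF i]
      by (auto simp: C_def E_def q less_Suc_eq)
  qed
  have entry: "partial_cycle r y i $$ (b, a) = inverse (y i) powi spin_pairing r i b * partial_cycle r y (Suc i) $$ (b, a) +
    (if spin_pairing r i b = -1 then partial_cycle r y (Suc i) $$ (reflect r i b, a) else 0)"
    using i y[OF i] step.prems ab(1) step.hyps by (simp add: partial_cycle_rec(1) x_minus_mult del: index_mult_mat(1))
  have cond: "(\<forall>j<i - 1. bit b j = bit a j) \<and> (\<forall>l\<in>{i..r}. interlaced_at a b l) \<longleftrightarrow> E \<and> (bit a q \<longrightarrow> bit b q) \<and> C"
  proof (cases E)
    case True
    then have "minus_count b q = minus_count a q" by (simp add: minus_count_def E_def)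
    then have "interlaced_at a b i \<longleftrightarrow> (bit a q \<longrightarrow> bit b q)"
      by (auto simp: interlaced_at_def minus_count_def q)
    then show ?thesis using True unfolding ivl(1) by (auto simp: E_def C_def q)
  qed (auto simp: E_def q)
  \<comment> \<open>New minus signs at both \<open>i\<close> and \<open>i + 1\<close> would require two of them at \<open>i + 1\<close> at the same time.\<close>
  have bad: False if "E" "C" "\<not> bit a q" "bit b q" "bit b i"
  proof -
    have "interlaced_at a b (Suc i)" using that step.hyps by (auto simp: C_def)
    moreover have "minus_count b q = minus_count a q" using that by (simp add: minus_count_def E_def)
    ultimately show False using that by (simp add: interlaced_at_def minus_count_def q)
  qed
  show ?case unfolding entry cond IH1 W spin_pairing_bits[OF i]
    using IH2 bad ir y[OF i] by (auto simp: q field_simps)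
qed

section \<open>Sums over paths\<close>

text \<open>The index of the basis vector whose weight has minus signs exactly at the entries of the list.\<close>

definition weight_index :: "nat list \<Rightarrow> nat" where
  "weight_index ks = set_encode ((\<lambda>k. k - 1) ` set ks)"

text \<open>The increasing lists represent the subsets of \<open>{1..r}\<close>, that is, the vertices at one level.\<close>

definition subset_lists :: "nat \<Rightarrow> nat list set" where
  "subset_lists r = {ks. set ks \<subseteq> {1..r} \<and> sorted_wrt (<) ks}"

lemma bit_weight_index:
  assumes "ks \<in> subset_lists r"
  shows "bit (weight_index ks) n \<longleftrightarrow> Suc n \<in> set ks"
proof -
  have "bit (weight_index ks) n \<longleftrightarrow> n \<in> set_decode (weight_index ks)" by (simp add: set_decode_def bit_iff_odd)
  also have "\<dots> \<longleftrightarrow> n \<in> (\<lambda>k. k - 1) ` set ks" by (simp add: weight_index_def)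
  also have "\<dots> \<longleftrightarrow> Suc n \<in> set ks"
  proof
    assume "n \<in> (\<lambda>k. k - 1) ` set ks"
    then obtain k where "k \<in> set ks" "n = k - 1" by auto
    moreover have "1 \<le> k" using calculation assms by (auto simp: subset_lists_def)
    ultimately show "Suc n \<in> set ks" by simp
  qed force
  finally show ?thesis .
qed

lemma weight_index_less:
  assumes "ks \<in> subset_lists r"
  shows "weight_index ks < 2 ^ r"
  by (rule less_exp_if_bits) (use assms bit_weight_index[OF assms] in \<open>auto simp: subset_lists_def\<close>)

lemma bij_betw_weight_index: "bij_betw weight_index (subset_lists r) {..<2 ^ r}"
proof (rule bij_betwI')
  fix ks js assume *: "ks \<in> subset_lists r" "js \<in> subset_lists r"
  show "weight_index ks = weight_index js \<longleftrightarrow> ks = js"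
  proof
    assume "weight_index ks = weight_index js"
    then have "Suc n \<in> set ks \<longleftrightarrow> Suc n \<in> set js" for n using bit_weight_index * by metis
    moreover have "0 \<notin> set ks" "0 \<notin> set js" using * by (auto simp: subset_lists_def)
    ultimately have "set ks = set js" by (metis not0_implies_Suc subsetI subset_antisym)
    then show "ks = js" using * by (intro strict_sorted_equal) (auto simp: subset_lists_def)
  qed simp
next
  fix ks assume "ks \<in> subset_lists r"
  then show "weight_index ks \<in> {..<2 ^ r}" using weight_index_less by simp
next
  fix a :: nat assume a: "a \<in> {..<2 ^ r}"
  define ks where "ks = filter (\<lambda>k. bit a (k - 1)) [1..<r + 1]"
  have ks: "ks \<in> subset_lists r"
    by (auto simp: ks_def subset_lists_def sorted_wrt_filter simp del: upt_Suc)
  have "a = weight_index ks"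
  proof (rule bit_eqI)
    fix n
    show "bit a n \<longleftrightarrow> bit (weight_index ks) n"
      unfolding bit_weight_index[OF ks] using a bit_less_exp[of a n r] by (auto simp: ks_def)
  qed
  then show "\<exists>ks\<in>subset_lists r. a = weight_index ks" using ks by blast
qed

lemma finite_subset_lists: "finite (subset_lists r)"
  using bij_betw_finite[OF bij_betw_weight_index] by simp

definition count_le :: "nat list \<Rightarrow> nat \<Rightarrow> nat" where
  "count_le ks l = length (filter (\<lambda>k. k \<le> l) ks)"

lemma minus_count_weight_index:
  assumes "ks \<in> subset_lists r"
  shows "minus_count (weight_index ks) l = count_le ks l"
proof -
  have "distinct ks" using assms by (auto simp: subset_lists_def strict_sorted_iff)
  then have "count_le ks l = card {k \<in> set ks. k \<le> l}"
    unfolding count_le_def using distinct_card[of "filter (\<lambda>k. k \<le> l) ks"] by simp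
  also have "{k \<in> set ks. k \<le> l} = Suc ` {j \<in> {..<l}. Suc j \<in> set ks}"
  proof -
    have "0 \<notin> set ks" using assms by (auto simp: subset_lists_def)
    then have "k \<in> {k \<in> set ks. k \<le> l} \<longleftrightarrow> k \<in> Suc ` {j \<in> {..<l}. Suc j \<in> set ks}" for k
      by (cases k) auto
    then show ?thesis by blast
  qed
  also have "card \<dots> = card {j \<in> {..<l}. Suc j \<in> set ks}" by (simp add: card_image)
  also have "\<dots> = minus_count (weight_index ks) l"
    by (simp add: minus_count_def bit_weight_index[OF assms] sum_of_bool_eq Int_def)
  finally show ?thesis by simp
qed

lemma nth_le_iff_count_le:
  assumes "sorted_wrt (<) ks" "i < length ks"
  shows "ks ! i \<le> l \<longleftrightarrow> i < count_le ks l"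
  using assms
proof (induction ks arbitrary: i)
  case (Cons k ks)
  show ?case
  proof (cases "k \<le> l")
    case True
    then show ?thesis using Cons by (cases i) (auto simp: count_le_def)
  next
    case False
    then have "filter (\<lambda>k. k \<le> l) (k # ks) = []" using Cons.prems by (auto simp: filter_empty_conv)
    moreover have "\<not> (k # ks) ! i \<le> l" using False Cons.prems by (cases i) (auto dest!: nth_mem)
    ultimately show ?thesis by (simp add: count_le_def)
  qed
qed simp

lemma count_le_length: "count_le ks l \<le> length ks"
  by (simp add: count_le_def)

lemma count_le_all: "set ks \<subseteq> {1..r} \<Longrightarrow> count_le ks r = length ks"
  unfolding count_le_def by (subst filter_True) auto

lemma last_eq_iff_mem:
  assumes "ks \<in> subset_lists r"
  shows "ks \<noteq> [] \<and> last ks = r \<longleftrightarrow> r \<in> set ks"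
proof
  assume r: "r \<in> set ks"
  then have ne: "ks \<noteq> []" by auto
  have "set ks \<subseteq> {1..r}" using assms by (simp add: subset_lists_def)
  then have "last ks \<le> r" using last_in_set[OF ne] by auto
  moreover have "x \<le> last ks" if "x \<in> set ks" "sorted_wrt (<) ks" for x
    using that by (induction ks) (auto simp: less_imp_le)
  ultimately show "ks \<noteq> [] \<and> last ks = r" using r ne assms by (auto simp: subset_lists_def intro: antisym)
qed (use last_in_set in auto)

text \<open>Both sides express the interlacing of two sets, once by their elements in increasing order and once by counting
  functions; \<open>nth_le_iff_count_le\<close> translates between the two. The conditions on the lengths correspond to
  position \<open>r\<close>.\<close>

lemma is_edge_iff_interlaced:
  assumes r: "1 \<le> r" and ks: "ks \<in> subset_lists r" and js: "js \<in> subset_lists r"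
  shows "is_edge r (Suc s, ks) (s, js) \<longleftrightarrow> (\<forall>l\<in>{1..r}. interlaced_at (weight_index ks) (weight_index js) l)"
proof -
  have K: "sorted_wrt (<) ks" "set ks \<subseteq> {1..r}" and J: "sorted_wrt (<) js" "set js \<subseteq> {1..r}"
    using ks js by (auto simp: subset_lists_def)
  note nk = nth_le_iff_count_le[OF K(1)] and nj = nth_le_iff_count_le[OF J(1)]
  have ri: "ks ! i \<in> {1..r}" if "i < length ks" for i using that K(2) nth_mem by blast
  show ?thesis
    unfolding interlaced_at_def minus_count_weight_index[OF ks] minus_count_weight_index[OF js]
  proof
    assume e: "is_edge r (Suc s, ks) (s, js)"
    show "\<forall>l\<in>{1..r}. count_le ks l \<le> count_le js l \<and> count_le js l \<le> count_le ks (l - 1) + 1"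
    proof (intro ballI conjI)
      fix l assume l: "l \<in> {1..r}"
      show "count_le ks l \<le> count_le js l"
      proof (cases "count_le ks l")
        case (Suc i)
        then have i: "i < length ks" using count_le_length[of ks l] by simp
        then have "ks ! i \<le> l" using nk Suc by simp
        then have "js ! i \<le> l" "i < length js" using e i by (auto intro: order_trans)
        then show ?thesis using nj Suc by simp
      qed simp
      show "count_le js l \<le> count_le ks (l - 1) + 1"
      proof (rule ccontr)
        assume "\<not> count_le js l \<le> count_le ks (l - 1) + 1"
        \<comment> \<open>The index of the first entry of the upper list that is at least \<open>l\<close>.\<close>
        define i where "i = count_le ks (l - 1)"
        then have il: "i + 1 < count_le js l" using \<open>\<not> _\<close> by simp
        then have ij: "i + 1 < length js" using count_le_length[of js l] by simp
        then have ik: "i < length ks" using e by auto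
        have "js ! (i + 1) \<le> l" using nj[OF ij] il by simp
        moreover have "\<not> ks ! i \<le> l - 1" using nk[OF ik] by (simp add: i_def)
        moreover have "ks ! i < js ! (i + 1)" using e ij ik by auto
        ultimately show False by simp
      qed
    qed
  next
    assume c: "\<forall>l\<in>{1..r}. count_le ks l \<le> count_le js l \<and> count_le js l \<le> count_le ks (l - 1) + 1"
    have lk: "count_le ks r = length ks" and lj: "count_le js r = length js" using K J count_le_all by auto
    have cr: "length ks \<le> length js" "length js \<le> count_le ks (r - 1) + 1" using bspec[OF c, of r] r lk lj by auto
    then have len: "length js \<le> length ks + 1" using count_le_length[of ks "r - 1"] by simp
    have last: "length js = length ks" if last: "ks \<noteq> []" "last ks = r"
    proof -
      have "\<not> ks ! (length ks - 1) \<le> r - 1" using last r by (simp add: last_conv_nth)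
      then have "count_le ks (r - 1) \<le> length ks - 1" using nk[of "length ks - 1" "r - 1"] last by simp
      moreover have "length ks > 0" using last by simp
      ultimately show ?thesis using cr by linarith
    qed
    have "js ! i \<le> ks ! i \<and> (i + 1 < length js \<longrightarrow> ks ! i < js ! (i + 1))" if i: "i < length ks" for i
    proof (intro conjI impI)
      have "i < count_le ks (ks ! i)" using nk[OF i, of "ks ! i"] by simp
      then have "i < count_le js (ks ! i)" using c ri[OF i] by fastforce
      then show "js ! i \<le> ks ! i" using nj[of i "ks ! i"] i cr by simp
      assume ij: "i + 1 < length js"
      show "ks ! i < js ! (i + 1)"
      proof (rule ccontr)
        assume "\<not> ks ! i < js ! (i + 1)"
        then have "i + 1 < count_le js (ks ! i)" using nj[OF ij, of "ks ! i"] by simp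
        moreover have "count_le js (ks ! i) \<le> count_le ks (ks ! i - 1) + 1" using c ri[OF i] by blast
        ultimately have "i < count_le ks (ks ! i - 1)" by simp
        then have "ks ! i \<le> ks ! i - 1" using nk[OF i, of "ks ! i - 1"] by simp
        then show False using ri[OF i] by auto
      qed
    qed
    then show "is_edge r (Suc s, ks) (s, js)" using len cr last by auto
  qed
qed

lemma prod_subset_list:
  fixes f :: "nat \<Rightarrow> complex"
  assumes "ks \<in> subset_lists r"
  shows "(\<Prod>l = 1..r. if bit (weight_index ks) (l - 1) then f l else 1) = (\<Prod>i<length ks. f (ks ! i))"
proof -
  have "(\<Prod>l = 1..r. if bit (weight_index ks) (l - 1) then f l else 1) = (\<Prod>l\<in>{1..r}. if l \<in> set ks then f l else 1)"
    using bit_weight_index[OF assms] by (intro prod.cong) auto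
  also have "\<dots> = (\<Prod>l\<in>{1..r} \<inter> set ks. f l)" by (simp add: prod.inter_restrict)
  also have "{1..r} \<inter> set ks = set ks" using assms by (auto simp: subset_lists_def)
  also have "(\<Prod>l\<in>set ks. f l) = prod_list (map f ks)"
    using assms by (intro prod.distinct_set_conv_list) (auto simp: subset_lists_def strict_sorted_iff)
  finally show ?thesis by (simp add: prod.list_conv_set_nth atLeast0LessThan)
qed

lemma edge_label_eq_cycle_weight:
  assumes r: "1 \<le> r" and ks: "ks \<in> subset_lists r" and js: "js \<in> subset_lists r" and e: "is_edge r (Suc s, ks) (s, js)"
  shows "edge_label r Y (Suc s, ks) (s, js) = cycle_weight r (Y (Suc s)) 1 (weight_index ks) (weight_index js)"
proof -
  let ?y = "Y_ext Y (Suc s)"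
  have len: "minus_count (weight_index ks) r = length ks" "minus_count (weight_index js) r = length js"
    using ks js minus_count_weight_index count_le_all by (auto simp: subset_lists_def)
  have rk: "bit (weight_index ks) (r - 1) \<longleftrightarrow> ks \<noteq> [] \<and> last ks = r"
    using bit_weight_index[OF ks, of "r - 1"] r last_eq_iff_mem[OF ks] by simp
  have num: "(\<Prod>l = 1..r. if bit (weight_index ks) (l - 1) then Y (Suc s) l else 1) = (\<Prod>i<length ks. ?y (ks ! i))"
    unfolding prod_subset_list[OF ks, symmetric] by (intro prod.cong) (auto simp: Y_ext_def)
  have "(\<Prod>i<length js. ?y (js ! i - 1)) = (\<Prod>l = 1..r. if bit (weight_index js) (l - 1) then ?y (l - 1) else 1)"
    by (rule prod_subset_list[OF js, symmetric])
  also have "\<dots> = (\<Prod>l = Suc 1..r. if bit (weight_index js) (l - 1) then Y (Suc s) (l - 1) else 1)"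
    using r by (subst prod.atLeast_Suc_atMost) (auto simp: Y_ext_def intro!: prod.cong)
  finally have den: "(\<Prod>l = Suc 1..r. if bit (weight_index js) (l - 1) then Y (Suc s) (l - 1) else 1) = (\<Prod>i<length js. ?y (js ! i - 1))" by simp
  show ?thesis
  proof (cases "length js = length ks")
    case True
    then show ?thesis unfolding cycle_weight_def num den len rk using r
      by (simp add: prod_dividef Y_ext_def[of _ _ r] inverse_eq_divide)
  next
    case False
    then have l: "length js = Suc (length ks)" using e by auto
    show ?thesis unfolding cycle_weight_def num den len rk using r
      by (simp add: l prod_dividef)
  qed
qed

lemma cycle_entry:
  assumes r: "1 \<le> r" and ks: "ks \<in> subset_lists r" and js: "js \<in> subset_lists r"
    and y: "\<And>j. j \<in> {1..r} \<Longrightarrow> Y (Suc s) j \<noteq> 0"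
  shows "partial_cycle r (Y (Suc s)) 1 $$ (weight_index js, weight_index ks) =
    (if is_edge r (Suc s, ks) (s, js) then edge_label r Y (Suc s, ks) (s, js) else 0)"
  using partial_cycle_entry[OF order_refl r y weight_index_less[OF ks] weight_index_less[OF js]]
    edge_label_eq_cycle_weight[OF r ks js, of s Y] is_edge_iff_interlaced[OF r ks js, of s] by auto

definition x_cycles :: "nat \<Rightarrow> (nat \<Rightarrow> nat \<Rightarrow> complex) \<Rightarrow> nat \<Rightarrow> complex mat" where
  "x_cycles r Y m = x_L r (cyclic_word r m) (list_coords r m Y)"

lemma list_mult_Spin_append:
  assumes "set as \<subseteq> spin_mat r" "set bs \<subseteq> spin_mat r"
  shows "list_mult (Spin r) (as @ bs) = list_mult (Spin r) as * list_mult (Spin r) bs"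
    "list_mult (Spin r) as \<in> spin_mat r"
proof -
  have m: "list_mult (Spin r) cs \<in> spin_mat r" if "set cs \<subseteq> spin_mat r" for cs
    using that by (induction cs) (simp_all add: list_mult_def)
  then show "list_mult (Spin r) as \<in> spin_mat r" using assms by blast
  have "list_mult (Spin r) bs \<in> spin_mat r" using m assms by blast
  then show "list_mult (Spin r) (as @ bs) = list_mult (Spin r) as * list_mult (Spin r) bs"
    using assms(1)
  proof (induction as)
    case (Cons a as)
    then have "foldr (*) as (1\<^sub>m (2 ^ r)) \<in> spin_mat r" using m[of as] by (simp add: list_mult_def)
    then show ?case using Cons by (simp add: list_mult_def spin_mat_assoc[of _ r])
  qed (simp add: list_mult_def)
qed

lemma x_cycles_rec:
  "x_cycles r Y 0 = 1\<^sub>m (2 ^ r)"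
  "x_cycles r Y (Suc m) = x_cycles r Y m * partial_cycle r (Y (Suc m)) 1"
  "x_cycles r Y m \<in> spin_mat r"
proof -
  show "x_cycles r Y 0 = 1\<^sub>m (2 ^ r)"
    by (simp add: x_cycles_def x_L_def cyclic_word_def list_coords_def list_mult_def)
  have zip: "set (map2 (x_minus r) is ts) \<subseteq> spin_mat r" for "is" ts by auto
  have cw: "cyclic_word r (Suc m) = cyclic_word r m @ [1..<r + 1]"
    by (simp add: cyclic_word_def replicate_append_same[symmetric] del: upt_Suc)
  have lc: "list_coords r (Suc m) Y = list_coords r m Y @ map (Y (Suc m)) [1..<r + 1]"
    by (simp add: list_coords_def)
  have len: "length (list_coords r m Y) = m * r"
    by (induction m) (simp_all add: list_coords_def)
  have "map2 (x_minus r) (cyclic_word r (Suc m)) (list_coords r (Suc m) Y) =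
     map2 (x_minus r) (cyclic_word r m) (list_coords r m Y) @ map (\<lambda>j. x_minus r j (Y (Suc m) j)) [1..<r + 1]"
    unfolding cw lc using len by (simp add: length_cyclic_word zip_map2 zip_same_conv_map del: upt_Suc)
  then show "x_cycles r Y (Suc m) = x_cycles r Y m * partial_cycle r (Y (Suc m)) 1"
    unfolding x_cycles_def x_L_def partial_cycle_def
    using list_mult_Spin_append(1)[of "map2 (x_minus r) (cyclic_word r m) (list_coords r m Y)" r
      "map (\<lambda>j. x_minus r j (Y (Suc m) j)) [1..<r + 1]"] zip by (simp del: upt_Suc) force
  show "x_cycles r Y m \<in> spin_mat r"
    unfolding x_cycles_def x_L_def by (rule list_mult_Spin_append(2)[OF zip empty_subsetI[folded set_simps(1)]])
qed

lemma x_cycles_Spin: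
  assumes "\<And>s i. s \<in> {1..m} \<Longrightarrow> i \<in> {1..r} \<Longrightarrow> Y s i \<noteq> 0"
  shows "x_cycles r Y m \<in> carrier (Spin r)"
  using assms
proof (induction m)
  case 0
  then show ?case by (simp add: x_cycles_rec Spin_one_closed)
next
  case (Suc m)
  have "list_mult (Spin r) (map (\<lambda>j. x_minus r j (Y (Suc m) j)) js) \<in> carrier (Spin r)" if "set js \<subseteq> {1..r}" for js
    using that
    by (induction js) (use Suc.prems in \<open>auto simp: list_mult_def Spin_one_closed intro!: Spin_mult_closed x_minus_Spin\<close>)
  from this[of "[1..<r + 1]"] have "partial_cycle r (Y (Suc m)) 1 \<in> carrier (Spin r)"
    unfolding partial_cycle_def by fastforce
  then show ?case using Suc by (simp add: x_cycles_rec Spin_mult_closed)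
qed

text \<open>The paths from a vertex at level \<open>s\<close> to \<open>T\<close> at level \<open>0\<close>, generated in the order in which a matrix product is
  expanded.\<close>

fun walks :: "nat \<Rightarrow> nat list \<Rightarrow> nat \<Rightarrow> nat list \<Rightarrow> vertex list set" where
  "walks r T 0 ks = (if ks = T then {[(0, ks)]} else {})"
| "walks r T (Suc s) ks =
    (\<Union>js\<in>{js \<in> subset_lists r. is_edge r (Suc s, ks) (s, js)}. (#) (Suc s, ks) ` walks r T s js)"

lemma walks_props:
  assumes "p \<in> walks r T s ks"
  shows "p \<noteq> []" "hd p = (s, ks)"
  using assms by (cases s; auto split: if_splits)+

lemma finite_walks: "finite (walks r T s ks)"
  by (induction s arbitrary: ks) (auto intro: finite_subset[OF _ finite_subset_lists])

lemma path_label_Cons: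
  assumes "p \<noteq> []"
  shows "path_label r Y (v # p) = edge_label r Y v (hd p) * path_label r Y p"
proof -
  obtain w q where p: "p = w # q" using assms by (cases p) auto
  show ?thesis unfolding path_label_def p by (simp add: prod.lessThan_Suc_shift del: prod.lessThan_Suc)
qed

text \<open>Expanding the last factor of the product of cycles amounts to choosing the first edge of a path, since the
  subsets of \<open>{1..r}\<close> index the basis.\<close>

lemma sum_walks:
  assumes r: "1 \<le> r" and T: "T \<in> subset_lists r" and ks: "ks \<in> subset_lists r"
    and y: "\<And>i j. i \<in> {1..s} \<Longrightarrow> j \<in> {1..r} \<Longrightarrow> Y i j \<noteq> 0"
  shows "(\<Sum>p\<in>walks r T s ks. path_label r Y p) = x_cycles r Y s $$ (weight_index T, weight_index ks)"
  using ks y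
proof (induction s arbitrary: ks)
  case 0
  have "weight_index T = weight_index ks \<longleftrightarrow> ks = T"
    using bij_betw_imp_inj_on[OF bij_betw_weight_index[of r]] T 0 by (auto dest: inj_onD)
  then show ?case using 0 T weight_index_less by (auto simp: x_cycles_rec path_label_def)
next
  case (Suc s)
  let ?E = "{js \<in> subset_lists r. is_edge r (Suc s, ks) (s, js)}"
  let ?M = "partial_cycle r (Y (Suc s)) 1"
  have "(\<Sum>p\<in>walks r T (Suc s) ks. path_label r Y p) =
     (\<Sum>js\<in>?E. \<Sum>p\<in>(#) (Suc s, ks) ` walks r T s js. path_label r Y p)"
    unfolding walks.simps
  proof (rule sum.UNION_disjoint)
    show "finite ?E" using finite_subset_lists by auto
    show "\<forall>js\<in>?E. finite ((#) (Suc s, ks) ` walks r T s js)" using finite_walks by auto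
    show "\<forall>js\<in>?E. \<forall>js'\<in>?E. js \<noteq> js' \<longrightarrow> (#) (Suc s, ks) ` walks r T s js \<inter> (#) (Suc s, ks) ` walks r T s js' = {}"
    proof (intro ballI impI)
      fix js js' :: "nat list" assume "js \<noteq> js'"
      then have "q \<notin> walks r T s js \<or> q \<notin> walks r T s js'" for q
        using walks_props(2)[of q r T s js] walks_props(2)[of q r T s js'] by auto
      then show "(#) (Suc s, ks) ` walks r T s js \<inter> (#) (Suc s, ks) ` walks r T s js' = {}" by blast
    qed
  qed
  also have "\<dots> = (\<Sum>js\<in>?E. edge_label r Y (Suc s, ks) (s, js) * x_cycles r Y s $$ (weight_index T, weight_index js))"
  proof (rule sum.cong[OF refl])
    fix js assume js: "js \<in> ?E"
    have "(\<Sum>p\<in>(#) (Suc s, ks) ` walks r T s js. path_label r Y p) = (\<Sum>p\<in>walks r T s js. path_label r Y ((Suc s, ks) # p))"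
      by (subst sum.reindex) auto
    also have "\<dots> = (\<Sum>p\<in>walks r T s js. edge_label r Y (Suc s, ks) (s, js) * path_label r Y p)"
      using walks_props by (intro sum.cong) (auto simp: path_label_Cons)
    also have "\<dots> = edge_label r Y (Suc s, ks) (s, js) * x_cycles r Y s $$ (weight_index T, weight_index js)"
      using Suc.IH[of js] Suc.prems js by (simp add: sum_distrib_left[symmetric])
    finally show "(\<Sum>p\<in>(#) (Suc s, ks) ` walks r T s js. path_label r Y p) = \<dots>" .
  qed
  also have "\<dots> = (\<Sum>js\<in>subset_lists r. x_cycles r Y s $$ (weight_index T, weight_index js) * ?M $$ (weight_index js, weight_index ks))"
  proof -
    have M: "?M $$ (weight_index js, weight_index ks) =
      (if is_edge r (Suc s, ks) (s, js) then edge_label r Y (Suc s, ks) (s, js) else 0)"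
      if "js \<in> subset_lists r" for js
      by (rule cycle_entry[OF r Suc.prems(1) that]) (rule Suc.prems(2), simp_all)
    show ?thesis
      by (rule sum.mono_neutral_cong_left)
        (auto simp: M finite_subset_lists simp del: is_edge.simps edge_label.simps One_nat_def)
  qed
  also have "\<dots> = (\<Sum>b<2 ^ r. x_cycles r Y s $$ (weight_index T, b) * ?M $$ (b, weight_index ks))"
    by (rule sum.reindex_bij_betw[OF bij_betw_weight_index])
  also have "\<dots> = x_cycles r Y (Suc s) $$ (weight_index T, weight_index ks)"
    using mult_mat_entry[OF x_cycles_rec(3) partial_cycle_carrier weight_index_less[OF T] weight_index_less[OF Suc.prems(1)]]
    by (simp add: x_cycles_rec(2))
  finally show ?case .
qed

lemma walks_iff:
  assumes "ks \<in> subset_lists r"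
  shows "p \<in> walks r T s ks \<longleftrightarrow> p \<noteq> [] \<and> hd p = (s, ks) \<and> last p = (0, T) \<and>
    successively (is_edge r) p \<and> snd ` set p \<subseteq> subset_lists r"
  using assms
proof (induction s arbitrary: ks p)
  case 0
  show ?case
  proof (cases p)
    case (Cons v q)
    then show ?thesis using 0 by (cases q) auto
  qed auto
next
  case (Suc s)
  show ?case
  proof (cases p)
    case (Cons v q)
    show ?thesis
    proof (cases q)
      case Nil
      have "[] \<notin> walks r T s js" for js using walks_props(1)[of "[]" r T s js] by blast
      then show ?thesis using Cons Nil by auto
    next
      case (Cons w q')
      obtain s' js where w: "w = (s', js)" by (cases w)
      have "p \<in> walks r T (Suc s) ks \<longleftrightarrow>
        v = (Suc s, ks) \<and> (\<exists>js\<in>subset_lists r. is_edge r (Suc s, ks) (s, js) \<and> q \<in> walks r T s js)"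
        using \<open>p = v # q\<close> by auto
      also have "\<dots> \<longleftrightarrow> v = (Suc s, ks) \<and> (\<exists>js\<in>subset_lists r. is_edge r (Suc s, ks) (s, js) \<and>
         q \<noteq> [] \<and> hd q = (s, js) \<and> last q = (0, T) \<and> successively (is_edge r) q \<and> snd ` set q \<subseteq> subset_lists r)"
        using Suc.IH by auto
      also have "\<dots> \<longleftrightarrow> p \<noteq> [] \<and> hd p = (Suc s, ks) \<and> last p = (0, T) \<and>
         successively (is_edge r) p \<and> snd ` set p \<subseteq> subset_lists r"
        using \<open>p = v # q\<close> Cons w Suc.prems by auto
      finally show ?thesis .
    qed
  qed auto
qed

text \<open>An edge adds at most one entry, so from the empty list at level \<open>m\<close> a vertex at level \<open>s\<close> has at most
  \<open>m - s\<close> entries.\<close>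

lemma walks_length:
  assumes "p \<in> walks r T s ks" "(s', js) \<in> set p"
  shows "s' \<le> s \<and> length js \<le> length ks + (s - s')"
  using assms
proof (induction s arbitrary: ks p)
  case (Suc s)
  then obtain ls q where *: "is_edge r (Suc s, ks) (s, ls)" "q \<in> walks r T s ls" "p = (Suc s, ks) # q" by auto
  show ?case
  proof (cases "(s', js) \<in> set q")
    case True
    then show ?thesis using Suc.IH[OF *(2) True] *(1) by auto
  next
    case False
    then show ?thesis using Suc.prems(2) *(3) by auto
  qed
qed (auto split: if_splits)

lemma paths_eq_walks: "paths r m m' = walks r [1..<m' + 1] m []"
proof (rule Set.set_eqI)
  fix p
  have nil: "[] \<in> subset_lists r" by (simp add: subset_lists_def)
  have "p \<in> walks r [1..<m' + 1] m [] \<longleftrightarrow> p \<noteq> [] \<and> hd p = (m, []) \<and> last p = (0, [1..<m' + 1]) \<and>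
    successively (is_edge r) p \<and> set p \<subseteq> vertices r m"
  proof -
    have "set p \<subseteq> vertices r m" if w: "p \<in> walks r [1..<m' + 1] m []"
    proof
      fix v assume v: "v \<in> set p"
      obtain s js where sj: "v = (s, js)" by (cases v)
      have "js \<in> subset_lists r" using w v sj unfolding walks_iff[OF nil] by force
      then show "v \<in> vertices r m" using walks_length[OF w v[unfolded sj]] sj
        by (auto simp: vertices_def subset_lists_def)
    qed
    moreover have "snd ` set p \<subseteq> subset_lists r" if "set p \<subseteq> vertices r m"
    proof
      fix ks assume "ks \<in> snd ` set p"
      then obtain s where "(s, ks) \<in> set p" by auto
      then have "(s, ks) \<in> vertices r m" using that by blast
      then show "ks \<in> subset_lists r" by (simp add: vertices_def subset_lists_def)
    qed
    ultimately show ?thesis unfolding walks_iff[OF nil] by blast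
  qed
  then show "p \<in> paths r m m' \<longleftrightarrow> p \<in> walks r [1..<m' + 1] m []"
    by (auto simp: paths_def successively_conv_nth)
qed

lemma weight_index_upt: "m \<le> r \<Longrightarrow> weight_index [1..<m + 1] = mask m"
proof (rule bit_eqI)
  fix n assume "m \<le> r"
  then have "[1..<m + 1] \<in> subset_lists r" by (auto simp: subset_lists_def simp del: upt_Suc)
  from bit_weight_index[OF this] show "bit (weight_index [1..<m + 1]) n \<longleftrightarrow> bit (mask m :: nat) n"
    by (auto simp: bit_mask_iff simp del: upt_Suc)
qed

lemma take_cyclic_word:
  assumes "m' \<le> m"
  shows "take (m' * r) (cyclic_word r m) = cyclic_word r m'"
proof -
  have "cyclic_word r m = cyclic_word r m' @ cyclic_word r (m - m')"
    using assms by (simp add: cyclic_word_def concat_append[symmetric] replicate_add[symmetric] del: concat_append)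
  then show ?thesis by (simp add: length_cyclic_word)
qed

lemma cyclic_word_last_letter:
  assumes "1 \<le> r" "1 \<le> m'" "m' \<le> m"
  shows "cyclic_word r m ! (m' * r - 1) = r"
proof -
  obtain q where q: "m' = Suc q" using assms(2) by (cases m') auto
  have *: "cyclic_word r m' = cyclic_word r q @ [1..<r + 1]"
    by (simp add: q cyclic_word_def replicate_append_same[symmetric] del: upt_Suc)
  have "cyclic_word r m ! (m' * r - 1) = take (m' * r) (cyclic_word r m) ! (m' * r - 1)"
    using assms by simp
  also have "\<dots> = (cyclic_word r q @ [1..<r + 1]) ! (q * r + (r - 1))"
    unfolding take_cyclic_word[OF assms(3)] * using assms(1) q by (simp add: add.commute del: upt_Suc)
  also have "\<dots> = [1..<r + 1] ! (r - 1)"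
    using length_cyclic_word[of r q] nth_append_length_plus[of "cyclic_word r q" "[1..<r + 1]" "r - 1"] by metis
  also have "\<dots> = r" using assms(1) by (simp del: upt_Suc)
  finally show ?thesis .
qed

theorem proposition6p20:
  fixes r m m' n k :: nat and Y :: "nat \<Rightarrow> nat \<Rightarrow> complex"
  assumes "1 \<le> m'" and "m' \<le> m" and "m \<le> r"
    and "n = m * r" and "k = m' * r"
    and "u = list_mult (weyl_group r) (replicate m (weyl_word r [1..<r + 1]))"
    and "\<And>s i. s \<in> {1..m} \<Longrightarrow> i \<in> {1..r} \<Longrightarrow> Y s i \<noteq> 0"
  shows "reduced_word r u (cyclic_word r m) \<and> length (cyclic_word r m) = n \<and>
    minor_L r k (cyclic_word r m) (list_coords r m Y) = (\<Sum>p\<in>paths r m m'. path_label r Y p)"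
proof (intro conjI)
  have r: "1 \<le> r" and m': "m' \<le> r" using assms(1-3) by auto
  have "u = weyl_word r (cyclic_word r m)"
  proof -
    have "set js \<subseteq> {1..r}" if "js \<in> set (replicate m [1..<r + 1])" for js
      using that by (auto simp del: upt_Suc)
    from weyl_word_concat[of "replicate m [1..<r + 1]" r, OF this] show ?thesis by (simp add: assms(6) cyclic_word_def del: upt_Suc)
  qed
  then show "reduced_word r u (cyclic_word r m)" using reduced_cyclic_word[OF assms(3)] by simp
  show "length (cyclic_word r m) = n" using length_cyclic_word assms(4) by simp
  have T: "[1..<m' + 1] \<in> subset_lists r" "[] \<in> subset_lists r"
    using m' by (auto simp: subset_lists_def simp del: upt_Suc)
  have "minor_L r k (cyclic_word r m) (list_coords r m Y) =
      gen_minor r (weyl_word r (cyclic_word r m')) r (x_cycles r Y m)"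
    unfolding minor_L_def minor_at_def assms(5) take_cyclic_word[OF assms(2)]
      cyclic_word_last_letter[OF r assms(1,2)] x_cycles_def ..
  also have "\<dots> = x_cycles r Y m $$ (mask m', 0)"
    by (rule gen_minor_cyclic_word[OF m' r x_cycles_Spin[OF assms(7)]])
  also have "\<dots> = x_cycles r Y m $$ (weight_index [1..<m' + 1], weight_index [])"
  proof -
    have "weight_index [] = 0" by (simp add: weight_index_def)
    then show ?thesis by (simp only: weight_index_upt[OF m'])
  qed
  also have "\<dots> = (\<Sum>p\<in>walks r [1..<m' + 1] m []. path_label r Y p)"
    by (rule sum_walks[OF r T assms(7), symmetric])
  finally show "minor_L r k (cyclic_word r m) (list_coords r m Y) = (\<Sum>p\<in>paths r m m'. path_label r Y p)"
    by (simp only: paths_eq_walks)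
qed

end
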